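(* Let $\mathbb K$ be a number field and let $\alpha\in\overline{\mathbb Q}^*$ be such that $[\mathbb K(\alpha):\mathbb Q]=:d\ge 1$. For any $H\ge 1$, any integer $\delta\ge 1$, any integer $p$ such that $p\ge d\delta$, and any $P\in\mathcal O_{\mathbb K}[X]\setminus\{0\}$ of degree $\le\delta$ and height $H(P)\le H$, we have $$\left\vert P(e^{\alpha})\right\vert\ \ge\ \frac{1}{(2a^d)^{1+\frac{\delta d}{p-d\delta+1}}\,\big(b^{\,d+\frac{\delta d^2}{p-d\delta+1}}\big)^{1+v^2}\,u^{\left(d+\frac{\delta d^2}{p-d\delta+1}\right)\frac{4\ln(b)}{\ln\ln(u+2)}}\,H^{\psi(d,\delta,p)}},$$ where $$q:=\mathrm{lcm}(1,2,\ldots,p)\times d(1/\alpha),\qquad t:=\max\big(1,h(1/\alpha)\big),$$ $$a:=(p+1)!\,e^{\vert\alpha\vert p(p+1)/2}(2qt)^{p\delta},\qquad b:=(2qt)^{(p+1)\delta},$$ $$u:=\left(2a^dH^{(p-\delta+1)d}\right)^{1/(p-d\delta+1)},\qquad v:=b^{d/(p-d\delta+1)}e,$$ $$\psi(d,\delta,p):=\frac{\delta d^2(p-\delta+1)}{p-\delta d+1}+d(p-\delta+1)-1,$$ and where $d(1/\alpha)$ denotes the denominator of $1/\alpha$ and $h(1/\alpha)$ the house of $1/\alpha$.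
   Context: The field $\overline{\mathbb Q}$ of algebraic numbers is embedded in $\mathbb C$ (so number fields are subfields of $\mathbb C$), and $\overline{\mathbb Q}^*=\overline{\mathbb Q}\setminus\{0\}$. $\mathcal O_{\mathbb K}$ is the ring of integers of $\mathbb K$. For an algebraic number $\beta$, its house $h(\beta)$ is the maximum of the moduli of $\beta$ and of all its Galois conjugates over $\mathbb Q$; its denominator $d(\beta)\ge 1$ is the least positive integer $m$ such that $m\beta$ is an algebraic integer (the notation $d(\cdot)$ for the denominator is not to be confused with the integer $d=[\mathbb K(\alpha):\mathbb Q]$). For $P(X)=\sum_j a_jX^j\in\overline{\mathbb Q}[X]$, the height $H(P)$ is the maximum over $j$ of the houses $h(a_j)$ of the coefficients. In the definition of $v$, $e$ is the base of the natural logarithm $\ln$. *)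

theory Defs
  imports Complex_Main "HOL-Computational_Algebra.Computational_Algebra"
begin

global_interpretation rat_complex: vector_space "\<lambda>(r::rat) (z::complex). of_rat r * z"
  by unfold_locales (simp_all add: algebra_simps of_rat_add of_rat_mult)

definition complex_subfield :: "complex set \<Rightarrow> bool" where
  "complex_subfield K \<longleftrightarrow> 0 \<in> K \<and> 1 \<in> K \<and>
     (\<forall>x\<in>K. \<forall>y\<in>K. x + y \<in> K \<and> x * y \<in> K) \<and>
     (\<forall>x\<in>K. - x \<in> K \<and> inverse x \<in> K)"

text \<open>Number fields are subfields of the complex numbers. The finiteness condition has to be
  stated separately because \<^const>\<open>rat_complex.dim\<close> is \<open>0\<close> on infinite-dimensional subspaces.\<close>

definition number_field :: "complex set \<Rightarrow> bool" where
  "number_field K \<longleftrightarrow> complex_subfield K \<and> (\<exists>B. finite B \<and> rat_complex.span B = K)"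

definition field_adjoin :: "complex set \<Rightarrow> complex \<Rightarrow> complex set" where
  "field_adjoin K \<alpha> = complex_subfield hull (insert \<alpha> K)"

definition ring_of_integers :: "complex set \<Rightarrow> complex set" where
  "ring_of_integers K = {x \<in> K. algebraic_int x}"

text \<open>The roots of the minimal polynomial over the rationals, which is the irreducible rational
  polynomial vanishing at \<open>\<beta>\<close>, unique up to a constant factor. In particular \<open>\<beta>\<close> is among its
  own conjugates when it is algebraic.\<close>

definition galois_conjugates :: "complex \<Rightarrow> complex set" where
  "galois_conjugates \<beta> = {z. \<exists>f :: rat poly. irreducible f \<and>
     poly (map_poly of_rat f) \<beta> = 0 \<and> poly (map_poly of_rat f) z = 0}"

text \<open>The next three notions are only meaningful for algebraic numbers, respectively polynomials
  with algebraic coefficients.\<close>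

definition house :: "complex \<Rightarrow> real" where
  "house \<beta> = Max (cmod ` galois_conjugates \<beta>)"

definition alg_denominator :: "complex \<Rightarrow> nat" where
  "alg_denominator \<beta> = (LEAST m. 1 \<le> m \<and> algebraic_int (of_nat m * \<beta>))"

definition poly_height :: "complex poly \<Rightarrow> real" where
  "poly_height P = Max ((\<lambda>j. house (coeff P j)) ` {..degree P})"

end

theory Submission
  imports Defs "HOL-Analysis.FPS_Convergence" "Jordan_Normal_Form.Char_Poly"
begin

text \<open>The method is that of Siegel and Mahler: a determinant formed from two families of linear forms in the powers
\<open>1, e\<^sup>\<alpha>, \<dots>\<close> of \<open>e\<^sup>\<alpha>\<close> up to the exponent \<open>p\<close> is a nonzero algebraic integer, hence not too small.

For a parameter \<open>n\<close> and each \<open>l \<le> p\<close>, the partial fraction expansion of the rational function with a pole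
of order \<open>n + 1\<close> at \<open>l\<close> and poles of order \<open>n\<close> at the other integers between \<open>0\<close> and \<open>p\<close> yields an explicit
Hermite-Pade form \<open>\<Sum>j\<le>p. A l j e\<^sup>j\<^sup>z\<close>. Its coefficients are polynomials in \<open>z\<close> of degree at most \<open>n\<close>, and it vanishes at
\<open>z = 0\<close> to the order \<open>N = (p + 1) n\<close> (\<open>approximants_exist\<close>), so that its value at \<open>\<alpha>\<close> is about as small
as \<open>\<bar>\<alpha>\<bar>\<^sup>N / N!\<close> (\<open>approximants_value_bound\<close>). The determinant of the coefficients is a
polynomial in \<open>z\<close> of degree at most \<open>N\<close>, divisible by \<open>z\<^sup>N\<close>, with an explicit nonzero
coefficient at \<open>z\<^sup>N\<close>; so it does not vanish at \<open>\<alpha>\<close>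
(\<open>approximants_det_nonzero\<close>). Multiplication by
\<open>n! / \<alpha>\<^sup>n\<close>, by a power of \<open>lcm(1, \<dots>, p)\<close> and by a power of the denominator of \<open>1 / \<alpha>\<close> turns the coefficients into
algebraic integers of \<open>K(\<alpha>)\<close> whose conjugates are at most \<open>n! (2 q t)\<^sup>N\<close> (\<open>scaled_approximants\<close>).

On the other hand the polynomials \<open>X\<^sup>i P\<close>, \<open>i \<le> p - \<delta>\<close>, give \<open>p - \<delta> + 1\<close> linearly independent forms whose
values are multiples of \<open>P(e\<^sup>\<alpha>)\<close>. They can be completed by \<open>\<delta>\<close> of the Hermite-Pade forms to a system
with nonzero determinant \<open>\<Delta>\<close> (\<open>independent_rows_complete\<close>). As \<open>\<Delta>\<close> is a nonzero algebraic integer of a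
field of degree \<open>d\<close>, the product of its conjugates has modulus at least \<open>1\<close>
(\<open>product_of_conjugates_ge_1\<close>), and the conjugates are bounded because the entries of the matrix have bounded
conjugates. But \<open>\<Delta>\<close> does not change when the first column is replaced by the values of the forms
at \<open>e\<^sup>\<alpha>\<close>, so \<open>\<Delta>\<close> itself is small unless \<open>\<bar>P(e\<^sup>\<alpha>)\<bar>\<close> is large (\<open>determinant_inequality\<close>).

Write \<open>D = p - d \<delta> + 1\<close>, which is positive since \<open>p \<ge> d \<delta>\<close>. In the resulting inequality, the term coming from the Hermite-Pade
forms is at most \<open>a\<^sup>d b\<^sup>n\<^sup>d H\<^sup>m / (n!)\<^sup>D\<close> with \<open>m = (p - \<delta> + 1) d\<close>, and this is at most \<open>1/2\<close> as
soon as \<open>n! \<ge> u \<beta>\<^sup>n\<close>, where \<open>\<beta>\<^sup>D = b\<^sup>d\<close>. The least such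
\<open>n\<close> is at most \<open>1 + v\<^sup>2 + 4 ln u / ln ln (u + 2)\<close> (\<open>parameter_choice\<close>), which produces the
stated bound.\<close>

(* Here det, mat and $ refer to matrices with explicit dimensions and to formal power series. *)
hide_const (open) Finite_Cartesian_Product.mat
no_notation vec_index (infixl "$" 100)
unbundle no vec_syntax

section \<open>Algebraic integers\<close>

interpretation of_rat_poly_hom: map_poly_inj_idom_hom "of_rat :: rat \<Rightarrow> complex" ..

interpretation int_complex: Modules.module "\<lambda>(k::int) (z::complex). of_int k * z"
  by unfold_locales (simp_all add: algebra_simps)

text \<open>The determinant trick: multiplication by \<open>x\<close> is given on the generators \<open>G\<close> by an integer matrix,
for which \<open>x\<close> is an eigenvalue, so \<open>x\<close> is a root of a monic characteristic polynomial.\<close>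

lemma algebraic_int_if_stable_lattice:
  fixes x :: complex
  assumes "finite G" and g0: "g0 \<in> G" "g0 \<noteq> 0"
    and stable: "\<And>g. g \<in> G \<Longrightarrow> x * g \<in> int_complex.span G"
  shows "algebraic_int x"
proof -
  obtain n h where h: "bij_betw h {0..<n::nat} G"
    using ex_bij_betw_nat_finite[OF \<open>finite G\<close>] by blast
  have "\<forall>g\<in>G. \<exists>u. x * g = (\<Sum>v\<in>G. of_int (u v) * v)"
    using stable by (auto simp: int_complex.span_finite[OF \<open>finite G\<close>])
  then obtain U where U: "\<And>g. g \<in> G \<Longrightarrow> x * g = (\<Sum>v\<in>G. of_int (U g v) * v)"
    by metis
  define A :: "int mat" where "A = mat n n (\<lambda>(i, j). U (h i) (h j))"
  define w :: "complex vec" where "w = vec n h"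
  have A: "A \<in> carrier_mat n n" and A': "map_mat of_int A \<in> carrier_mat n n"
    by (auto simp: A_def)
  have hG: "h i \<in> G" if "i < n" for i
    using h that by (auto simp: bij_betw_def)
  have "eigenvector (map_mat complex_of_int A) w x"
    unfolding eigenvector_def
  proof (intro conjI)
    show "w \<in> carrier_vec (dim_row (map_mat complex_of_int A))"
      by (simp add: A_def w_def)
    obtain i where i: "i < n" "h i = g0"
      using g0 h by (auto simp: bij_betw_def)
    then have "vec_index w i \<noteq> vec_index (0\<^sub>v n) i" using g0 by (simp add: w_def)
    then show "w \<noteq> 0\<^sub>v (dim_row (map_mat complex_of_int A))"
      by (auto simp: A_def)
    show "map_mat complex_of_int A *\<^sub>v w = x \<cdot>\<^sub>v w"
    proof (rule eq_vecI)
      fix i assume "i < dim_vec (x \<cdot>\<^sub>v w)"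
      then have i: "i < n" by (simp add: w_def)
      have "x * h i = (\<Sum>j = 0..<n. of_int (U (h i) (h j)) * h j)"
        using U[OF hG[OF i]] sum.reindex_bij_betw[OF h, of "\<lambda>v. of_int (U (h i) v) * v"] by simp
      then show "vec_index (map_mat complex_of_int A *\<^sub>v w) i = vec_index (x \<cdot>\<^sub>v w) i"
        using i by (simp add: A_def w_def scalar_prod_def)
    qed (simp add: A_def w_def)
  qed
  then have "eigenvalue (map_mat complex_of_int A) x"
    by (auto simp: eigenvalue_def)
  then have "poly (map_poly of_int (char_poly A)) x = 0"
    using eigenvalue_root_char_poly[OF A'] of_int_hom.char_poly_hom[OF A] by metis
  moreover have "lead_coeff (char_poly A) = 1"
    using degree_monic_char_poly[OF A] by simp
  ultimately show ?thesis
    by (auto simp: algebraic_int_altdef_ipoly)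
qed

lemma algebraic_int_power_relation:
  assumes "algebraic_int (x::complex)"
  obtains m a where "0 < m" "x ^ m = (\<Sum>i<m. of_int (a i) * x ^ i)"
proof -
  obtain p where p: "poly (map_poly of_int p) x = 0" "lead_coeff p = 1"
    using assms by (auto simp: algebraic_int_altdef_ipoly)
  have "(\<Sum>i\<le>degree p. of_int (coeff p i) * x ^ i) = 0"
    using p(1) by (simp add: poly_altdef)
  moreover have "{..degree p} = insert (degree p) {..<degree p}" by auto
  ultimately have "x ^ degree p + (\<Sum>i<degree p. of_int (coeff p i) * x ^ i) = 0"
    using p(2) by simp
  then have "x ^ degree p = - (\<Sum>i<degree p. of_int (coeff p i) * x ^ i)"
    by (simp only: eq_neg_iff_add_eq_0)
  then have "x ^ degree p = (\<Sum>i<degree p. of_int (- coeff p i) * x ^ i)"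
    by (simp add: sum_negf)
  moreover have "0 < degree p"
  proof (rule ccontr)
    assume "\<not> 0 < degree p"
    then have "degree p = 0" by simp
    then obtain c where "p = [:c:]" by (rule degree_eq_zeroE)
    with p show False by simp
  qed
  ultimately show ?thesis using that[of "degree p" "\<lambda>i. - coeff p i"] by simp
qed

lemma algebraic_int_if_power_relation:
  assumes "0 < m" "x ^ m = (\<Sum>i<m. of_int (a i) * x ^ i)"
  shows "algebraic_int (x::complex)"
proof (rule algebraic_int_if_stable_lattice[of "(\<lambda>i. x ^ i) ` {..<m}" 1])
  show "1 \<in> (\<lambda>i. x ^ i) ` {..<m}"
    by (rule image_eqI[of _ _ 0]) (use assms(1) in auto)
  fix g assume "g \<in> (\<lambda>i. x ^ i) ` {..<m}"
  then obtain i where i: "i < m" "g = x ^ i" by auto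
  show "x * g \<in> int_complex.span ((\<lambda>i. x ^ i) ` {..<m})"
  proof (cases "Suc i < m")
    case True
    then show ?thesis using i by (intro int_complex.span_base) (auto simp flip: power_Suc)
  next
    case False
    then have "x * g = x ^ m" using i by (metis Suc_lessI power_Suc)
    also have "\<dots> \<in> int_complex.span ((\<lambda>i. x ^ i) ` {..<m})"
      unfolding assms(2) by (intro int_complex.span_sum int_complex.span_scale int_complex.span_base) auto
    finally show ?thesis .
  qed
qed auto

text \<open>The products \<open>x\<^sup>i y\<^sup>j\<close> with bounded exponents generate a lattice that is stable under multiplication
by both \<open>x\<close> and \<open>y\<close>, hence also by \<open>x + y\<close> and \<open>x y\<close>.\<close>

lemma algebraic_int_plus_times:
  assumes x: "algebraic_int (x::complex)" and y: "algebraic_int y"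
  shows "algebraic_int (x + y)" and "algebraic_int (x * y)"
proof -
  obtain m a where m: "0 < m" "x ^ m = (\<Sum>i<m. of_int (a i) * x ^ i)"
    using algebraic_int_power_relation[OF x] .
  obtain n b where n: "0 < n" "y ^ n = (\<Sum>i<n. of_int (b i) * y ^ i)"
    using algebraic_int_power_relation[OF y] .
  define G where "G = (\<lambda>(i, j). x ^ i * y ^ j) ` ({..<m} \<times> {..<n})"
  have G: "x ^ i * y ^ j \<in> int_complex.span G" if "i < m" "j < n" for i j
    by (rule int_complex.span_base) (use that in \<open>auto simp: G_def\<close>)
  have xG: "x * g \<in> int_complex.span G" if g: "g \<in> G" for g
  proof -
    obtain i j where ij: "i < m" "j < n" "g = x ^ i * y ^ j"
      using g by (auto simp: G_def)
    show ?thesis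
    proof (cases "Suc i < m")
      case True
      then show ?thesis using G[of "Suc i" j] ij by (simp add: mult.assoc)
    next
      case False
      then have "m = Suc i" using ij by simp
      then have "x * g = x ^ m * y ^ j" using ij by (simp add: mult.assoc)
      also have "\<dots> = (\<Sum>i<m. of_int (a i) * (x ^ i * y ^ j))"
        unfolding m(2) by (simp add: sum_distrib_right mult.assoc)
      also have "\<dots> \<in> int_complex.span G"
        by (intro int_complex.span_sum int_complex.span_scale G) (use ij in auto)
      finally show ?thesis .
    qed
  qed
  have yG: "y * g \<in> int_complex.span G" if g: "g \<in> G" for g
  proof -
    obtain i j where ij: "i < m" "j < n" "g = x ^ i * y ^ j"
      using g by (auto simp: G_def)
    show ?thesis
    proof (cases "Suc j < n")
      case True
      then show ?thesis using G[of i "Suc j"] ij by (simp add: mult_ac)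
    next
      case False
      then have "n = Suc j" using ij by simp
      then have "y * g = x ^ i * y ^ n" using ij by (simp add: mult_ac)
      also have "\<dots> = (\<Sum>j<n. of_int (b j) * (x ^ i * y ^ j))"
        unfolding n(2) by (simp add: sum_distrib_left mult_ac)
      also have "\<dots> \<in> int_complex.span G"
        by (intro int_complex.span_sum int_complex.span_scale G) (use ij in auto)
      finally show ?thesis .
    qed
  qed
  have xS: "x * s \<in> int_complex.span G" if "s \<in> int_complex.span G" for s
    using that
  proof (induction rule: int_complex.span_induct_alt)
    case base
    then show ?case by (simp add: int_complex.span_zero)
  next
    case (step c g s)
    have "x * (of_int c * g + s) = of_int c * (x * g) + x * s" by (simp add: algebra_simps)
    moreover have "of_int c * (x * g) + x * s \<in> int_complex.span G"
      using int_complex.span_add[OF int_complex.span_scale[OF xG[OF step(1)]] step(2)] .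
    ultimately show ?case by (simp only:)
  qed
  have fin: "finite G" by (simp add: G_def)
  have one: "1 \<in> G"
    unfolding G_def by (rule image_eqI[of _ _ "(0, 0)"]) (use m(1) n(1) in auto)
  show "algebraic_int (x + y)"
  proof (rule algebraic_int_if_stable_lattice[OF fin one one_neq_zero])
    fix g assume g: "g \<in> G"
    show "(x + y) * g \<in> int_complex.span G"
      unfolding distrib_right by (rule int_complex.span_add[OF xG[OF g] yG[OF g]])
  qed
  show "algebraic_int (x * y)"
  proof (rule algebraic_int_if_stable_lattice[OF fin one one_neq_zero])
    fix g assume g: "g \<in> G"
    show "x * y * g \<in> int_complex.span G"
      unfolding mult.assoc by (rule xS[OF yG[OF g]])
  qed
qed

lemma algebraic_int_sum:
  "(\<And>i. i \<in> I \<Longrightarrow> algebraic_int (f i :: complex)) \<Longrightarrow> algebraic_int (sum f I)"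
  by (induction I rule: infinite_finite_induct) (auto intro: algebraic_int_plus_times)

lemma algebraic_int_of_int [simp]: "algebraic_int (of_int k :: complex)"
  by (rule int_imp_algebraic_int) simp

lemma algebraic_int_prod:
  "(\<And>i. i \<in> I \<Longrightarrow> algebraic_int (f i :: complex)) \<Longrightarrow> algebraic_int (prod f I)"
  by (induction I rule: infinite_finite_induct)
    (auto intro: algebraic_int_plus_times simp: int_imp_algebraic_int)

lemma algebraic_int_power: "algebraic_int (x::complex) \<Longrightarrow> algebraic_int (x ^ n)"
  using algebraic_int_prod[of "{..<n}" "\<lambda>_. x"] by simp

section \<open>Subfields and minimal polynomials\<close>

lemma complex_subfieldD:
  assumes "complex_subfield K"
  shows "0 \<in> K" "1 \<in> K" "x \<in> K \<Longrightarrow> y \<in> K \<Longrightarrow> x + y \<in> K" "x \<in> K \<Longrightarrow> y \<in> K \<Longrightarrow> x * y \<in> K"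
    "x \<in> K \<Longrightarrow> - x \<in> K" "x \<in> K \<Longrightarrow> inverse x \<in> K"
  using assms by (auto simp: complex_subfield_def)

lemma complex_subfield_diff:
  "complex_subfield K \<Longrightarrow> x \<in> K \<Longrightarrow> y \<in> K \<Longrightarrow> x - y \<in> K"
  using complex_subfieldD(3)[of K x "- y"] complex_subfieldD(5)[of K y] by simp

lemma complex_subfield_power: "complex_subfield K \<Longrightarrow> x \<in> K \<Longrightarrow> x ^ n \<in> K"
  by (induction n) (auto intro: complex_subfieldD)

lemma complex_subfield_sum:
  "complex_subfield K \<Longrightarrow> (\<And>i. i \<in> I \<Longrightarrow> f i \<in> K) \<Longrightarrow> sum f I \<in> K"
  by (induction I rule: infinite_finite_induct) (auto intro: complex_subfieldD)

lemma complex_subfield_prod: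
  "complex_subfield K \<Longrightarrow> (\<And>i. i \<in> I \<Longrightarrow> f i \<in> K) \<Longrightarrow> prod f I \<in> K"
  by (induction I rule: infinite_finite_induct) (auto intro: complex_subfieldD)

lemma complex_subfield_of_int: "complex_subfield K \<Longrightarrow> of_int k \<in> K"
proof -
  assume K: "complex_subfield K"
  have "of_nat n \<in> K" for n
    by (induction n) (auto intro: complex_subfieldD[OF K])
  then show ?thesis
    by (cases k) (auto simp: complex_subfieldD(5)[OF K] simp del: of_nat_Suc)
qed

lemma complex_subfield_of_rat: "complex_subfield K \<Longrightarrow> of_rat r \<in> K"
  by (cases r) (auto simp: of_rat_rat divide_inverse intro!: complex_subfieldD complex_subfield_of_int)

lemma rat_subspace_subfield: "complex_subfield K \<Longrightarrow> rat_complex.subspace K"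
  by (auto simp: rat_complex.subspace_def complex_subfield_of_rat complex_subfieldD)

lemma poly_in_subfield:
  assumes "complex_subfield K" "\<And>i. coeff f i \<in> K" "x \<in> K"
  shows "poly f x \<in> K"
  unfolding poly_altdef
  by (intro complex_subfield_sum complex_subfieldD(4) complex_subfield_power assms)

lemma complex_subfield_Rats: "complex_subfield \<rat>"
  by (auto simp: complex_subfield_def)

lemma complex_subfield_hull: "complex_subfield (complex_subfield hull S)"
  by (rule hull_in) (auto simp: complex_subfield_def)

lemma poly_eq_sum_atMost:
  fixes x :: "'a::comm_semiring_1"
  shows "degree f \<le> d \<Longrightarrow> poly f x = (\<Sum>i\<le>d. coeff f i * x ^ i)"
  unfolding poly_altdef by (intro sum.mono_neutral_left) (auto simp: coeff_eq_0)

text \<open>The powers \<open>1, x, \<dots>, x\<^sup>d\<close> are too many to be independent in a space of dimension \<open>d\<close>. The bound on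
the degree is what later limits the number of conjugates of an element by the dimension of the field.\<close>

lemma rational_poly_vanishing_at_element:
  assumes "finite B" and pow: "\<And>i. x ^ i \<in> rat_complex.span B"
  obtains f :: "rat poly" where "f \<noteq> 0" "degree f \<le> rat_complex.dim (rat_complex.span B)"
    "poly (map_poly of_rat f) x = 0"
proof -
  obtain C where C: "C \<subseteq> rat_complex.span B" "rat_complex.independent C"
     "rat_complex.span B \<subseteq> rat_complex.span C" "card C = rat_complex.dim (rat_complex.span B)"
    using rat_complex.basis_exists by blast
  have "finite C" using rat_complex.independent_span_bound[OF \<open>finite B\<close> C(2) C(1)] by blast
  define d where "d = card C"
  have deg: "degree (\<Sum>i\<le>d. monom (c i) i :: rat poly) \<le> d" for c
    by (intro degree_sum_le) (auto intro: order.trans[OF degree_monom_le])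
  have coef: "coeff (\<Sum>i\<le>d. monom (c i) i :: rat poly) k = (if k \<le> d then c k else 0)" for c k
    by (simp add: coeff_sum)
  have ev: "poly (map_poly of_rat (\<Sum>i\<le>d. monom (c i) i)) x = (\<Sum>i\<le>d. of_rat (c i) * x ^ i)" for c
    using deg[of c] by (subst poly_eq_sum_atMost[of _ d]) (auto simp: coef coeff_map_poly degree_map_poly intro: sum.cong)
  have "\<exists>c. (\<exists>i\<le>d. c i \<noteq> 0) \<and> (\<Sum>i\<le>d. of_rat (c i) * x ^ i) = 0"
  proof (cases "inj_on (\<lambda>i. x ^ i) {..d}")
    case False
    then obtain i j where ij: "i \<le> d" "j \<le> d" "i \<noteq> j" "x ^ i = x ^ j"
      by (auto simp: inj_on_def)
    define c where "c = (\<lambda>k. (if k = i then 1 else 0) - (if k = j then 1 else 0) :: rat)"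
    have "(\<Sum>k\<le>d. of_rat (c k) * x ^ k) = (\<Sum>k\<le>d. (if k = i then x ^ k else 0) - (if k = j then x ^ k else 0))"
      by (intro sum.cong) (auto simp: c_def)
    also have "\<dots> = 0" using ij by (simp add: sum_subtractf)
    finally show ?thesis using ij by (intro exI[of _ c]) (auto simp: c_def)
  next
    case True
    define S where "S = (\<lambda>i. x ^ i) ` {..d}"
    have "card S = Suc d" using True by (simp add: S_def card_image)
    then have "rat_complex.dependent S"
      using rat_complex.independent_span_bound[OF \<open>finite C\<close>, of S] C(3) pow
      by (auto simp: S_def d_def)
    then obtain u where u: "\<exists>v\<in>S. u v \<noteq> 0" "(\<Sum>v\<in>S. of_rat (u v) * v) = 0"
      using rat_complex.dependent_finite[of S] by (auto simp: S_def)
    then show ?thesis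
      by (intro exI[of _ "\<lambda>i. u (x ^ i)"]) (auto simp: S_def sum.reindex[OF True])
  qed
  then obtain c i where c: "i \<le> d" "c i \<noteq> 0" "(\<Sum>i\<le>d. of_rat (c i) * x ^ i) = 0" by blast
  show ?thesis
  proof (rule that)
    have "coeff (\<Sum>i\<le>d. monom (c i) i) i \<noteq> 0" using c coef by simp
    then show "(\<Sum>i\<le>d. monom (c i) i) \<noteq> 0" by auto
  qed (use c ev deg C(4) in \<open>auto simp: d_def\<close>)
qed


text \<open>A nonzero polynomial of least degree vanishing at \<open>x\<close>: division with remainder shows that it divides
all others, and minimality that it is irreducible.\<close>

lemma rat_minimal_poly:
  fixes g :: "rat poly"
  assumes "g \<noteq> 0" "poly (map_poly of_rat g) (x::complex) = 0"
  obtains f :: "rat poly" where "irreducible f" "poly (map_poly of_rat f) x = 0"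
    "\<And>g. poly (map_poly of_rat g) x = 0 \<Longrightarrow> f dvd g"
proof -
  obtain f :: "rat poly" where f: "f \<noteq> 0" "poly (map_poly of_rat f) x = 0"
    and min: "\<And>g. g \<noteq> 0 \<Longrightarrow> poly (map_poly of_rat g) x = 0 \<Longrightarrow> degree f \<le> degree g"
    using ex_has_least_nat[of "\<lambda>g. g \<noteq> 0 \<and> poly (map_poly of_rat g) x = 0" g degree] assms
    by blast
  have dvd: "f dvd g" if "poly (map_poly of_rat g) x = 0" for g
  proof (rule ccontr)
    assume "\<not> f dvd g"
    then have nz: "g mod f \<noteq> 0" by (simp add: dvd_eq_mod_eq_0)
    have "poly (map_poly of_rat (g div f * f + g mod f)) x = 0"
      using that by simp
    then have "poly (map_poly of_rat (g mod f)) x = 0"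
      using f(2) by (simp only: of_rat_poly_hom.hom_add of_rat_poly_hom.hom_mult poly_add poly_mult)
        simp
    from min[OF nz this] degree_mod_less[OF f(1), of g] nz show False by auto
  qed
  have irr: "irreducible f"
  proof (rule irreducibleI)
    show "f \<noteq> 0" by fact
    show "\<not> f dvd 1"
    proof
      assume "f dvd 1"
      then obtain h where "f * h = 1" by (metis dvdE)
      then have "poly (map_poly of_rat f * map_poly of_rat h) x = 1"
        by (metis of_rat_poly_hom.hom_mult of_rat_poly_hom.hom_one poly_1)
      with f(2) show False by simp
    qed
    fix a b assume ab: "f = a * b"
    then have [simp]: "a \<noteq> 0" "b \<noteq> 0" using f(1) by auto
    have "poly (map_poly of_rat a) x * poly (map_poly of_rat b) x = 0"
      using f(2) unfolding ab by (simp only: of_rat_poly_hom.hom_mult poly_mult)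
    then consider "poly (map_poly of_rat a) x = 0" | "poly (map_poly of_rat b) x = 0" by auto
    then show "a dvd 1 \<or> b dvd 1"
    proof cases
      case 1
      then have "degree f \<le> degree a" by (intro min) auto
      then have "degree b = 0" unfolding ab by (simp add: degree_mult_eq)
      then show ?thesis by (simp add: is_unit_iff_degree)
    next
      case 2
      then have "degree f \<le> degree b" by (intro min) auto
      then have "degree a = 0" unfolding ab by (simp add: degree_mult_eq)
      then show ?thesis by (simp add: is_unit_iff_degree)
    qed
  qed
  show ?thesis using that[OF irr f(2) dvd] .
qed

lemma irreducible_root_dvd:
  fixes f g :: "rat poly"
  assumes f: "irreducible f" "poly (map_poly of_rat f) (x::complex) = 0"
    and g: "poly (map_poly of_rat g) x = 0"
  shows "f dvd g"
proof -
  have "f \<noteq> 0" using f(1) by auto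
  then show ?thesis
  proof (rule rat_minimal_poly[OF _ f(2)])
    fix m :: "rat poly"
    assume m: "irreducible m" "\<And>g. poly (map_poly of_rat g) x = 0 \<Longrightarrow> m dvd g"
    have "f dvd m"
      using irreducibleD'[OF f(1) m(2)[OF f(2)]] irreducible_not_unit[OF m(1)] by blast
    then show "f dvd g" using m(2)[OF g] by (rule dvd_trans)
  qed
qed

lemma algebraic_rat_poly:
  assumes "algebraic (x::complex)"
  obtains g :: "rat poly" where "g \<noteq> 0" "poly (map_poly of_rat g) x = 0"
proof -
  obtain p where p: "p \<noteq> 0" "poly (map_poly of_int p) x = 0"
    using algebraicE'[OF assms] .
  show ?thesis
  proof (rule that[of "map_poly of_int p"])
    show "map_poly rat_of_int p \<noteq> 0" using p(1) by simp
    have "map_poly of_rat (map_poly rat_of_int p) = map_poly complex_of_int p"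
      by (simp add: map_poly_map_poly o_def)
    then show "poly (map_poly of_rat (map_poly rat_of_int p)) x = 0" using p(2) by simp
  qed
qed

lemma rat_poly_imp_algebraic:
  assumes "g \<noteq> 0" "poly (map_poly of_rat g) (x::complex) = 0"
  shows "algebraic x"
  by (rule algebraicI'[of "map_poly of_rat g"]) (use assms in \<open>auto simp: coeff_map_poly\<close>)

lemma galois_conjugates_eq_roots:
  assumes "irreducible f" "poly (map_poly of_rat f) x = 0"
  shows "galois_conjugates x = {z. poly (map_poly of_rat f) z = 0}"
proof (intro subset_antisym subsetI)
  fix z assume "z \<in> galois_conjugates x"
  then obtain g where g: "irreducible g" "poly (map_poly of_rat g) x = 0" "poly (map_poly of_rat g) z = 0"
    by (auto simp: galois_conjugates_def)
  then obtain h where "f = g * h"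
    using irreducible_root_dvd[of g x f] assms by (auto simp: dvd_def)
  with g show "z \<in> {z. poly (map_poly of_rat f) z = 0}"
    by (simp add: of_rat_poly_hom.hom_mult)
qed (use assms in \<open>auto simp: galois_conjugates_def\<close>)

lemma finite_galois_conjugates: "algebraic x \<Longrightarrow> finite (galois_conjugates x)"
proof -
  assume "algebraic x"
  then obtain g :: "rat poly" where "g \<noteq> 0" "poly (map_poly of_rat g) x = 0"
    by (rule algebraic_rat_poly)
  then obtain f :: "rat poly" where f: "irreducible f" "poly (map_poly of_rat f) x = 0"
    by (rule rat_minimal_poly)
  then have "map_poly complex_of_rat f \<noteq> 0" by (auto simp: irreducible_def)
  then show ?thesis
    unfolding galois_conjugates_eq_roots[OF f] by (rule poly_roots_finite)
qed

lemma cmod_le_house: "algebraic x \<Longrightarrow> z \<in> galois_conjugates x \<Longrightarrow> cmod z \<le> house x"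
  unfolding house_def by (intro Max_ge) (auto simp: finite_galois_conjugates)

text \<open>If \<open>c\<close> is the leading coefficient of an integer polynomial of degree \<open>n\<close> vanishing at \<open>x\<close>, then multiplying
the relation by \<open>c\<^sup>n\<^sup>-\<^sup>1\<close> makes it monic in \<open>c x\<close>. So the set of admissible denominators is nonempty and
its least element is one of them.\<close>

lemma alg_denominator:
  assumes "algebraic (x::complex)"
  shows "1 \<le> alg_denominator x" "algebraic_int (of_nat (alg_denominator x) * x)"
proof -
  obtain p where p: "p \<noteq> 0" "poly (map_poly of_int p) x = 0"
    using algebraicE'[OF assms] .
  define n c where "n = degree p" and "c = lead_coeff p"
  have "0 < n"
  proof (rule ccontr)
    assume "\<not> 0 < n"
    then have "degree p = 0" by (simp add: n_def)
    then obtain k where "p = [:k:]" by (rule degree_eq_zeroE)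
    with p show False by simp
  qed
  have set: "{..n} = insert n {..<n}" by auto
  have "(\<Sum>i\<le>n. of_int (coeff p i) * x ^ i) = 0"
    using p(2) by (simp add: poly_altdef n_def)
  then have rel: "of_int c * x ^ n = - (\<Sum>i<n. of_int (coeff p i) * x ^ i)"
    unfolding set eq_neg_iff_add_eq_0 by (simp add: c_def n_def)
  have "(of_int c * x) ^ n = of_int c ^ (n - 1) * (of_int c * x ^ n)"
    using \<open>0 < n\<close> by (cases n) (simp_all add: power_mult_distrib mult_ac)
  also have "\<dots> = (\<Sum>i<n. of_int (- coeff p i * c ^ (n - 1 - i)) * (of_int c * x) ^ i)"
    unfolding rel mult_minus_right sum_distrib_left sum_negf[symmetric]
  proof (intro sum.cong refl)
    fix i assume "i \<in> {..<n}"
    then have "n - 1 = (n - 1 - i) + i" by auto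
    then have "(of_int c :: complex) ^ (n - 1) = of_int c ^ (n - 1 - i) * of_int c ^ i"
      by (metis power_add)
    then show "- ((of_int c :: complex) ^ (n - 1) * (of_int (coeff p i) * x ^ i)) =
        of_int (- coeff p i * c ^ (n - 1 - i)) * (of_int c * x) ^ i"
      by (simp add: power_mult_distrib)
  qed
  finally have "algebraic_int (of_int c * x)"
    by (rule algebraic_int_if_power_relation[OF \<open>0 < n\<close>])
  then have "algebraic_int (of_nat (nat \<bar>c\<bar>) * x)"
    by (cases "c \<ge> 0") (auto simp: algebraic_int_minus_iff)
  moreover have "1 \<le> nat \<bar>c\<bar>" using p(1) leading_coeff_0_iff[of p] unfolding c_def by linarith
  ultimately have "\<exists>m. 1 \<le> m \<and> algebraic_int (of_nat m * x)" by blast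
  from LeastI_ex[OF this] show "1 \<le> alg_denominator x" "algebraic_int (of_nat (alg_denominator x) * x)"
    by (auto simp: alg_denominator_def)
qed

section \<open>Embeddings of number fields\<close>

text \<open>Embeddings are total functions of which only the restriction to \<open>F\<close> matters. This lets an
embedding of a field be compared with its extension to a larger field without any coercion.\<close>

definition field_embedding :: "complex set \<Rightarrow> (complex \<Rightarrow> complex) \<Rightarrow> bool" where
  "field_embedding F \<sigma> \<longleftrightarrow> \<sigma> 1 = 1 \<and>
     (\<forall>x\<in>F. \<forall>y\<in>F. \<sigma> (x + y) = \<sigma> x + \<sigma> y \<and> \<sigma> (x * y) = \<sigma> x * \<sigma> y)"

context
  fixes F \<sigma>
  assumes F: "complex_subfield F" and \<sigma>: "field_embedding F \<sigma>"
begin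

lemma embedding_1: "\<sigma> 1 = 1"
  and embedding_add: "x \<in> F \<Longrightarrow> y \<in> F \<Longrightarrow> \<sigma> (x + y) = \<sigma> x + \<sigma> y"
  and embedding_mult: "x \<in> F \<Longrightarrow> y \<in> F \<Longrightarrow> \<sigma> (x * y) = \<sigma> x * \<sigma> y"
  using \<sigma> by (auto simp: field_embedding_def)

lemma embedding_0: "\<sigma> 0 = 0"
  using embedding_add[of 0 0] complex_subfieldD(1)[OF F] by simp

lemma embedding_minus: "x \<in> F \<Longrightarrow> \<sigma> (- x) = - \<sigma> x"
  using embedding_add[of x "- x"] complex_subfieldD(5)[OF F] embedding_0
  by (simp add: eq_neg_iff_add_eq_0 add.commute)

lemma embedding_diff: "x \<in> F \<Longrightarrow> y \<in> F \<Longrightarrow> \<sigma> (x - y) = \<sigma> x - \<sigma> y"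
  using embedding_add[of x "- y"] embedding_minus[of y] complex_subfieldD(5)[OF F] by simp

lemma embedding_sum: "(\<And>i. i \<in> I \<Longrightarrow> f i \<in> F) \<Longrightarrow> \<sigma> (sum f I) = (\<Sum>i\<in>I. \<sigma> (f i))"
proof (induction I rule: infinite_finite_induct)
  case (insert i I)
  then show ?case
    using embedding_add[of "f i" "sum f I"] complex_subfield_sum[OF F, of I f] by simp
qed (simp_all add: embedding_0)

lemma embedding_prod: "(\<And>i. i \<in> I \<Longrightarrow> f i \<in> F) \<Longrightarrow> \<sigma> (prod f I) = (\<Prod>i\<in>I. \<sigma> (f i))"
proof (induction I rule: infinite_finite_induct)
  case (insert i I)
  then show ?case
    using embedding_mult[of "f i" "prod f I"] complex_subfield_prod[OF F, of I f] by simp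
qed (simp_all add: embedding_1)

lemma embedding_power: "x \<in> F \<Longrightarrow> \<sigma> (x ^ n) = \<sigma> x ^ n"
  using embedding_prod[of "{..<n}" "\<lambda>_. x"] by simp

lemma embedding_of_int: "\<sigma> (of_int k) = of_int k"
proof -
  have nat: "\<sigma> (of_nat n) = of_nat n" for n
    using embedding_sum[of "{..<n}" "\<lambda>_. 1"] complex_subfieldD(2)[OF F] embedding_1 by simp
  show ?thesis
  proof (cases k)
    case (nonneg n)
    then show ?thesis using nat by simp
  next
    case (neg n)
    then show ?thesis
      using nat[of "Suc n"] embedding_minus[of "of_nat (Suc n)"]
        complex_subfield_of_int[OF F, of "int (Suc n)"] by simp
  qed
qed

lemma embedding_of_rat: "\<sigma> (of_rat r) = of_rat r"
proof (cases r)
  case (Fract a b)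
  then have b: "(of_int b :: complex) \<noteq> 0" by simp
  have "of_int b * of_rat r = (of_int a :: complex)"
    using Fract by (simp add: of_rat_rat)
  then have "of_int b * \<sigma> (of_rat r) = of_int a"
    using embedding_mult[of "of_int b" "of_rat r"] complex_subfield_of_int[OF F]
      complex_subfield_of_rat[OF F] embedding_of_int by metis
  then show ?thesis
    using \<open>of_int b * of_rat r = (of_int a :: complex)\<close> b by (metis mult_left_cancel)
qed

lemma coeff_map_embedding: "coeff (map_poly \<sigma> f) i = \<sigma> (coeff f i)"
  by (simp add: coeff_map_poly embedding_0)

lemma map_embedding_add:
  assumes "\<And>i. coeff f i \<in> F" "\<And>i. coeff g i \<in> F"
  shows "map_poly \<sigma> (f + g) = map_poly \<sigma> f + map_poly \<sigma> g"
  by (rule poly_eqI) (simp add: coeff_map_embedding embedding_add assms)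

lemma map_embedding_diff:
  assumes "\<And>i. coeff f i \<in> F" "\<And>i. coeff g i \<in> F"
  shows "map_poly \<sigma> (f - g) = map_poly \<sigma> f - map_poly \<sigma> g"
  by (rule poly_eqI) (simp add: coeff_map_embedding embedding_diff assms)

lemma map_embedding_mult:
  assumes "\<And>i. coeff f i \<in> F" "\<And>i. coeff g i \<in> F"
  shows "map_poly \<sigma> (f * g) = map_poly \<sigma> f * map_poly \<sigma> g"
proof (rule poly_eqI)
  fix n
  have "\<sigma> (\<Sum>i\<le>n. coeff f i * coeff g (n - i)) = (\<Sum>i\<le>n. \<sigma> (coeff f i) * \<sigma> (coeff g (n - i)))"
    by (subst embedding_sum) (auto simp: embedding_mult assms complex_subfieldD(4)[OF F])
  then show "coeff (map_poly \<sigma> (f * g)) n = coeff (map_poly \<sigma> f * map_poly \<sigma> g) n"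
    by (simp add: coeff_map_embedding coeff_mult)
qed

lemma embedding_poly:
  assumes "\<And>i. coeff f i \<in> F" "x \<in> F"
  shows "\<sigma> (poly f x) = poly (map_poly \<sigma> f) (\<sigma> x)"
proof -
  have "\<sigma> (poly f x) = (\<Sum>i\<le>degree f. \<sigma> (coeff f i * x ^ i))"
    unfolding poly_altdef
    by (intro embedding_sum complex_subfieldD(4)[OF F] complex_subfield_power[OF F] assms)
  also have "\<dots> = (\<Sum>i\<le>degree f. coeff (map_poly \<sigma> f) i * \<sigma> x ^ i)"
    by (simp add: embedding_mult embedding_power coeff_map_embedding assms complex_subfield_power[OF F])
  also have "\<dots> = poly (map_poly \<sigma> f) (\<sigma> x)"
    by (rule poly_eq_sum_atMost[symmetric]) (simp add: map_poly_degree_leq)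
  finally show ?thesis .
qed

lemma embedding_in_galois_conjugates:
  assumes "x \<in> F" "algebraic x"
  shows "\<sigma> x \<in> galois_conjugates x"
proof -
  obtain g :: "rat poly" where "g \<noteq> 0" "poly (map_poly of_rat g) x = 0"
    using algebraic_rat_poly[OF assms(2)] .
  then obtain f :: "rat poly" where f: "irreducible f" "poly (map_poly of_rat f) x = 0"
    by (rule rat_minimal_poly)
  have "map_poly \<sigma> (map_poly of_rat f) = map_poly of_rat f"
    by (rule poly_eqI) (simp add: coeff_map_embedding coeff_map_poly embedding_of_rat)
  then have "poly (map_poly of_rat f) (\<sigma> x) = \<sigma> (poly (map_poly of_rat f) x)"
    using embedding_poly[of "map_poly of_rat f" x] assms(1) complex_subfield_of_rat[OF F]
    by (simp add: coeff_map_poly)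
  then show ?thesis
    using f embedding_0 unfolding galois_conjugates_def by auto
qed

end

text \<open>The inverse of an algebraic number is a rational polynomial expression in it, so closure under inverses
comes for free.\<close>

lemma subfield_if_algebraic_subring:
  assumes F: "complex_subfield F" "F \<subseteq> S"
    and add: "\<And>x y. x \<in> S \<Longrightarrow> y \<in> S \<Longrightarrow> x + y \<in> S"
    and mult: "\<And>x y. x \<in> S \<Longrightarrow> y \<in> S \<Longrightarrow> x * y \<in> S"
    and alg: "\<And>x. x \<in> S \<Longrightarrow> algebraic x"
  shows "complex_subfield S"
proof -
  have int: "of_int k \<in> S" and rat: "of_rat r \<in> S" for k r
    using complex_subfield_of_int[OF F(1)] complex_subfield_of_rat[OF F(1)] F(2) by auto
  have minus: "- x \<in> S" if "x \<in> S" for x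
    using mult[OF int[of "-1"] that] by simp
  have poly: "poly (map_poly of_int p) x \<in> S" if "x \<in> S" for p :: "int poly" and x
    using int[of 0] by (induction p) (auto intro!: add mult int that)
  have "inverse x \<in> S" if x: "x \<in> S" for x
  proof (cases "x = 0")
    case True
    then show ?thesis using int[of 0] by simp
  next
    case False
    obtain p where p: "coeff p 0 \<noteq> 0" "poly (map_poly of_int p) x = 0"
      using algebraicE'_nonzero[OF alg[OF x] False] by blast
    obtain c q where pq: "p = pCons c q" by (cases p)
    then have c: "c \<noteq> 0" using p(1) by simp
    have rel: "of_int c + x * poly (map_poly of_int q) x = 0"
      using p(2) pq c by (simp add: map_poly_pCons)
    have "inverse x = - (of_rat (1 / of_int c) * poly (map_poly of_int q) x)"
    proof -
      have "of_int c = - (x * poly (map_poly of_int q) x)"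
        using rel by (simp only: eq_neg_iff_add_eq_0)
      then have "- (x * poly (map_poly of_int q) x) / of_int c = 1"
        by (metis c divide_self of_int_eq_0_iff)
      then have "x * - (poly (map_poly of_int q) x / of_int c) = 1"
        by simp
      then show ?thesis
        using inverse_unique[of x] by (simp add: of_rat_divide)
    qed
    then show ?thesis using minus[OF mult[OF rat poly[OF x]]] by metis
  qed
  then show ?thesis
    unfolding complex_subfield_def using int[of 0] int[of 1] add mult minus by auto
qed

definition ring_adjoin :: "complex set \<Rightarrow> complex \<Rightarrow> complex set" where
  "ring_adjoin F \<beta> = {poly f \<beta> | f. \<forall>i. coeff f i \<in> F}"

lemma ring_adjoinI: "(\<And>i. coeff f i \<in> F) \<Longrightarrow> x = poly f \<beta> \<Longrightarrow> x \<in> ring_adjoin F \<beta>"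
  unfolding ring_adjoin_def by auto

lemma ring_adjoin_facts:
  assumes F: "complex_subfield F"
  shows "F \<subseteq> ring_adjoin F \<beta>" "\<beta> \<in> ring_adjoin F \<beta>"
    "x \<in> ring_adjoin F \<beta> \<Longrightarrow> y \<in> ring_adjoin F \<beta> \<Longrightarrow> x + y \<in> ring_adjoin F \<beta>"
    "x \<in> ring_adjoin F \<beta> \<Longrightarrow> y \<in> ring_adjoin F \<beta> \<Longrightarrow> x * y \<in> ring_adjoin F \<beta>"
proof -
  note D = complex_subfieldD[OF F]
  show "F \<subseteq> ring_adjoin F \<beta>"
  proof
    fix x assume "x \<in> F"
    then show "x \<in> ring_adjoin F \<beta>"
      by (intro ring_adjoinI[of "[:x:]"]) (auto simp: coeff_pCons D split: nat.splits)
  qed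
  show "\<beta> \<in> ring_adjoin F \<beta>"
    by (rule ring_adjoinI[of "[:0, 1:]"]) (auto simp: coeff_pCons D split: nat.splits)
  assume "x \<in> ring_adjoin F \<beta>" "y \<in> ring_adjoin F \<beta>"
  then obtain f g where fg: "\<forall>i. coeff f i \<in> F" "\<forall>i. coeff g i \<in> F" "x = poly f \<beta>" "y = poly g \<beta>"
    by (auto simp: ring_adjoin_def)
  show "x + y \<in> ring_adjoin F \<beta>"
    by (rule ring_adjoinI[of "f + g"]) (use fg in \<open>auto intro: D(3)\<close>)
  show "x * y \<in> ring_adjoin F \<beta>"
    by (rule ring_adjoinI[of "f * g"])
      (use fg in \<open>auto simp: coeff_mult intro!: D(4) complex_subfield_sum[OF F]\<close>)
qed

lemma ring_adjoin_subset:
  assumes "complex_subfield L" "F \<subseteq> L" "\<beta> \<in> L"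
  shows "ring_adjoin F \<beta> \<subseteq> L"
  using assms by (auto simp: ring_adjoin_def intro!: poly_in_subfield)

text \<open>The extension sends \<open>f(\<beta>)\<close> to \<open>f\<^sup>\<sigma>(\<gamma>)\<close>; the hypothesis on \<open>\<gamma>\<close> says exactly that this is
well defined.\<close>

lemma embedding_extend_to_root:
  assumes F: "complex_subfield F" and \<sigma>: "field_embedding F \<sigma>"
    and root: "\<forall>f. (\<forall>i. coeff f i \<in> F) \<longrightarrow> poly f \<beta> = 0 \<longrightarrow> poly (map_poly \<sigma> f) \<gamma> = 0"
  obtains \<tau> where "field_embedding (ring_adjoin F \<beta>) \<tau>" "\<forall>x\<in>F. \<tau> x = \<sigma> x" "\<tau> \<beta> = \<gamma>"
proof -
  note D = complex_subfieldD[OF F]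
  note e0 = embedding_0[OF F \<sigma>] and e1 = embedding_1[OF F \<sigma>]
  define \<tau> where "\<tau> x = poly (map_poly \<sigma> (SOME f. (\<forall>i. coeff f i \<in> F) \<and> poly f \<beta> = x)) \<gamma>" for x
  have \<tau>: "\<tau> (poly f \<beta>) = poly (map_poly \<sigma> f) \<gamma>" if f: "\<forall>i. coeff f i \<in> F" for f
  proof -
    define g where "g = (SOME g. (\<forall>i. coeff g i \<in> F) \<and> poly g \<beta> = poly f \<beta>)"
    have g: "(\<forall>i. coeff g i \<in> F) \<and> poly g \<beta> = poly f \<beta>"
      unfolding g_def by (rule someI[of _ f]) (use f in auto)
    have "poly (map_poly \<sigma> (g - f)) \<gamma> = 0"
      by (rule root[rule_format]) (use f g complex_subfield_diff[OF F] in auto)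
    then show ?thesis
      using map_embedding_diff[OF F \<sigma>, of g f] f g by (simp add: \<tau>_def g_def[symmetric])
  qed
  show ?thesis
  proof (rule that)
    have val: "\<tau> x = \<sigma> x" if "x \<in> F" for x
    proof -
      have "\<forall>i. coeff [:x:] i \<in> F" using that by (auto simp: coeff_pCons D split: nat.splits)
      from \<tau>[OF this] show ?thesis by (cases "x = 0") (simp_all add: map_poly_pCons e0)
    qed
    then show "\<forall>x\<in>F. \<tau> x = \<sigma> x" by blast
    show "\<tau> \<beta> = \<gamma>"
    proof -
      have "\<forall>i. coeff [:0, 1:] i \<in> F" by (auto simp: coeff_pCons D split: nat.splits)
      from \<tau>[OF this] show ?thesis by (simp add: map_poly_pCons e0 e1)
    qed
    show "field_embedding (ring_adjoin F \<beta>) \<tau>"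
      unfolding field_embedding_def
    proof (intro conjI ballI)
      show "\<tau> 1 = 1" using val[of 1] D(2) e1 by simp
      fix x y assume "x \<in> ring_adjoin F \<beta>" "y \<in> ring_adjoin F \<beta>"
      then obtain f g where fg: "\<forall>i. coeff f i \<in> F" "\<forall>i. coeff g i \<in> F" "x = poly f \<beta>" "y = poly g \<beta>"
        by (auto simp: ring_adjoin_def)
      have c: "\<forall>i. coeff (f + g) i \<in> F" "\<forall>i. coeff (f * g) i \<in> F"
        using fg(1,2) by (simp_all add: coeff_mult D(3,4) complex_subfield_sum[OF F])
      show "\<tau> (x + y) = \<tau> x + \<tau> y"
        using \<tau>[OF c(1)] \<tau>[OF fg(1)] \<tau>[OF fg(2)] map_embedding_add[OF F \<sigma>, of f g] fg by simp
      show "\<tau> (x * y) = \<tau> x * \<tau> y"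
        using \<tau>[OF c(2)] \<tau>[OF fg(1)] \<tau>[OF fg(2)] map_embedding_mult[OF F \<sigma>, of f g] fg by simp
    qed
  qed
qed

text \<open>For \<open>\<gamma>\<close> one takes a root of \<open>g\<^sup>\<sigma>\<close>, where \<open>g\<close> has least degree among the polynomials over \<open>F\<close> vanishing at \<open>\<beta>\<close>.
Every such polynomial is reduced to \<open>0\<close> by subtracting multiples of \<open>g\<close>, and this reduction is
transported by \<open>\<sigma>\<close>.\<close>

lemma embedding_root_exists:
  assumes F: "complex_subfield F" and \<sigma>: "field_embedding F \<sigma>" and "algebraic \<beta>"
  obtains \<gamma> where "\<forall>f. (\<forall>i. coeff f i \<in> F) \<longrightarrow> poly f \<beta> = 0 \<longrightarrow> poly (map_poly \<sigma> f) \<gamma> = 0"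
proof -
  note D = complex_subfieldD[OF F]
  define R where "R f \<longleftrightarrow> (\<forall>i. coeff f i \<in> F) \<and> poly f \<beta> = 0" for f
  obtain h :: "rat poly" where h: "h \<noteq> 0" "poly (map_poly of_rat h) \<beta> = 0"
    using algebraic_rat_poly[OF assms(3)] .
  have "R (map_poly of_rat h) \<and> map_poly of_rat h \<noteq> (0 :: complex poly)"
    using h complex_subfield_of_rat[OF F] by (simp add: R_def coeff_map_poly)
  then obtain g where g: "R g" "g \<noteq> 0" and min: "\<And>f. R f \<Longrightarrow> f \<noteq> 0 \<Longrightarrow> degree g \<le> degree f"
    using ex_has_least_nat[of "\<lambda>f. R f \<and> f \<noteq> 0" "map_poly of_rat h" degree] by blast
  have lc: "lead_coeff g \<in> F" "lead_coeff g \<noteq> 0" using g by (auto simp: R_def)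
  have \<sigma>lc: "\<sigma> (lead_coeff g) \<noteq> 0"
  proof
    assume "\<sigma> (lead_coeff g) = 0"
    then have "\<sigma> (lead_coeff g * inverse (lead_coeff g)) = 0"
      using embedding_mult[OF F \<sigma> lc(1) D(6)[OF lc(1)]] by simp
    then show False using lc embedding_1[OF F \<sigma>] by simp
  qed
  have "degree g \<noteq> 0"
  proof
    assume "degree g = 0"
    then obtain c where "g = [:c:]" by (rule degree_eq_zeroE)
    with g show False by (auto simp: R_def)
  qed
  moreover have "degree (map_poly \<sigma> g) = degree g"
    by (rule antisym[OF map_poly_degree_leq le_degree]) (use \<sigma>lc in \<open>simp add: coeff_map_embedding[OF F \<sigma>]\<close>)
  ultimately obtain \<gamma> where \<gamma>: "poly (map_poly \<sigma> g) \<gamma> = 0"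
    using fundamental_theorem_of_algebra[of "map_poly \<sigma> g"] constant_degree[of "map_poly \<sigma> g"] by auto
  have key: "poly (map_poly \<sigma> f) \<gamma> = 0" if "R f" for f
    using that
  proof (induction "degree f" arbitrary: f rule: less_induct)
    case less
    show ?case
    proof (cases "f = 0")
      case False
      then have deg: "degree g \<le> degree f" using min less.prems by blast
      define m where "m = monom (lead_coeff f * inverse (lead_coeff g)) (degree f - degree g)"
      have m: "\<forall>i. coeff m i \<in> F" and gF: "\<forall>i. coeff g i \<in> F" and fF: "\<forall>i. coeff f i \<in> F"
        using less.prems g(1) lc by (auto simp: m_def R_def intro!: D)
      have mg: "\<forall>i. coeff (m * g) i \<in> F"
        using m gF by (simp add: coeff_mult D(4) complex_subfield_sum[OF F])
      have Rd: "R (f - m * g)"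
        using less.prems g(1) mg fF complex_subfield_diff[OF F] by (auto simp: R_def)
      have split: "poly (map_poly \<sigma> f) \<gamma> = poly (map_poly \<sigma> (f - m * g)) \<gamma>"
        using map_embedding_diff[OF F \<sigma>, of f "m * g"] map_embedding_mult[OF F \<sigma>, of m g] m gF mg fF \<gamma>
        by simp
      show ?thesis
      proof (cases "f - m * g = 0")
        case True
        then show ?thesis using split by simp
      next
        case False
        have nz: "lead_coeff f * inverse (lead_coeff g) \<noteq> 0" using \<open>f \<noteq> 0\<close> lc(2) by simp
        have "degree m = degree f - degree g" unfolding m_def by (rule degree_monom_eq[OF nz])
        moreover have "m \<noteq> 0" using nz by (simp add: m_def)
        ultimately have dm: "degree (m * g) = degree f" "m \<noteq> 0"
          using deg g(2) by (auto simp: degree_mult_eq)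
        have "coeff (m * g) (degree f) = lead_coeff m * lead_coeff g"
          using dm(1) lead_coeff_mult[of m g] by simp
        also have "lead_coeff m = lead_coeff f * inverse (lead_coeff g)"
          unfolding m_def by (rule lead_coeff_monom)
        also have "\<dots> * lead_coeff g = lead_coeff f" using lc(2) by simp
        finally have "coeff (f - m * g) (degree f) = 0" by simp
        moreover have "degree (f - m * g) \<le> degree f" using dm(1) by (intro degree_diff_le) auto
        ultimately have "degree (f - m * g) < degree f"
          using False by (metis leading_coeff_0_iff order_le_less)
        from less.hyps[OF this Rd] show ?thesis using split by simp
      qed
    qed simp
  qed
  show ?thesis by (rule that[of \<gamma>]) (use key in \<open>auto simp: R_def\<close>)
qed

lemma number_field_subfield: "number_field L \<Longrightarrow> complex_subfield L"
  by (simp add: number_field_def)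

lemma finite_dim_algebraic:
  assumes "finite B" "\<And>i. x ^ i \<in> rat_complex.span B"
  shows "algebraic x"
proof -
  obtain f :: "rat poly" where "f \<noteq> 0" "poly (map_poly of_rat f) x = 0"
    by (rule rational_poly_vanishing_at_element[OF assms])
  then show ?thesis by (rule rat_poly_imp_algebraic)
qed

lemma number_field_algebraic:
  assumes "number_field L" "x \<in> L"
  shows "algebraic x"
proof -
  obtain B where B: "finite B" "rat_complex.span B = L"
    using assms(1) by (auto simp: number_field_def)
  show ?thesis
    by (rule finite_dim_algebraic[OF B(1)])
      (simp add: B(2) complex_subfield_power[OF number_field_subfield[OF assms(1)] assms(2)])
qed

section \<open>Conjugates of algebraic integers in a number field\<close>

text \<open>Start with \<open>\<rat>(x) \<rightarrow> \<rat>(z)\<close>, which is well defined because \<open>x\<close> and \<open>z\<close> have the same minimal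
polynomial, and adjoin the elements of a finite generating set of \<open>L\<close> one after the other. In this way the conjugates of an
element that is computed from others can be bounded through the conjugates of the others.\<close>

lemma embedding_onto_conjugate:
  assumes L: "number_field L" and x: "x \<in> L" and z: "z \<in> galois_conjugates x"
  obtains \<sigma> where "field_embedding L \<sigma>" "\<sigma> x = z"
proof -
  note Ls = number_field_subfield[OF L]
  obtain B where B: "finite B" "rat_complex.span B = L"
    using L by (auto simp: number_field_def)
  have sub: "complex_subfield (ring_adjoin F \<beta>)" if "complex_subfield F" "F \<subseteq> L" "\<beta> \<in> L" for F \<beta>
  proof (rule subfield_if_algebraic_subring[OF that(1) ring_adjoin_facts(1)[OF that(1)]])
    fix y assume "y \<in> ring_adjoin F \<beta>"
    then show "algebraic y"
      using ring_adjoin_subset[OF Ls that(2,3)] number_field_algebraic[OF L] by blast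
  qed (rule ring_adjoin_facts(3,4)[OF that(1)]; assumption)+
  have main: "\<exists>F \<sigma>. complex_subfield F \<and> F \<subseteq> L \<and> x \<in> F \<and> C \<subseteq> F \<and> field_embedding F \<sigma> \<and> \<sigma> x = z"
    if "finite C" "C \<subseteq> L" for C
    using that
  proof (induction C rule: finite_induct)
    case empty
    have QL: "\<rat> \<subseteq> L" using complex_subfield_of_rat[OF Ls] by (auto simp: Rats_def)
    have id: "field_embedding \<rat> (\<lambda>x. x)" by (simp add: field_embedding_def)
    obtain g :: "rat poly" where g: "irreducible g" "poly (map_poly of_rat g) x = 0"
        "poly (map_poly of_rat g) z = 0"
      using z by (auto simp: galois_conjugates_def)
    have "poly (map_poly (\<lambda>x. x) f) z = 0" if f: "\<forall>i. coeff f i \<in> \<rat>" "poly f x = 0" for f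
    proof -
      obtain h :: "rat poly" where h: "f = map_poly of_rat h"
        by (rule ratpolyE[of f]) (use f(1) in auto)
      with f(2) have "g dvd h" using irreducible_root_dvd[OF g(1,2)] by blast
      then obtain k where "h = g * k" by (rule dvdE)
      then show ?thesis using g(3) h by (simp add: of_rat_poly_hom.hom_mult map_poly_idI)
    qed
    then have "\<forall>f. (\<forall>i. coeff f i \<in> \<rat>) \<longrightarrow> poly f x = 0 \<longrightarrow> poly (map_poly (\<lambda>x. x) f) z = 0"
      by blast
    then obtain \<tau> where "field_embedding (ring_adjoin \<rat> x) \<tau>" "\<tau> x = z"
      by (rule embedding_extend_to_root[OF complex_subfield_Rats id])
    then show ?case
      using sub[OF complex_subfield_Rats QL x] ring_adjoin_subset[OF Ls QL x]
        ring_adjoin_facts(2)[OF complex_subfield_Rats, where \<beta> = x] by blast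
  next
    case (insert b C)
    then obtain F \<sigma> where F: "complex_subfield F" "F \<subseteq> L" "x \<in> F" "C \<subseteq> F"
      and \<sigma>: "field_embedding F \<sigma>" "\<sigma> x = z" by auto
    have b: "b \<in> L" using insert by auto
    obtain \<gamma> where "\<forall>f. (\<forall>i. coeff f i \<in> F) \<longrightarrow> poly f b = 0 \<longrightarrow> poly (map_poly \<sigma> f) \<gamma> = 0"
      by (rule embedding_root_exists[OF F(1) \<sigma>(1) number_field_algebraic[OF L b]])
    then obtain \<tau> where \<tau>: "field_embedding (ring_adjoin F b) \<tau>" "\<forall>y\<in>F. \<tau> y = \<sigma> y"
      by (rule embedding_extend_to_root[OF F(1) \<sigma>(1)])
    have "complex_subfield (ring_adjoin F b)" "ring_adjoin F b \<subseteq> L" "F \<subseteq> ring_adjoin F b"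
      "b \<in> ring_adjoin F b"
      by (rule sub[OF F(1,2) b] ring_adjoin_subset[OF Ls F(2) b] ring_adjoin_facts[OF F(1)])+
    moreover have "\<tau> x = z" using \<tau>(2) F(3) \<sigma>(2) by simp
    ultimately show ?case using \<tau>(1) F(3,4)
      by (intro exI[of _ "ring_adjoin F b"] exI[of _ \<tau>]) auto
  qed
  have "B \<subseteq> L" using B(2) rat_complex.span_superset[of B] by simp
  from main[OF B(1) this] obtain F \<sigma> where F: "complex_subfield F" "F \<subseteq> L" "B \<subseteq> F"
      and \<sigma>: "field_embedding F \<sigma>" "\<sigma> x = z"
    by blast
  have "L \<subseteq> F"
    unfolding B(2)[symmetric] by (rule rat_complex.span_minimal[OF F(3) rat_subspace_subfield[OF F(1)]])
  with F(2) have "F = L" by auto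
  show ?thesis by (rule that[of \<sigma>]) (use \<sigma> \<open>F = L\<close> in auto)
qed

lemma embedding_nonzero:
  assumes "complex_subfield F" "field_embedding F \<sigma>" "x \<in> F" "x \<noteq> 0"
  shows "\<sigma> x \<noteq> 0"
  using embedding_mult[OF assms(1,2,3) complex_subfieldD(6)[OF assms(1,3)]]
    embedding_1[OF assms(1,2)] assms(4) by auto

lemma cmod_prod_list_le:
  "(\<And>a. a \<in> set as \<Longrightarrow> cmod a \<le> B) \<Longrightarrow> 0 \<le> B \<Longrightarrow> cmod (prod_list as) \<le> B ^ length as"
  by (induction as) (auto simp: norm_mult intro!: mult_mono)

lemma algebraic_int_prod_list:
  "(\<And>a. a \<in> set as \<Longrightarrow> algebraic_int (a :: complex)) \<Longrightarrow> algebraic_int (prod_list as)"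
  by (induction as) (auto intro: algebraic_int_plus_times(2) simp: int_imp_algebraic_int)

lemma algebraic_int_conjugate:
  assumes "algebraic_int x" "z \<in> galois_conjugates x"
  shows "algebraic_int z"
proof -
  obtain p where p: "poly (map_poly of_int p) x = 0" "lead_coeff p = 1"
    using assms(1) by (auto simp: algebraic_int_altdef_ipoly)
  obtain f :: "rat poly" where f: "irreducible f" "poly (map_poly of_rat f) x = 0"
      "poly (map_poly of_rat f) z = 0"
    using assms(2) by (auto simp: galois_conjugates_def)
  have eq: "map_poly of_rat (map_poly rat_of_int p) = map_poly complex_of_int p"
    by (simp add: map_poly_map_poly o_def)
  have "f dvd map_poly of_int p"
    by (rule irreducible_root_dvd[OF f(1,2)]) (simp add: eq p(1))
  then obtain k where "map_poly rat_of_int p = f * k" by (rule dvdE)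
  then have "map_poly complex_of_int p = map_poly of_rat f * map_poly of_rat k"
    using eq by (simp add: of_rat_poly_hom.hom_mult)
  then have "poly (map_poly of_int p) z = 0" using f(3) by simp
  then show ?thesis using p(2) by (auto simp: algebraic_int_altdef_ipoly)
qed

text \<open>The conjugates of \<open>x\<close> are the roots of its minimal polynomial, whose degree is at most the degree of \<open>L\<close>.
Their product is an algebraic integer and, up to sign, a quotient of two coefficients of the minimal
polynomial, so it is a nonzero rational integer. All factors but \<open>x\<close> itself are at most \<open>B\<close>; since
\<open>B \<ge> 1\<close>, the exponent may be raised to the one coming from the degree of \<open>L\<close>.\<close>

lemma product_of_conjugates_ge_1:
  assumes L: "number_field L" and x: "x \<in> L" "x \<noteq> 0" "algebraic_int x"
    and B: "1 \<le> B" "\<And>\<sigma>. field_embedding L \<sigma> \<Longrightarrow> cmod (\<sigma> x) \<le> B"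
  shows "1 \<le> cmod x * B ^ (rat_complex.dim L - 1)"
proof -
  note Ls = number_field_subfield[OF L]
  obtain G where G: "finite G" "rat_complex.span G = L"
    using L by (auto simp: number_field_def)
  obtain g :: "rat poly" where g: "g \<noteq> 0" "degree g \<le> rat_complex.dim L" "poly (map_poly of_rat g) x = 0"
    by (rule rational_poly_vanishing_at_element[OF G(1), of x, unfolded G(2), OF complex_subfield_power[OF Ls x(1)]])
  obtain f :: "rat poly" where f: "irreducible f" "poly (map_poly of_rat f) x = 0"
    by (rule rat_minimal_poly[OF g(1,3)])
  have deg: "degree f \<le> rat_complex.dim L"
    using dvd_imp_degree_le[OF irreducible_root_dvd[OF f g(3)] g(1)] g(2) by simp
  define h :: "complex poly" where "h = map_poly of_rat f"
  have "f \<noteq> 0" using f(1) by auto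
  then have h0: "h \<noteq> 0" by (simp add: h_def)
  obtain as where as: "Polynomial.smult (lead_coeff h) (\<Prod>a\<leftarrow>as. [:- a, 1:]) = h" "length as = degree h"
    using fundamental_theorem_algebra_factorized[of h] by blast
  have roots: "poly h a = 0 \<longleftrightarrow> a \<in> set as" for a
  proof -
    have "poly h a = lead_coeff h * (\<Prod>b\<leftarrow>as. a - b)"
      by (subst as(1)[symmetric]) (simp add: poly_prod_list o_def)
    then show ?thesis using h0 by (auto simp: prod_list_zero_iff)
  qed
  have emb: "\<exists>\<sigma>. field_embedding L \<sigma> \<and> \<sigma> x = a" if "a \<in> set as" for a
  proof -
    have "a \<in> galois_conjugates x"
      using galois_conjugates_eq_roots[OF f] that roots by (simp add: h_def)
    then obtain \<sigma> where "field_embedding L \<sigma>" "\<sigma> x = a" by (rule embedding_onto_conjugate[OF L x(1)])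
    then show ?thesis by (intro exI[of _ \<sigma>] conjI)
  qed
  have int: "algebraic_int a" if "a \<in> set as" for a
    by (rule algebraic_int_conjugate[OF x(3)])
      (use galois_conjugates_eq_roots[OF f] that roots in \<open>simp add: h_def\<close>)
  have nz: "a \<noteq> 0" if "a \<in> set as" for a
    using emb[OF that] embedding_nonzero[OF Ls _ x(1,2)] by blast
  have "poly h 0 = lead_coeff h * (\<Prod>b\<leftarrow>as. - b)"
    by (subst as(1)[symmetric]) (simp add: poly_prod_list o_def)
  moreover have "poly h 0 \<in> \<rat>" "lead_coeff h \<in> \<rat>"
    by (simp_all add: h_def coeff_map_poly poly_0_coeff_0)
  ultimately have "(\<Prod>b\<leftarrow>as. - b) \<in> \<rat>"
    using h0 by (metis Rats_divide leading_coeff_0_iff nonzero_mult_div_cancel_left)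
  moreover have "algebraic_int (\<Prod>b\<leftarrow>as. - b)"
    by (rule algebraic_int_prod_list) (auto simp: int)
  ultimately have "(\<Prod>b\<leftarrow>as. - b) \<in> \<int>" by (rule rational_algebraic_int_is_int[rotated])
  then obtain k where k: "(\<Prod>b\<leftarrow>as. - b) = of_int k" by (rule Ints_cases)
  have "k \<noteq> 0"
  proof
    assume "k = 0"
    then have "0 \<in> set (map uminus as)" using k by (simp add: prod_list_zero_iff)
    then show False using nz by auto
  qed
  have prod_uminus: "cmod (\<Prod>b\<leftarrow>bs. - b) = cmod (prod_list bs)" for bs :: "complex list"
    by (induction bs) (simp_all add: norm_mult)
  have "1 \<le> cmod (prod_list as)"
    unfolding prod_uminus[symmetric] k using \<open>k \<noteq> 0\<close> by simp
  moreover have "x \<in> set as" using roots f(2) by (simp add: h_def)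
  then obtain ys zs where yz: "as = ys @ x # zs" by (meson split_list)
  then have "prod_list as = x * prod_list (ys @ zs)" by simp
  moreover have "cmod (prod_list (ys @ zs)) \<le> B ^ length (ys @ zs)"
    by (rule cmod_prod_list_le) (use emb B yz in force)+
  moreover have "length (ys @ zs) \<le> rat_complex.dim L - 1"
    using as(2) yz deg by (simp add: h_def)
  then have "B ^ length (ys @ zs) \<le> B ^ (rat_complex.dim L - 1)"
    using B(1) by (rule power_increasing)
  ultimately have "1 \<le> cmod x * cmod (prod_list (ys @ zs))"
      "cmod (prod_list (ys @ zs)) \<le> B ^ (rat_complex.dim L - 1)"
    by (simp_all add: norm_mult)
  then show ?thesis
    by (meson mult_left_mono norm_ge_zero order_trans)
qed

lemma number_field_dim_pos:
  assumes "number_field L" shows "1 \<le> rat_complex.dim L"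
proof -
  obtain G where G: "finite G" "rat_complex.span G = L"
    using assms by (auto simp: number_field_def)
  have "1 \<in> L" using complex_subfieldD(2)[OF number_field_subfield[OF assms]] .
  obtain g :: "rat poly" where g: "g \<noteq> 0" "degree g \<le> rat_complex.dim L" "poly (map_poly of_rat g) (1::complex) = 0"
    by (rule rational_poly_vanishing_at_element[OF G(1), of 1, unfolded G(2)]) (use \<open>1 \<in> L\<close> in simp)
  have "degree g \<noteq> 0"
  proof
    assume "degree g = 0"
    then obtain c where "g = [:c:]" by (rule degree_eq_zeroE)
    with g show False by auto
  qed
  with g(2) show ?thesis by simp
qed

lemma algebraic_power_relation:
  assumes "algebraic (x::complex)"
  obtains m a where "0 < m" "x ^ m = (\<Sum>i<m. of_rat (a i) * x ^ i)"
proof -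
  obtain g :: "rat poly" where g: "g \<noteq> 0" "poly (map_poly of_rat g) x = 0"
    using algebraic_rat_poly[OF assms] .
  define m c where "m = degree g" and "c = lead_coeff g"
  have c: "c \<noteq> 0" using g(1) by (simp add: c_def)
  have "(\<Sum>i\<le>m. of_rat (coeff g i) * x ^ i) = 0"
    using g(2) poly_eq_sum_atMost[of "map_poly of_rat g" m x] by (simp add: m_def coeff_map_poly)
  moreover have "{..m} = insert m {..<m}" by auto
  ultimately have "of_rat c * x ^ m + (\<Sum>i<m. of_rat (coeff g i) * x ^ i) = 0"
    by (simp add: c_def m_def)
  then have "of_rat c * x ^ m = - (\<Sum>i<m. of_rat (coeff g i) * x ^ i)"
    by (simp only: eq_neg_iff_add_eq_0)
  then have "of_rat (1 / c) * (of_rat c * x ^ m) = of_rat (1 / c) * - (\<Sum>i<m. of_rat (coeff g i) * x ^ i)"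
    by simp
  then have "x ^ m = (\<Sum>i<m. of_rat (- coeff g i / c) * x ^ i)"
    using c by (simp add: of_rat_divide sum_distrib_left of_rat_minus sum_negf)
  moreover have "degree g \<noteq> 0"
  proof
    assume "degree g = 0"
    then obtain c where "g = [:c:]" by (rule degree_eq_zeroE)
    with g show False by auto
  qed
  ultimately show ?thesis using that[of m "\<lambda>i. - coeff g i / c"] by (simp add: m_def)
qed

text \<open>The products of the generators of \<open>K\<close> with the powers \<open>\<alpha>\<^sup>i\<close>, \<open>i < m\<close>, span a space that is stable
under multiplication by \<open>\<alpha>\<close>. So \<open>K[\<alpha>]\<close> has finite dimension, its elements are algebraic, and it is
already a field.\<close>

lemma number_field_adjoin:
  assumes K: "number_field K" and \<alpha>: "algebraic \<alpha>"
  shows "number_field (field_adjoin K \<alpha>)" "K \<subseteq> field_adjoin K \<alpha>" "\<alpha> \<in> field_adjoin K \<alpha>"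
proof -
  note Ks = number_field_subfield[OF K]
  obtain B where B: "finite B" "rat_complex.span B = K"
    using K by (auto simp: number_field_def)
  obtain m a where m: "0 < m" "\<alpha> ^ m = (\<Sum>i<m. of_rat (a i) * \<alpha> ^ i)"
    by (rule algebraic_power_relation[OF \<alpha>])
  define G where "G = (\<lambda>(b, i). b * \<alpha> ^ i) ` (B \<times> {..<m})"
  define W where "W = rat_complex.span G"
  have "finite G" using B(1) by (simp add: G_def)
  have G: "b * \<alpha> ^ i \<in> W" if "b \<in> B" "i < m" for b i
    unfolding W_def by (rule rat_complex.span_base) (use that in \<open>auto simp: G_def\<close>)
  have \<alpha>G: "\<alpha> * g \<in> W" if g: "g \<in> G" for g
  proof -
    obtain b i where bi: "b \<in> B" "i < m" "g = b * \<alpha> ^ i"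
      using g by (auto simp: G_def)
    show ?thesis
    proof (cases "Suc i < m")
      case True
      then show ?thesis using G[of b "Suc i"] bi by (simp add: mult_ac)
    next
      case False
      then have "m = Suc i" using bi by simp
      then have "\<alpha> * g = b * \<alpha> ^ m" using bi by (simp add: mult_ac)
      also have "\<dots> = (\<Sum>i<m. of_rat (a i) * (b * \<alpha> ^ i))"
        unfolding m(2) by (simp add: sum_distrib_left mult_ac)
      also have "\<dots> \<in> W"
        unfolding W_def
        by (intro rat_complex.span_sum rat_complex.span_scale G[unfolded W_def]) (use bi in auto)
      finally show ?thesis .
    qed
  qed
  have \<alpha>W: "\<alpha> * w \<in> W" if "w \<in> W" for w
    using that unfolding W_def
  proof (induction rule: rat_complex.span_induct_alt)
    case base
    then show ?case by (simp add: rat_complex.span_zero)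
  next
    case (step c g s)
    have "\<alpha> * (of_rat c * g + s) = of_rat c * (\<alpha> * g) + \<alpha> * s" by (simp add: algebra_simps)
    moreover have "of_rat c * (\<alpha> * g) + \<alpha> * s \<in> rat_complex.span G"
      using rat_complex.span_add[OF rat_complex.span_scale[OF \<alpha>G[OF step(1), unfolded W_def]] step(2)] .
    ultimately show ?case by (simp only:)
  qed
  have "K \<subseteq> W"
    unfolding B(2)[symmetric] W_def
    by (rule rat_complex.span_minimal) (use G[of _ 0, unfolded W_def] m(1) in auto)
  have pow: "k * \<alpha> ^ i \<in> W" if "k \<in> K" for k i
  proof (induction i)
    case 0
    then show ?case using that \<open>K \<subseteq> W\<close> by auto
  next
    case (Suc i)
    have "k * \<alpha> ^ Suc i = \<alpha> * (k * \<alpha> ^ i)" by simp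
    then show ?case using \<alpha>W[OF Suc] by (simp only:)
  qed
  have RW: "ring_adjoin K \<alpha> \<subseteq> W"
  proof
    fix y assume "y \<in> ring_adjoin K \<alpha>"
    then obtain f where f: "\<forall>i. coeff f i \<in> K" "y = poly f \<alpha>" by (auto simp: ring_adjoin_def)
    show "y \<in> W"
      unfolding f(2) poly_altdef W_def
      by (rule rat_complex.span_sum) (use f(1) in \<open>simp add: pow[unfolded W_def]\<close>)
  qed
  note R = ring_adjoin_facts[OF Ks, where \<beta> = \<alpha>]
  have R1: "1 \<in> ring_adjoin K \<alpha>" using R(1) complex_subfieldD(2)[OF Ks] by blast
  have Rs: "complex_subfield (ring_adjoin K \<alpha>)"
  proof (rule subfield_if_algebraic_subring[OF Ks R(1)])
    fix y assume y: "y \<in> ring_adjoin K \<alpha>"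
    have "y ^ i \<in> ring_adjoin K \<alpha>" for i
      by (induction i) (simp_all add: R1 R(4) y)
    then show "algebraic y"
      using finite_dim_algebraic[OF \<open>finite G\<close>, of y] RW by (auto simp: W_def)
  qed (rule R(3,4); assumption)+
  have KA: "insert \<alpha> K \<subseteq> field_adjoin K \<alpha>"
    unfolding field_adjoin_def by (rule hull_subset)
  have As: "complex_subfield (field_adjoin K \<alpha>)"
    unfolding field_adjoin_def by (rule complex_subfield_hull)
  have "field_adjoin K \<alpha> = ring_adjoin K \<alpha>"
  proof (rule subset_antisym)
    show "field_adjoin K \<alpha> \<subseteq> ring_adjoin K \<alpha>"
      unfolding field_adjoin_def by (rule hull_minimal) (use R(1,2) Rs in auto)
    show "ring_adjoin K \<alpha> \<subseteq> field_adjoin K \<alpha>"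
      by (rule ring_adjoin_subset[OF As]) (use KA in auto)
  qed
  then have AW: "field_adjoin K \<alpha> \<subseteq> W" using RW by simp
  obtain C where C: "C \<subseteq> field_adjoin K \<alpha>" "rat_complex.independent C"
     "field_adjoin K \<alpha> \<subseteq> rat_complex.span C"
    using rat_complex.basis_exists[of "field_adjoin K \<alpha>"] by metis
  have "finite C"
    using rat_complex.independent_span_bound[OF \<open>finite G\<close> C(2)] C(1) AW by (auto simp: W_def)
  moreover have "rat_complex.span C = field_adjoin K \<alpha>"
    by (rule subset_antisym[OF rat_complex.span_minimal[OF C(1) rat_subspace_subfield[OF As]] C(3)])
  ultimately show "number_field (field_adjoin K \<alpha>)"
    using As by (auto simp: number_field_def)
  show "K \<subseteq> field_adjoin K \<alpha>" "\<alpha> \<in> field_adjoin K \<alpha>" using KA by auto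
qed

section \<open>Partial fractions with integral nodes\<close>

text \<open>The expansion of \<open>1 / (x - i)\<close> at \<open>x = \<infinity>\<close>, in the variable \<open>X = 1 / x\<close>. A multiset of nodes then
encodes \<open>\<Prod>i. 1 / (x - i)\<close> with the multiplicities of the poles.\<close>

definition pole_factor :: "nat \<Rightarrow> complex fps" where
  "pole_factor i = fps_X * inverse (1 - fps_const (of_nat i) * fps_X)"

definition pole_fps :: "nat multiset \<Rightarrow> complex fps" where
  "pole_fps m = (\<Prod>i\<in>#m. pole_factor i)"

lemma pole_fps_empty [simp]: "pole_fps {#} = 1"
  and pole_fps_add [simp]: "pole_fps (add_mset i m) = pole_factor i * pole_fps m"
  by (simp_all add: pole_fps_def)

lemma pole_factor_eq: "(1 - fps_const (of_nat i) * fps_X) * pole_factor i = fps_X"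
proof -
  have "(1 - fps_const (of_nat i) * fps_X) * inverse (1 - fps_const (of_nat i) * fps_X) = (1 :: complex fps)"
    by (rule inverse_mult_eq_1') simp
  then show ?thesis by (simp add: pole_factor_def mult.left_commute)
qed

text \<open>In terms of \<open>x\<close> this is \<open>(j - i) / ((x - i) (x - j)) = 1 / (x - j) - 1 / (x - i)\<close>, the
elementary step of the partial fraction expansion.\<close>

lemma pole_factor_diff:
  "fps_const (of_nat j - of_nat i) * (pole_factor i * pole_factor j) = pole_factor j - pole_factor i"
proof -
  define E :: "nat \<Rightarrow> complex fps" where "E i = 1 - fps_const (of_nat i) * fps_X" for i
  have E: "E i * pole_factor i = fps_X" for i
    unfolding E_def by (rule pole_factor_eq)
  have "E i - E j = fps_X * fps_const (of_nat j - of_nat i)"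
    by (simp add: E_def algebra_simps flip: fps_const_sub)
  then have "fps_X * (fps_const (of_nat j - of_nat i) * (pole_factor i * pole_factor j))
      = (E i - E j) * (pole_factor i * pole_factor j)"
    by (simp only: mult.assoc)
  also have "\<dots> = (E i * pole_factor i) * pole_factor j - (E j * pole_factor j) * pole_factor i"
    by (simp only: left_diff_distrib) (simp only: ac_simps)
  also have "\<dots> = fps_X * (pole_factor j - pole_factor i)"
    by (simp only: E right_diff_distrib)
  finally show ?thesis by (rule mult_left_cancel[THEN iffD1, rotated]) simp
qed

lemma pole_fps_nth_Suc:
  "pole_fps (add_mset i m) $ Suc s = of_nat i * pole_fps (add_mset i m) $ s + pole_fps m $ s"
proof -
  define f where "f = pole_fps (add_mset i m)"
  have "f - fps_const (of_nat i) * (fps_X * f) = (1 - fps_const (of_nat i) * fps_X) * f"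
    by (simp only: left_diff_distrib mult_1_left mult.assoc)
  also have "\<dots> = fps_X * pole_fps m"
    by (simp only: f_def pole_fps_add mult.assoc[symmetric] pole_factor_eq)
  finally have "f - fps_const (of_nat i) * (fps_X * f) = fps_X * pole_fps m" .
  from arg_cong[OF this, of "\<lambda>g. g $ Suc s"] have "f $ Suc s - of_nat i * f $ s = pole_fps m $ s"
    by (simp only: fps_sub_nth fps_mult_left_const_nth fps_X_mult_nth) simp
  then show ?thesis by (simp add: f_def diff_eq_eq add.commute del: pole_fps_add)
qed

lemma pole_fps_nth_0: "m \<noteq> {#} \<Longrightarrow> pole_fps m $ 0 = 0"
  by (cases m) (auto simp: pole_factor_def fps_mult_nth_0)

text \<open>The coefficients are dominated by those of \<open>1 / (x - p)\<^sup>k\<^sup>+\<^sup>1\<close>: both satisfy a recursion in the style of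
Pascal. Since the binomial coefficient vanishes for \<open>s < k\<close>, the bound includes the order of vanishing.\<close>

lemma pole_fps_nth_bound:
  assumes "size m = Suc k" "\<And>i. i \<in># m \<Longrightarrow> i \<le> p"
  shows "norm (pole_fps m $ Suc s) \<le> real (s choose k) * real p ^ (s - k)"
  using assms
proof (induction m arbitrary: k s)
  case (add i m)
  have ip: "i \<le> p" using add.prems by auto
  show ?case
  proof (cases "m = {#}")
    case True
    then have k: "k = 0" using add.prems by simp
    have "pole_fps (add_mset i m) $ Suc s = of_nat i ^ s"
    proof (induction s)
      case 0
      then show ?case using True pole_fps_nth_Suc[of i m 0] pole_fps_nth_0[of "{#i#}"] by simp
    next
      case (Suc s)
      then show ?case using pole_fps_nth_Suc[of i m "Suc s"] True by simp
    qed
    then show ?thesis using k ip by (simp add: norm_power power_mono del: pole_fps_add)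
  next
    case False
    then obtain k' where k': "k = Suc k'" "size m = Suc k'"
      using add.prems by (cases k) auto
    have IH: "norm (pole_fps m $ Suc s) \<le> real (s choose k') * real p ^ (s - k')" for s
      by (rule add.IH[OF k'(2)]) (use add.prems in auto)
    show ?thesis
    proof (induction s)
      case 0
      then show ?case
        using pole_fps_nth_Suc[of i m 0] False by (simp add: pole_fps_nth_0 del: pole_fps_add)
    next
      case (Suc s)
      have "norm (pole_fps (add_mset i m) $ Suc (Suc s)) \<le>
          real i * norm (pole_fps (add_mset i m) $ Suc s) + norm (pole_fps m $ Suc s)"
        unfolding pole_fps_nth_Suc[of i m "Suc s"]
        by (rule order.trans[OF norm_triangle_ineq]) (simp add: norm_mult)
      also have "\<dots> \<le> real p * (real (s choose k) * real p ^ (s - k)) + real (s choose k') * real p ^ (s - k')"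
        by (intro add_mono mult_mono Suc.IH IH) (use ip in auto)
      also have "real p * (real (s choose k) * real p ^ (s - k)) = real (s choose k) * real p ^ (s - k')"
      proof (cases "k \<le> s")
        case True
        then have "s - k' = Suc (s - k)" using k' by simp
        then show ?thesis by simp
      qed (simp add: binomial_eq_0)
      also have "real (s choose k) * real p ^ (s - k') + real (s choose k') * real p ^ (s - k')
          = real (Suc s choose k) * real p ^ (Suc s - k)"
        unfolding k' by (simp add: algebra_simps)
      finally show ?case .
    qed
  qed
qed simp

lemma pole_fps_replicate_nth:
  "pole_fps (replicate_mset (Suc k) j) $ Suc s = of_nat (s choose k) * of_nat j ^ (s - k)"
proof (induction k arbitrary: s)
  case 0
  show ?case
  proof (induction s)
    case 0
    then show ?case using pole_fps_nth_Suc[of j "{#}" 0] pole_fps_nth_0[of "{#j#}"] by simp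
  next
    case (Suc s)
    then show ?case using pole_fps_nth_Suc[of j "{#}" "Suc s"] by simp
  qed
next
  case (Suc k)
  let ?m = "replicate_mset (Suc k) j"
  note IH = Suc.IH
  show ?case
  proof (induction s)
    case 0
    then show ?case
      using pole_fps_nth_Suc[of j ?m 0] pole_fps_nth_0[of ?m] pole_fps_nth_0[of "add_mset j ?m"]
      by (simp del: pole_fps_add)
  next
    case (Suc s)
    have "pole_fps (replicate_mset (Suc (Suc k)) j) $ Suc (Suc s) =
        of_nat j * (of_nat (s choose Suc k) * of_nat j ^ (s - Suc k)) + of_nat (s choose k) * of_nat j ^ (s - k)"
      using pole_fps_nth_Suc[of j ?m "Suc s"] IH[of s] Suc by (simp del: pole_fps_add)
    also have "of_nat j * (of_nat (s choose Suc k) * of_nat j ^ (s - Suc k)) =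
        (of_nat (s choose Suc k) * of_nat j ^ (s - k) :: complex)"
    proof (cases "Suc k \<le> s")
      case True
      then have "s - k = Suc (s - Suc k)" by simp
      then show ?thesis by simp
    qed (simp add: binomial_eq_0)
    finally show ?case by (simp add: algebra_simps)
  qed
qed

text \<open>For a node \<open>l\<close>, the reciprocal of the coefficient of \<open>1 / (x - l)\<close> to the power \<open>count m l\<close> in the expansion.\<close>

definition node_diffs :: "nat multiset \<Rightarrow> nat \<Rightarrow> complex" where
  "node_diffs m l = (\<Prod>i\<in>#filter_mset (\<lambda>i. i \<noteq> l) m. of_nat l - of_nat i)"

lemma Lcm_div_diff_Ints:
  assumes "i \<le> p" "j \<le> p" "i \<noteq> j"
  shows "of_nat (Lcm {1..p}) / (of_nat j - of_nat i :: complex) \<in> \<int>"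
proof -
  have *: "of_nat (Lcm {1..p}) / (of_nat (b - a) :: complex) \<in> \<int>" if "a < b" "b \<le> p" for a b
  proof -
    have "b - a dvd Lcm {1..p}" using that by (intro dvd_Lcm) auto
    then obtain c where "Lcm {1..p} = (b - a) * c" by (rule dvdE)
    then have "of_nat (Lcm {1..p}) / (of_nat (b - a) :: complex) = of_nat c"
      using that by (simp only: of_nat_mult) simp
    then show ?thesis by simp
  qed
  show ?thesis
  proof (cases "i < j")
    case True
    then show ?thesis using *[OF True assms(2)] by (simp add: of_nat_diff)
  next
    case False
    then have "j < i" using assms by simp
    then have "of_nat (Lcm {1..p}) / (of_nat j - of_nat i :: complex) = - (of_nat (Lcm {1..p}) / of_nat (i - j))"
      by (simp add: of_nat_diff) (metis minus_diff_eq minus_divide_right)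
    then show ?thesis using *[OF \<open>j < i\<close> assms(1)] by simp
  qed
qed

text \<open>Here \<open>c j k\<close> is the coefficient of \<open>1 / (x - j)\<^sup>k\<close>. The number \<open>K\<close> is any upper bound for the orders of the poles; it
keeps the range of summation fixed when \<open>m\<close> varies.\<close>

definition partial_fraction_coeffs ::
    "nat \<Rightarrow> nat \<Rightarrow> nat multiset \<Rightarrow> (nat \<Rightarrow> nat \<Rightarrow> complex) \<Rightarrow> bool" where
  "partial_fraction_coeffs p K m c \<longleftrightarrow>
    (\<forall>j k. c j k \<noteq> 0 \<longrightarrow> 1 \<le> k \<and> k \<le> count m j) \<and>
    pole_fps m = (\<Sum>(j, k)\<in>{..p} \<times> {..K}. fps_const (c j k) * pole_fps (replicate_mset k j)) \<and>
    (\<Sum>(j, k)\<in>{..p} \<times> {..K}. norm (c j k)) \<le> 2 ^ (size m - 1) \<and>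
    (\<forall>j k. of_nat (Lcm {1..p}) ^ (size m - 1) * c j k \<in> \<int>) \<and>
    (\<forall>l. l \<in># m \<longrightarrow> c l (count m l) * node_diffs m l = 1)"

lemma partial_fraction_coeffsD:
  assumes "partial_fraction_coeffs p K m c"
  shows "c j k \<noteq> 0 \<Longrightarrow> 1 \<le> k \<and> k \<le> count m j"
    "pole_fps m = (\<Sum>(j, k)\<in>{..p} \<times> {..K}. fps_const (c j k) * pole_fps (replicate_mset k j))"
    "(\<Sum>(j, k)\<in>{..p} \<times> {..K}. norm (c j k)) \<le> 2 ^ (size m - 1)"
    "of_nat (Lcm {1..p}) ^ (size m - 1) * c j k \<in> \<int>"
    "l \<in># m \<Longrightarrow> c l (count m l) * node_diffs m l = 1"
  using assms by (auto simp: partial_fraction_coeffs_def)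

text \<open>If the nodes are not all equal, two distinct nodes \<open>i\<close> and \<open>j\<close> are separated by the elementary step. Each step
adds two expansions with one node less and divides by the integer \<open>j - i\<close>, a divisor of
\<open>lcm(1, \<dots>, p)\<close>; so each node costs at most a factor \<open>2\<close> in size and a factor \<open>lcm(1, \<dots>, p)\<close> in the
denominator.\<close>

lemma partial_fraction_coeffs_exist:
  fixes p K :: nat
  assumes "m \<noteq> {#}" "\<forall>i \<in># m. i \<le> p" "size m \<le> K"
  shows "\<exists>c. partial_fraction_coeffs p K m c"
  using assms
proof (induction "size m" arbitrary: m rule: less_induct)
  case less
  let ?J = "{..p} \<times> {..K}"
  obtain j0 where j0: "j0 \<in># m" using less.prems by auto
  show ?case
  proof (cases "\<exists>i. i \<in># m \<and> i \<noteq> j0")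
    case False
    then have "\<forall>i \<in># m. i = j0" by blast
    then have m: "m = replicate_mset (size m) j0"
      by (intro set_mset_subset_singletonD) auto
    define M where "M = size m"
    have M: "m = replicate_mset M j0" "1 \<le> M" "M \<le> K" "j0 \<le> p"
      using m less.prems j0 by (auto simp: M_def Suc_le_eq nonempty_has_size)
    define c where "c = (\<lambda>j k. if j = j0 \<and> k = M then 1 else 0 :: complex)"
    have sum: "(\<Sum>(j, k)\<in>?J. f j k) = f j0 M" if "\<And>j k. (j, k) \<noteq> (j0, M) \<Longrightarrow> f j k = 0"
      for f :: "nat \<Rightarrow> nat \<Rightarrow> 'b::comm_monoid_add"
    proof -
      have "(\<Sum>(j, k)\<in>?J. f j k) = (\<Sum>(j, k)\<in>{(j0, M)}. f j k)"
        by (rule sum.mono_neutral_right) (use M that in auto)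
      then show ?thesis by simp
    qed
    have rep: "(\<Sum>(j, k)\<in>?J. fps_const (c j k) * pole_fps (replicate_mset k j)) = pole_fps m"
      by (subst sum) (auto simp: c_def M(1))
    have norm: "(\<Sum>(j, k)\<in>?J. norm (c j k)) = 1"
      by (subst sum) (auto simp: c_def)
    have fil: "filter_mset (\<lambda>i. i \<noteq> j0) (replicate_mset r j0) = {#}" for r by (induction r) auto
    have "node_diffs m j0 = 1"
      unfolding node_diffs_def M(1) fil by simp
    then have lead: "c j0 M * node_diffs m j0 = 1"
      by (simp add: c_def)
    have cnt: "count m j = (if j = j0 then M else 0)" for j
      by (simp add: M(1))
    show ?thesis
    proof (rule exI[of _ c], unfold partial_fraction_coeffs_def, intro conjI allI impI)
      fix l assume "l \<in># m"
      then have "l = j0" using cnt[of l] by (auto simp: count_greater_zero_iff[symmetric] split: if_splits)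
      then show "c l (count m l) * node_diffs m l = 1" using lead cnt by simp
    qed (use rep norm cnt M(2) in \<open>auto simp: c_def split: if_splits\<close>)
  next
    case True
    then obtain i0 where i0: "i0 \<in># m" "i0 \<noteq> j0" by blast
    then obtain y where y: "m = add_mset i0 y" by (auto dest: mset_add)
    then have "j0 \<in># y" using j0 i0(2) by auto
    then obtain z where "y = add_mset j0 z" by (auto dest: mset_add)
    with y have z: "m = add_mset i0 (add_mset j0 z)" by simp
    define m1 m2 where "m1 = add_mset j0 z" and "m2 = add_mset i0 z"
    define e where "e = (of_nat j0 - of_nat i0 :: complex)"
    have e: "e \<noteq> 0" "norm e \<ge> 1"
    proof -
      show "e \<noteq> 0" using i0 by (simp add: e_def)
      have "e = of_int (int j0 - int i0)" by (simp add: e_def)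
      then have "norm e = \<bar>of_int (int j0 - int i0)\<bar>" by (simp only: norm_of_int)
      also have "\<dots> \<ge> 1" using i0(2) by linarith
      finally show "norm e \<ge> 1" .
    qed
    have le: "i0 \<le> p" "j0 \<le> p" using less.prems i0 j0 by auto
    have "\<exists>c. partial_fraction_coeffs p K m1 c"
      by (rule less.hyps) (use less.prems in \<open>auto simp: z m1_def\<close>)
    then obtain c1 where "partial_fraction_coeffs p K m1 c1" ..
    note c1 = partial_fraction_coeffsD[OF this]
    have "\<exists>c. partial_fraction_coeffs p K m2 c"
      by (rule less.hyps) (use less.prems in \<open>auto simp: z m2_def\<close>)
    then obtain c2 where "partial_fraction_coeffs p K m2 c2" ..
    note c2 = partial_fraction_coeffsD[OF this]
    define s where "s = size z"
    have sizes: "size m - 1 = Suc s" "size m1 - 1 = s" "size m2 - 1 = s"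
      by (simp_all add: z m1_def m2_def s_def)
    define c where "c j k = (c1 j k - c2 j k) / e" for j k
    have supp: "1 \<le> k \<and> k \<le> count m j" if "c j k \<noteq> 0" for j k
    proof -
      have "c1 j k \<noteq> 0 \<or> c2 j k \<noteq> 0" using that by (auto simp: c_def)
      then show ?thesis using c1(1)[of j k] c2(1)[of j k] by (auto simp: z m1_def m2_def split: if_splits)
    qed
    have "fps_const e * pole_fps m = (fps_const e * (pole_factor i0 * pole_factor j0)) * pole_fps z"
      by (simp only: z pole_fps_add mult.assoc)
    also have "\<dots> = pole_fps m1 - pole_fps m2"
      by (simp only: e_def pole_factor_diff m1_def m2_def pole_fps_add left_diff_distrib)
    finally have "fps_const e * pole_fps m = pole_fps m1 - pole_fps m2" .
    then have "fps_const (1 / e) * (fps_const e * pole_fps m) = fps_const (1 / e) * (pole_fps m1 - pole_fps m2)"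
      by simp
    then have "pole_fps m = fps_const (1 / e) * (pole_fps m1 - pole_fps m2)"
      using e(1) by (simp add: mult.assoc[symmetric])
    also have "\<dots> = (\<Sum>(j, k)\<in>?J. fps_const (c j k) * pole_fps (replicate_mset k j))"
      unfolding c1(2) c2(2) sum_subtractf[symmetric] sum_distrib_left
    proof (intro sum.cong refl, clarify)
      fix j k
      have "fps_const (c j k) = fps_const (1 / e) * (fps_const (c1 j k) - fps_const (c2 j k))"
        by (simp add: c_def)
      then show "fps_const (1 / e) * (fps_const (c1 j k) * pole_fps (replicate_mset k j)
            - fps_const (c2 j k) * pole_fps (replicate_mset k j))
          = fps_const (c j k) * pole_fps (replicate_mset k j)"
        by (simp only: left_diff_distrib right_diff_distrib mult.assoc)
    qed
    finally have rep: "pole_fps m = (\<Sum>(j, k)\<in>?J. fps_const (c j k) * pole_fps (replicate_mset k j))" .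
    have "norm (c j k) \<le> norm (c1 j k) + norm (c2 j k)" for j k
    proof -
      have "norm (c j k) = norm (c1 j k - c2 j k) / norm e" by (simp add: c_def norm_divide)
      also have "\<dots> \<le> norm (c1 j k - c2 j k) / 1"
        using e(2) by (intro divide_left_mono) auto
      also have "\<dots> \<le> norm (c1 j k) + norm (c2 j k)" by (simp add: norm_triangle_ineq4)
      finally show ?thesis .
    qed
    then have "(\<Sum>(j, k)\<in>?J. norm (c j k)) \<le> (\<Sum>(j, k)\<in>?J. norm (c1 j k) + norm (c2 j k))"
      by (intro sum_mono) auto
    also have "\<dots> \<le> 2 ^ s + 2 ^ s"
      using c1(3) c2(3) sizes by (simp add: sum.distrib case_prod_unfold)
    finally have norm: "(\<Sum>(j, k)\<in>?J. norm (c j k)) \<le> 2 ^ (size m - 1)"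
      unfolding sizes by simp
    have int: "of_nat (Lcm {1..p}) ^ (size m - 1) * c j k \<in> \<int>" for j k
    proof -
      let ?L = "of_nat (Lcm {1..p}) :: complex"
      have "?L ^ (size m - 1) * c j k = (?L / e) * (?L ^ s * c1 j k - ?L ^ s * c2 j k)"
        unfolding sizes by (simp add: c_def algebra_simps diff_divide_distrib)
      also have "\<dots> \<in> \<int>"
        using Lcm_div_diff_Ints[OF le i0(2)] c1(4)[unfolded sizes] c2(4)[unfolded sizes]
        unfolding e_def by (rule Ints_mult[OF _ Ints_diff])
      finally show ?thesis .
    qed
    have lead: "c l (count m l) * node_diffs m l = 1" if l: "l \<in># m" for l
    proof -
      consider "l = i0" | "l = j0" | "l \<noteq> i0" "l \<noteq> j0" by blast
      then show ?thesis
      proof cases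
        case 1
        have "c1 l (count m l) = 0"
          using c1(1)[of l "count m l"] 1 i0(2) by (auto simp: z m1_def)
        moreover have "count m l = count m2 l" using 1 i0(2) by (simp add: z m2_def)
        moreover have "node_diffs m l = - e * node_diffs m2 l"
          using 1 i0(2) by (simp add: z m2_def node_diffs_def e_def)
        ultimately show ?thesis
          using c2(5)[of l] 1 e(1) by (simp add: c_def m2_def)
      next
        case 2
        have "c2 l (count m l) = 0"
          using c2(1)[of l "count m l"] 2 i0(2) by (auto simp: z m2_def)
        moreover have "count m l = count m1 l" using 2 i0(2) by (simp add: z m1_def)
        moreover have "node_diffs m l = e * node_diffs m1 l"
          using 2 i0(2) by (simp add: z m1_def node_diffs_def e_def)
        ultimately show ?thesis
          using c1(5)[of l] 2 e(1) by (simp add: c_def m1_def)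
      next
        case 3
        then have lz: "l \<in># m1" "l \<in># m2" using l by (auto simp: z m1_def m2_def)
        have cnt: "count m1 l = count m l" "count m2 l = count m l"
          using 3 by (auto simp: z m1_def m2_def)
        have W: "node_diffs m l = (of_nat l - of_nat i0) * node_diffs m1 l"
          "node_diffs m l = (of_nat l - of_nat j0) * node_diffs m2 l"
          using 3 by (auto simp: z m1_def m2_def node_diffs_def)
        have "c1 l (count m l) * node_diffs m l = of_nat l - of_nat i0"
          unfolding W(1) using c1(5)[OF lz(1)] cnt by (simp add: mult.left_commute)
        moreover have "c2 l (count m l) * node_diffs m l = of_nat l - of_nat j0"
          unfolding W(2) using c2(5)[OF lz(2)] cnt by (simp add: mult.left_commute)
        ultimately have "(c1 l (count m l) - c2 l (count m l)) * node_diffs m l = e"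
          by (simp add: e_def left_diff_distrib)
        then show ?thesis using e(1) by (simp add: c_def)
      qed
    qed
    show ?thesis
    proof (rule exI[of _ c], unfold partial_fraction_coeffs_def, intro conjI)
      show "\<forall>j k. c j k \<noteq> 0 \<longrightarrow> 1 \<le> k \<and> k \<le> count m j" using supp by blast
    qed (use rep norm int lead in simp_all)
  qed
qed

section \<open>Simultaneous approximation of exponential functions\<close>

text \<open>The inverse Laplace transform, for expansions in \<open>X = 1 / x\<close>: \<open>1 / x\<^sup>s\<^sup>+\<^sup>1\<close> becomes \<open>z\<^sup>s / s!\<close>, so that
\<open>1 / (x - j)\<^sup>k\<^sup>+\<^sup>1\<close> becomes \<open>z\<^sup>k / k! \<cdot> e\<^sup>j\<^sup>z\<close>, and a rational function that vanishes to a high order at infinity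
becomes an exponential polynomial that vanishes to a high order at \<open>0\<close>.\<close>

definition borel_transform :: "complex fps \<Rightarrow> complex fps" where
  "borel_transform f = Abs_fps (\<lambda>s. f $ Suc s / fact s)"

lemma borel_transform_nth: "borel_transform f $ s = f $ Suc s / fact s"
  by (simp add: borel_transform_def)

lemma borel_transform_cmult: "borel_transform (fps_const c * f) = fps_const c * borel_transform f"
  by (rule fps_ext) (simp add: borel_transform_nth)

lemma borel_transform_sum: "borel_transform (sum f S) = (\<Sum>i\<in>S. borel_transform (f i))"
  by (rule fps_ext) (simp add: borel_transform_nth fps_sum_nth sum_divide_distrib)

lemma borel_transform_replicate:
  "borel_transform (pole_fps (replicate_mset (Suc k) j)) =
    fps_const (1 / fact k) * (fps_X ^ k * fps_exp (of_nat j))"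
proof (rule fps_ext)
  fix s
  have nth: "(fps_X ^ k * fps_exp (of_nat j :: complex)) $ s =
      (if s < k then 0 else of_nat j ^ (s - k) / fact (s - k))"
    by (simp add: fps_X_power_mult_nth)
  show "borel_transform (pole_fps (replicate_mset (Suc k) j)) $ s =
      (fps_const (1 / fact k) * (fps_X ^ k * fps_exp (of_nat j))) $ s"
    unfolding borel_transform_nth pole_fps_replicate_nth fps_mult_left_const_nth nth
    by (cases "s < k") (simp_all add: binomial_eq_0 binomial_fact)
qed

text \<open>The polynomials \<open>A j\<close> are the coefficients of \<open>e\<^sup>j\<^sup>z\<close> in a Hermite-Pade form; the multiplicity of a node \<open>j\<close> in \<open>m\<close> is
one more than the degree of \<open>A j\<close>. The factorials \<open>k!\<close> are kept apart from the other denominators since they divide \<open>n!\<close>.\<close>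

definition approximants :: "nat \<Rightarrow> nat multiset \<Rightarrow> (nat \<Rightarrow> complex poly) \<Rightarrow> bool" where
  "approximants p m A \<longleftrightarrow>
    (\<forall>j k. count m j \<le> k \<longrightarrow> coeff (A j) k = 0) \<and>
    (\<forall>j k. count m j = Suc k \<longrightarrow> coeff (A j) k \<noteq> 0) \<and>
    (\<forall>j k. of_nat (Lcm {1..p}) ^ (size m - 1) * (fact k * coeff (A j) k) \<in> \<int>) \<and>
    (\<Sum>(j, k)\<in>{..p} \<times> {..<size m}. fact k * norm (coeff (A j) k)) \<le> 2 ^ (size m - 1) \<and>
    (\<Sum>j\<le>p. fps_of_poly (A j) * fps_exp (of_nat j)) = borel_transform (pole_fps m)"

lemma approximantsD:
  assumes "approximants p m A"
  shows "count m j \<le> k \<Longrightarrow> coeff (A j) k = 0"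
    "count m j = Suc k \<Longrightarrow> coeff (A j) k \<noteq> 0"
    "of_nat (Lcm {1..p}) ^ (size m - 1) * (fact k * coeff (A j) k) \<in> \<int>"
    "(\<Sum>(j, k)\<in>{..p} \<times> {..<size m}. fact k * norm (coeff (A j) k)) \<le> 2 ^ (size m - 1)"
    "(\<Sum>j\<le>p. fps_of_poly (A j) * fps_exp (of_nat j)) = borel_transform (pole_fps m)"
  using assms by (auto simp: approximants_def)

lemma approximants_exist:
  assumes "m \<noteq> {#}" "\<forall>i \<in># m. i \<le> p"
  shows "\<exists>A. approximants p m A"
proof -
  obtain c where "partial_fraction_coeffs p (size m) m c"
    using partial_fraction_coeffs_exist[OF assms order_refl] ..
  note c = partial_fraction_coeffsD[OF this]
  define A where "A j = (\<Sum>k<size m. monom (c j (Suc k) / fact k) k)" for j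
  have coeff: "coeff (A j) k = c j (Suc k) / fact k" for j k
  proof -
    have "coeff (A j) k = (if k < size m then c j (Suc k) / fact k else 0)"
      by (simp add: A_def coeff_sum)
    moreover have "c j (Suc k) = 0" if "\<not> k < size m"
      using c(1)[of j "Suc k"] count_le_size[of m j] that by (auto simp: not_less)
    ultimately show ?thesis by simp
  qed
  have c0: "c j 0 = 0" for j using c(1)[of j 0] by auto
  have shift: "(\<Sum>(j, k)\<in>{..p} \<times> {..size m}. f j k) = (\<Sum>j\<le>p. \<Sum>k<size m. f j (Suc k))"
    if "\<And>j. f j 0 = 0" for f :: "nat \<Rightarrow> nat \<Rightarrow> 'b::comm_monoid_add"
    unfolding sum.cartesian_product[symmetric] lessThan_Suc_atMost[symmetric] sum.lessThan_Suc_shift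
    using that by (simp add: sum.lessThan_Suc_shift)
  have "norm (coeff (A j) k) * fact k = norm (c j (Suc k))" for j k
    by (simp add: coeff norm_divide)
  then have "(\<Sum>(j, k)\<in>{..p} \<times> {..<size m}. fact k * norm (coeff (A j) k)) =
      (\<Sum>j\<le>p. \<Sum>k<size m. norm (c j (Suc k)))"
    unfolding sum.cartesian_product[symmetric] by (simp add: mult.commute)
  also have "\<dots> = (\<Sum>(j, k)\<in>{..p} \<times> {..size m}. norm (c j k))"
    by (rule shift[symmetric]) (simp add: c0)
  finally have norm: "(\<Sum>(j, k)\<in>{..p} \<times> {..<size m}. fact k * norm (coeff (A j) k)) \<le> 2 ^ (size m - 1)"
    using c(3) by simp
  have "borel_transform (pole_fps m) =
      (\<Sum>(j, k)\<in>{..p} \<times> {..size m}. fps_const (c j k) * borel_transform (pole_fps (replicate_mset k j)))"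
    unfolding c(2) borel_transform_sum by (intro sum.cong) (auto simp: borel_transform_cmult)
  also have "\<dots> = (\<Sum>j\<le>p. \<Sum>k<size m.
      fps_const (c j (Suc k)) * borel_transform (pole_fps (replicate_mset (Suc k) j)))"
    by (rule shift) (simp add: c0)
  also have "\<dots> = (\<Sum>j\<le>p. fps_of_poly (A j) * fps_exp (of_nat j))"
  proof (intro sum.cong refl)
    fix j
    have "fps_of_poly (A j) = (\<Sum>k<size m. fps_const (c j (Suc k) * (1 / fact k)) * fps_X ^ k)"
      by (simp add: A_def fps_of_poly_sum fps_of_poly_monom)
    then show "(\<Sum>k<size m. fps_const (c j (Suc k)) * borel_transform (pole_fps (replicate_mset (Suc k) j)))
        = fps_of_poly (A j) * fps_exp (of_nat j)"
      unfolding borel_transform_replicate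
      by (simp only: sum_distrib_right fps_const_mult[symmetric] mult.assoc)
  qed
  finally have rep: "(\<Sum>j\<le>p. fps_of_poly (A j) * fps_exp (of_nat j)) = borel_transform (pole_fps m)" ..
  have "approximants p m A"
    unfolding approximants_def
  proof (intro conjI allI impI)
    fix j k assume "count m j \<le> k"
    then show "coeff (A j) k = 0" using c(1)[of j "Suc k"] by (auto simp: coeff)
  next
    fix j k assume k: "count m j = Suc k"
    then have "j \<in># m" by (simp flip: count_greater_zero_iff)
    then show "coeff (A j) k \<noteq> 0" using c(5)[of j] k by (auto simp: coeff)
  next
    fix j k
    show "of_nat (Lcm {1..p}) ^ (size m - 1) * (fact k * coeff (A j) k) \<in> \<int>"
      using c(4)[of j "Suc k"] by (simp add: coeff)
  qed (fact norm rep)+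
  then show ?thesis by blast
qed

lemma approximants_vanish:
  assumes A: "approximants p m A" and m: "\<forall>i \<in># m. i \<le> p" "size m = Suc N"
  shows "s < N \<Longrightarrow> (\<Sum>j\<le>p. fps_of_poly (A j) * fps_exp (of_nat j)) $ s = 0"
    and "norm ((\<Sum>j\<le>p. fps_of_poly (A j) * fps_exp (of_nat j)) $ s) \<le>
      real (s choose N) * real p ^ (s - N) / fact s"
proof -
  have "norm (pole_fps m $ Suc s) \<le> real (s choose N) * real p ^ (s - N)" for s
    by (rule pole_fps_nth_bound[OF m(2)]) (use m in auto)
  then show bound: "norm ((\<Sum>j\<le>p. fps_of_poly (A j) * fps_exp (of_nat j)) $ s) \<le>
      real (s choose N) * real p ^ (s - N) / fact s" for s
    unfolding approximantsD(5)[OF A] borel_transform_nth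
    by (simp add: norm_divide divide_right_mono)
  show "(\<Sum>j\<le>p. fps_of_poly (A j) * fps_exp (of_nat j)) $ s = 0" if "s < N" for s
    using bound[of s] that by (simp add: binomial_eq_0)
qed

text \<open>From the order \<open>N\<close> on, the Taylor coefficients are at most those of \<open>z\<^sup>N / N! \<cdot> e\<^sup>p\<^sup>z\<close>.\<close>

lemma approximants_value_bound:
  assumes A: "approximants p m A" and m: "\<forall>i \<in># m. i \<le> p" "size m = Suc N"
  shows "norm (\<Sum>j\<le>p. poly (A j) z * exp (of_nat j * z)) \<le> norm z ^ N / fact N * exp (real p * norm z)"
proof -
  define F where "F = (\<Sum>j\<le>p. fps_of_poly (A j) * fps_exp (of_nat j))"
  define g where "g s = real (s choose N) * real p ^ (s - N) / fact s * norm z ^ s" for s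
  have one: "(\<lambda>s. (fps_of_poly Q * fps_exp c) $ s * z ^ s) sums (poly Q z * exp (c * z))"
    for Q :: "complex poly" and c
  proof -
    have "fps_conv_radius (fps_of_poly Q * fps_exp c) \<ge> \<infinity>"
      using fps_conv_radius_mult[of "fps_of_poly Q" "fps_exp c"] by simp
    then have "(\<lambda>s. (fps_of_poly Q * fps_exp c) $ s * z ^ s) sums eval_fps (fps_of_poly Q * fps_exp c) z"
      by (intro sums_eval_fps) auto
    then show ?thesis by (simp add: eval_fps_mult)
  qed
  have "(\<lambda>s. \<Sum>j\<le>p. (fps_of_poly (A j) * fps_exp (of_nat j)) $ s * z ^ s) sums
      (\<Sum>j\<le>p. poly (A j) z * exp (of_nat j * z))"
    by (intro sums_sum one)
  then have F: "(\<lambda>s. F $ s * z ^ s) sums (\<Sum>j\<le>p. poly (A j) z * exp (of_nat j * z))"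
    by (simp add: F_def fps_sum_nth sum_distrib_right)
  have le: "norm (F $ s * z ^ s) \<le> g s" for s
    unfolding g_def norm_mult norm_power F_def
    by (intro mult_right_mono approximants_vanish(2)[OF A m]) auto
  have "g (s + N) = norm z ^ N / fact N * ((real p * norm z) ^ s / fact s)" for s
  proof -
    have "real (s + N choose N) = fact (s + N) / (fact N * fact s)"
      by (subst binomial_fact) auto
    then show ?thesis by (simp add: g_def power_add power_mult_distrib field_simps)
  qed
  moreover have "(\<lambda>s. norm z ^ N / fact N * ((real p * norm z) ^ s / fact s)) sums
      (norm z ^ N / fact N * exp (real p * norm z))"
    by (intro sums_mult) (use exp_converges[of "real p * norm z"] in \<open>simp add: field_simps scaleR_conv_of_real\<close>)
  ultimately have "(\<lambda>s. g (s + N)) sums (norm z ^ N / fact N * exp (real p * norm z))" by simp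
  then have g: "g sums (norm z ^ N / fact N * exp (real p * norm z))"
    by (subst (asm) sums_zero_iff_shift) (auto simp: g_def binomial_eq_0)
  have "norm (\<Sum>s. F $ s * z ^ s) \<le> suminf g"
    by (rule norm_suminf_le[OF le sums_summable[OF g]])
  then show ?thesis using sums_unique[OF F] sums_unique[OF g] by simp
qed

text \<open>Multiplication on the right by the unipotent matrix whose first column is \<open>x\<close>. It is used
for the powers of \<open>e\<^sup>z\<close> as power series and for the powers of the number \<open>e\<^sup>\<alpha>\<close>.\<close>

lemma det_replace_col_0:
  fixes f :: "nat \<Rightarrow> nat \<Rightarrow> 'a::comm_ring_1"
  assumes "x 0 = 1"
  shows "det (mat (Suc n) (Suc n) (\<lambda>(i, j). f i j)) =
    det (mat (Suc n) (Suc n) (\<lambda>(i, j). if j = 0 then \<Sum>k\<le>n. f i k * x k else f i j))"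
proof -
  define M where "M = mat (Suc n) (Suc n) (\<lambda>(i, j). f i j)"
  define T where "T = mat (Suc n) (Suc n) (\<lambda>(k, j). if j = 0 then x k else if k = j then 1 else 0)"
  have carr: "M \<in> carrier_mat (Suc n) (Suc n)" "T \<in> carrier_mat (Suc n) (Suc n)"
    by (auto simp: M_def T_def)
  have "det T = prod_list (diag_mat T)"
    by (rule det_lower_triangular[OF _ carr(2)]) (auto simp: T_def)
  also have "diag_mat T = map (\<lambda>_. 1) [0..<Suc n]"
    unfolding diag_mat_def using assms by (intro map_cong) (auto simp: T_def)
  also have "prod_list \<dots> = (1::'a)" by (induction n) auto
  finally have "det (M * T) = det M" using det_mult[OF carr] by simp
  moreover have "M * T = mat (Suc n) (Suc n) (\<lambda>(i, j). if j = 0 then \<Sum>k\<le>n. f i k * x k else f i j)"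
  proof (rule eq_matI)
    fix i j assume "i < dim_row (mat (Suc n) (Suc n) (\<lambda>(i, j). if j = 0 then \<Sum>k\<le>n. f i k * x k else f i j))"
      "j < dim_col (mat (Suc n) (Suc n) (\<lambda>(i, j). if j = 0 then \<Sum>k\<le>n. f i k * x k else f i j))"
    then have ij: "i < Suc n" "j < Suc n" by auto
    have "(M * T) $$ (i, j) = (\<Sum>k\<le>n. f i k * (if j = 0 then x k else if k = j then 1 else 0))"
      using ij by (simp add: M_def T_def scalar_prod_def atLeast0LessThan lessThan_Suc_atMost)
    also have "\<dots> = (if j = 0 then \<Sum>k\<le>n. f i k * x k else f i j)"
      using ij by (simp add: if_distrib[of "\<lambda>y. _ * y"] cong: if_cong)
    finally show "(M * T) $$ (i, j) =
        mat (Suc n) (Suc n) (\<lambda>(i, j). if j = 0 then \<Sum>k\<le>n. f i k * x k else f i j) $$ (i, j)"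
      using ij by simp
  qed (auto simp: M_def T_def)
  ultimately show ?thesis by (simp add: M_def)
qed

lemma coeff_mult_top:
  assumes "degree f \<le> a" "degree g \<le> b"
  shows "coeff (f * g) (a + b) = coeff f a * coeff g b"
proof -
  have "coeff f i * coeff g (a + b - i) = 0" if "i \<le> a + b" "i \<noteq> a" for i
    using that assms by (cases "i < a") (auto simp: coeff_eq_0)
  then have "coeff (f * g) (a + b) = (\<Sum>i\<in>{a}. coeff f i * coeff g (a + b - i))"
    unfolding coeff_mult by (intro sum.mono_neutral_right) auto
  then show ?thesis by simp
qed

lemma coeff_prod_top:
  assumes "finite I" "\<And>i. i \<in> I \<Longrightarrow> degree (f i) \<le> n"
  shows "degree (prod f I) \<le> card I * n \<and> coeff (prod f I) (card I * n) = (\<Prod>i\<in>I. coeff (f i) n)"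
  using assms
proof (induction I rule: finite_induct)
  case (insert i I)
  then have IH: "degree (prod f I) \<le> card I * n" "coeff (prod f I) (card I * n) = (\<Prod>i\<in>I. coeff (f i) n)"
    and i: "degree (f i) \<le> n" by auto
  have "degree (f i * prod f I) \<le> n + card I * n"
    using degree_mult_le[of "f i" "prod f I"] IH(1) i by linarith
  then show ?case using insert.hyps coeff_mult_top[OF i IH(1)] IH(2) by simp
qed simp

text \<open>The extra multiplicity at \<open>l\<close> makes the diagonal entries of the resulting system dominate in degree.\<close>

definition node_mset :: "nat \<Rightarrow> nat \<Rightarrow> nat \<Rightarrow> nat multiset" where
  "node_mset p n l = (\<Sum>j\<le>p. replicate_mset (if j = l then Suc n else n) j)"

lemma count_node_mset: "count (node_mset p n l) i = (if i \<le> p then if i = l then Suc n else n else 0)"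
  by (simp add: node_mset_def count_sum)

lemma size_node_mset: "l \<le> p \<Longrightarrow> size (node_mset p n l) = Suc (Suc p * n)"
proof -
  have "size (\<Sum>j\<le>r. replicate_mset (if j = l then Suc n else n) j) = Suc r * n + (if l \<le> r then 1 else 0)" for r
    by (induction r) auto
  then show "l \<le> p \<Longrightarrow> ?thesis" by (simp add: node_mset_def)
qed

lemma node_mset_le: "\<forall>i \<in># node_mset p n l. i \<le> p"
  by (auto simp: count_node_mset simp flip: count_greater_zero_iff split: if_splits)

text \<open>All entries have degree at most \<open>n\<close>, and off the diagonal the coefficient of \<open>z\<^sup>n\<close> vanishes. So only the identity permutation contributes to the
coefficient of \<open>z\<^sup>N\<close>, and the determinant has degree at most \<open>N\<close>. Replacing the first column by the
forms themselves shows that it is divisible by \<open>z\<^sup>N\<close>. So it is a nonzero constant times \<open>z\<^sup>N\<close>.\<close>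

lemma approximants_det_nonzero:
  assumes A: "\<And>l. l \<le> p \<Longrightarrow> approximants p (node_mset p n l) (A l)" and \<alpha>: "\<alpha> \<noteq> 0"
  shows "det (mat (Suc p) (Suc p) (\<lambda>(l, j). poly (A l j) \<alpha>)) \<noteq> 0"
proof -
  define N where "N = Suc p * n"
  define M where "M = mat (Suc p) (Suc p) (\<lambda>(l, j). A l j)"
  define D where "D = det M"
  have M: "M \<in> carrier_mat (Suc p) (Suc p)" by (simp add: M_def)
  note cnt = count_node_mset
  have deg: "degree (A l j) \<le> n" if "l \<le> p" "j \<le> p" for l j
    by (rule degree_le) (use approximantsD(1)[OF A[OF that(1)]] that in \<open>auto simp: cnt\<close>)
  have diag: "coeff (A l l) n \<noteq> 0" if "l \<le> p" for l
    using approximantsD(2)[OF A[OF that], of l n] that by (simp add: cnt)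
  have off: "coeff (A l j) n = 0" if "l \<le> p" "j \<le> p" "j \<noteq> l" for l j
    using approximantsD(1)[OF A[OF that(1)], of j n] that by (simp add: cnt)
  have D: "D = (\<Sum>\<pi> | \<pi> permutes {0..<Suc p}. signof \<pi> * (\<Prod>i = 0..<Suc p. A i (\<pi> i)))"
    unfolding D_def det_def'[OF M] by (intro sum.cong prod.cong refl arg_cong2[of _ _ _ _ "(*)"])
      (auto simp: M_def dest: permutes_in_image)
  have perm: "degree (\<Prod>i = 0..<Suc p. A i (\<pi> i)) \<le> N \<and>
      coeff (\<Prod>i = 0..<Suc p. A i (\<pi> i)) N = (\<Prod>i = 0..<Suc p. coeff (A i (\<pi> i)) n)"
    if "\<pi> permutes {0..<Suc p}" for \<pi>
    using coeff_prod_top[of "{0..<Suc p}" "\<lambda>i. A i (\<pi> i)" n] deg permutes_in_image[OF that]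
    by (auto simp: N_def less_Suc_eq_le)
  have sgn: "signof \<pi> * f = Polynomial.smult (signof \<pi>) f" for \<pi> :: "nat \<Rightarrow> nat" and f :: "complex poly"
    by (simp add: sign_def)
  define Pr where "Pr \<pi> = (\<Prod>i = 0..<Suc p. A i (\<pi> i))" for \<pi>
  note D = D[folded Pr_def] and perm = perm[folded Pr_def]
  have degD: "degree D \<le> N"
    unfolding D sgn by (intro degree_sum_le) (auto intro: order.trans[OF degree_smult_le] simp: perm finite_permutations)
  have "coeff D N = (\<Sum>\<pi> | \<pi> permutes {0..<Suc p}. signof \<pi> * (\<Prod>i = 0..<Suc p. coeff (A i (\<pi> i)) n))"
    unfolding D sgn coeff_sum coeff_smult by (intro sum.cong refl) (simp add: perm)
  also have "\<dots> = (\<Sum>\<pi>\<in>{id}. signof \<pi> * (\<Prod>i = 0..<Suc p. coeff (A i (\<pi> i)) n))"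
  proof (rule sum.mono_neutral_right)
    show "\<forall>\<pi>\<in>{\<pi>. \<pi> permutes {0..<Suc p}} - {id}. signof \<pi> * (\<Prod>i = 0..<Suc p. coeff (A i (\<pi> i)) n) = 0"
    proof
      fix \<pi> assume \<pi>: "\<pi> \<in> {\<pi>. \<pi> permutes {0..<Suc p}} - {id}"
      then have p: "\<pi> permutes {0..<Suc p}" by simp
      from \<pi> obtain i where i: "\<pi> i \<noteq> i" by (auto simp: fun_eq_iff)
      then have "i < Suc p" using p by (auto simp: permutes_def)
      moreover have "\<pi> i < Suc p" using permutes_in_image[OF p, of i] \<open>i < Suc p\<close> by simp
      ultimately have "coeff (A i (\<pi> i)) n = 0" "i \<in> {0..<Suc p}" using off[of i "\<pi> i"] i by auto
      then have "(\<Prod>i = 0..<Suc p. coeff (A i (\<pi> i)) n) = 0" by (intro prod_zero) auto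
      then show "signof \<pi> * (\<Prod>i = 0..<Suc p. coeff (A i (\<pi> i)) n) = 0" by simp
    qed
  qed (auto simp: finite_permutations permutes_id)
  also have "\<dots> = (\<Prod>i = 0..<Suc p. coeff (A i i) n)" by (simp add: sign_def)
  also have "\<dots> \<noteq> 0" using diag by (simp add: less_Suc_eq_le)
  finally have lead: "coeff D N \<noteq> 0" .
  interpret hom: comm_ring_hom "fps_of_poly :: complex poly \<Rightarrow> complex fps"
    by unfold_locales (auto simp: fps_of_poly_add fps_of_poly_mult)
  have ev: "comm_ring_hom (\<lambda>f. poly f \<alpha>)"
    by unfold_locales auto
  define R where "R l = (\<Sum>j\<le>p. fps_of_poly (A l j) * fps_exp (of_nat j :: complex))" for l
  have "fps_of_poly D = det (map_mat fps_of_poly M)" by (simp add: D_def)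
  also have "map_mat fps_of_poly M = mat (Suc p) (Suc p) (\<lambda>(l, j). fps_of_poly (A l j))"
    by (auto simp: M_def)
  also have "det \<dots> = det (mat (Suc p) (Suc p) (\<lambda>(l, j). if j = 0 then R l else fps_of_poly (A l j)))"
    unfolding R_def by (rule det_replace_col_0) (simp add: fps_eq_iff)
  also have "fps_X ^ N dvd \<dots>"
  proof -
    have R: "fps_X ^ N dvd R l" if "l \<le> p" for l
    proof -
      have "R l $ s = 0" if "s < N" for s
        unfolding R_def by (rule approximants_vanish(1)[OF A[OF \<open>l \<le> p\<close>] node_mset_le _ that])
          (simp only: size_node_mset[OF \<open>l \<le> p\<close>] N_def)
      then have "R l = fps_X ^ N * fps_shift N (R l)"
        by (intro fps_ext) (simp add: fps_X_power_mult_nth)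
      then show ?thesis by (metis dvd_triv_left)
    qed
    show ?thesis
      unfolding det_def'[OF mat_carrier]
    proof (rule dvd_sum)
      fix \<pi> assume "\<pi> \<in> {\<pi>. \<pi> permutes {0..<Suc p}}"
      then have p: "\<pi> permutes {0..<Suc p}" by simp
      then obtain i where i: "i \<in> {0..<Suc p}" "\<pi> i = 0"
        by (metis atLeast0LessThan lessThan_iff permutes_surj surjD permutes_in_image zero_less_Suc)
      have "fps_X ^ N dvd mat (Suc p) (Suc p) (\<lambda>(l, j). if j = 0 then R l else fps_of_poly (A l j)) $$ (i, \<pi> i)"
        using i R[of i] by (simp add: less_Suc_eq_le)
      also have "\<dots> dvd (\<Prod>i = 0..<Suc p. mat (Suc p) (Suc p) (\<lambda>(l, j). if j = 0 then R l else fps_of_poly (A l j)) $$ (i, \<pi> i))"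
        by (rule dvd_prodI) (use i in auto)
      finally show "fps_X ^ N dvd signof \<pi> * (\<Prod>i = 0..<Suc p. mat (Suc p) (Suc p) (\<lambda>(l, j). if j = 0 then R l else fps_of_poly (A l j)) $$ (i, \<pi> i))"
        by (rule dvd_mult)
    qed
  qed
  finally obtain Q where Q: "fps_of_poly D = fps_X ^ N * Q" by (rule dvdE)
  have low: "coeff D s = 0" if "s < N" for s
    using arg_cong[OF Q, of "\<lambda>f. fps_nth f s"] that by (simp add: fps_X_power_mult_nth)
  have "D = monom (coeff D N) N"
  proof (rule poly_eqI)
    fix s
    show "coeff D s = coeff (monom (coeff D N) N) s"
      using low[of s] degD coeff_eq_0[of D s] by (cases s N rule: linorder_cases) auto
  qed
  then have "poly D \<alpha> = coeff D N * \<alpha> ^ N" by (metis poly_monom)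
  then have "poly D \<alpha> \<noteq> 0" using lead \<alpha> by simp
  moreover have "poly D \<alpha> = det (map_mat (\<lambda>f. poly f \<alpha>) M)"
    unfolding D_def by (rule comm_ring_hom.hom_det[OF ev, symmetric])
  moreover have "map_mat (\<lambda>f. poly f \<alpha>) M = mat (Suc p) (Suc p) (\<lambda>(l, j). poly (A l j) \<alpha>)"
    by (auto simp: M_def)
  ultimately show ?thesis by simp
qed

section \<open>Completing independent linear forms\<close>

definition independent_rows :: "nat \<Rightarrow> nat \<Rightarrow> (nat \<Rightarrow> nat \<Rightarrow> complex) \<Rightarrow> bool" where
  "independent_rows p k r \<longleftrightarrow>
    (\<forall>c. (\<forall>j\<le>p. (\<Sum>i<k. c i * r i j) = 0) \<longrightarrow> (\<forall>i<k. c i = 0))"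

lemma det_nonzero_if_independent_rows:
  assumes "independent_rows p (Suc p) r"
  shows "det (mat (Suc p) (Suc p) (\<lambda>(i, j). r i j)) \<noteq> 0"
proof
  define M where "M = mat (Suc p) (Suc p) (\<lambda>(i, j). r i j)"
  have M: "M \<in> carrier_mat (Suc p) (Suc p)" by (simp add: M_def)
  assume "det (mat (Suc p) (Suc p) (\<lambda>(i, j). r i j)) = 0"
  then have "det (transpose_mat M) = 0" using det_transpose[OF M] by (simp add: M_def)
  moreover have MT: "transpose_mat M \<in> carrier_mat (Suc p) (Suc p)" using M by simp
  ultimately obtain v where v: "v \<in> carrier_vec (Suc p)" "v \<noteq> 0\<^sub>v (Suc p)"
      "transpose_mat M *\<^sub>v v = 0\<^sub>v (Suc p)"
    using det_0_iff_vec_prod_zero[OF MT] by blast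
  have "(\<Sum>i<Suc p. vec_index v i * r i j) = 0" if "j \<le> p" for j
  proof -
    have "vec_index (transpose_mat M *\<^sub>v v) j = 0" using v(3) that by simp
    moreover have "vec_index (transpose_mat M *\<^sub>v v) j = (\<Sum>i<Suc p. vec_index v i * r i j)"
      using that v(1) by (simp add: M_def scalar_prod_def atLeast0LessThan mult.commute del: sum.lessThan_Suc)
    ultimately show ?thesis by simp
  qed
  then have "\<forall>i<Suc p. vec_index v i = 0"
    using assms unfolding independent_rows_def by blast
  then have "v = 0\<^sub>v (Suc p)" using v(1) by (intro eq_vecI) auto
  with v(2) show False by simp
qed

lemma det_zero_row:
  fixes M :: "'a::comm_ring_1 mat"
  assumes M: "M \<in> carrier_mat n n" and k: "k < n" "\<And>j. j < n \<Longrightarrow> M $$ (k, j) = 0"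
  shows "det M = 0"
  unfolding det_def'[OF M]
proof (rule sum.neutral, rule ballI)
  fix \<pi> assume "\<pi> \<in> {\<pi>. \<pi> permutes {0..<n}}"
  then have "\<pi> k < n" using permutes_in_image[of \<pi> "{0..<n}" k] k(1) by auto
  then have "(\<Prod>i = 0..<n. M $$ (i, \<pi> i)) = 0"
    using k by (intro prod_zero bexI[of _ k]) auto
  then show "signof \<pi> * (\<Prod>i = 0..<n. M $$ (i, \<pi> i)) = 0" by simp
qed

text \<open>If every row of \<open>E\<close> were a combination of the \<open>k \<le> p\<close> given rows, then \<open>E\<close> would factor through a
matrix with a zero row.\<close>

lemma independent_rows_extend:
  assumes r: "independent_rows p k r" and k: "k \<le> p"
    and E: "det (mat (Suc p) (Suc p) (\<lambda>(i, j). E i j)) \<noteq> 0"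
  shows "\<exists>l\<le>p. independent_rows p (Suc k) (r(k := E l))"
proof (rule ccontr)
  assume no: "\<not> ?thesis"
  have "\<exists>a. \<forall>j\<le>p. E l j = (\<Sum>i<k. a i * r i j)" if l: "l \<le> p" for l
  proof -
    have "\<not> independent_rows p (Suc k) (r(k := E l))" using no l by blast
    then obtain c where c: "\<forall>j\<le>p. (\<Sum>i<Suc k. c i * (r(k := E l)) i j) = 0" "\<exists>i<Suc k. c i \<noteq> 0"
      unfolding independent_rows_def by blast
    have rel: "(\<Sum>i<k. c i * r i j) + c k * E l j = 0" if "j \<le> p" for j
    proof -
      have "(\<Sum>i<k. c i * (r(k := E l)) i j) = (\<Sum>i<k. c i * r i j)" by (intro sum.cong) auto
      then show ?thesis using c(1) that by simp
    qed
    have "c k \<noteq> 0"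
    proof
      assume "c k = 0"
      then have "\<forall>j\<le>p. (\<Sum>i<k. c i * r i j) = 0" using rel by simp
      then have "\<forall>i<k. c i = 0" using r unfolding independent_rows_def by blast
      with c(2) \<open>c k = 0\<close> show False by (auto simp: less_Suc_eq)
    qed
    show ?thesis
    proof (intro exI[of _ "\<lambda>i. - c i / c k"] allI impI)
      fix j assume "j \<le> p"
      from rel[OF this] have "c k * E l j = - (\<Sum>i<k. c i * r i j)" by (simp add: eq_neg_iff_add_eq_0 add.commute)
      then have "E l j = - (\<Sum>i<k. c i * r i j) / c k"
        using \<open>c k \<noteq> 0\<close> by (metis nonzero_mult_div_cancel_left)
      then show "E l j = (\<Sum>i<k. - c i / c k * r i j)"
        by (simp add: sum_divide_distrib sum_negf)
    qed
  qed
  then have "\<forall>l. \<exists>a. l \<le> p \<longrightarrow> (\<forall>j\<le>p. E l j = (\<Sum>i<k. a i * r i j))" by blast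
  from choice[OF this] obtain a where a: "\<And>l j. l \<le> p \<Longrightarrow> j \<le> p \<Longrightarrow> E l j = (\<Sum>i<k. a l i * r i j)" by blast
  define C R where "C = mat (Suc p) (Suc p) (\<lambda>(l, i). if i < k then a l i else 0)"
    and "R = mat (Suc p) (Suc p) (\<lambda>(i, j). if i < k then r i j else 0)"
  have carr: "C \<in> carrier_mat (Suc p) (Suc p)" "R \<in> carrier_mat (Suc p) (Suc p)"
    by (auto simp: C_def R_def)
  have "mat (Suc p) (Suc p) (\<lambda>(i, j). E i j) = C * R"
  proof (rule eq_matI)
    fix l j assume "l < dim_row (C * R)" "j < dim_col (C * R)"
    then have lj: "l < Suc p" "j < Suc p" by (auto simp: C_def R_def)
    have "(C * R) $$ (l, j) = (\<Sum>i<Suc p. (if i < k then a l i else 0) * (if i < k then r i j else 0))"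
      using lj by (simp add: C_def R_def scalar_prod_def atLeast0LessThan del: sum.lessThan_Suc)
    also have "\<dots> = (\<Sum>i<k. a l i * r i j)"
      by (rule sum.mono_neutral_cong_right) (use k in auto)
    finally show "mat (Suc p) (Suc p) (\<lambda>(i, j). E i j) $$ (l, j) = (C * R) $$ (l, j)"
      using a lj by simp
  qed (auto simp: C_def R_def)
  moreover have "det R = 0"
    by (rule det_zero_row[OF carr(2), of k]) (use k in \<open>auto simp: R_def\<close>)
  ultimately show False using E det_mult[OF carr] by simp
qed

lemma independent_rows_complete:
  assumes r: "independent_rows p k r" and k: "k \<le> Suc p"
    and E: "det (mat (Suc p) (Suc p) (\<lambda>(i, j). E i j)) \<noteq> 0"
  shows "\<exists>s. (\<forall>i. s i \<le> p) \<and>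
    det (mat (Suc p) (Suc p) (\<lambda>(i, j). if i < k then r i j else E (s i) j)) \<noteq> 0"
proof -
  have "\<exists>s. (\<forall>i. s i \<le> p) \<and> independent_rows p k' (\<lambda>i. if i < k then r i else E (s i))"
    if "k \<le> k'" "k' \<le> Suc p" for k'
    using that
  proof (induction k' rule: dec_induct)
    case base
    have "independent_rows p k (\<lambda>i. if i < k then r i else E (0::nat)) = independent_rows p k r"
      unfolding independent_rows_def by (intro iff_allI arg_cong2[of _ _ _ _ "(\<longrightarrow>)"] all_cong sum.cong
          arg_cong2[of _ _ _ _ "(=)"]) auto
    then show ?case using r by (intro exI[of _ "\<lambda>_. 0"]) simp
  next
    case (step k')
    then obtain s where s: "\<forall>i. s i \<le> p" "independent_rows p k' (\<lambda>i. if i < k then r i else E (s i))"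
      by auto
    obtain l where l: "l \<le> p" "independent_rows p (Suc k') ((\<lambda>i. if i < k then r i else E (s i))(k' := E l))"
      using independent_rows_extend[OF s(2) _ E] step.prems by auto
    have "(\<lambda>i. if i < k then r i else E (s i))(k' := E l) = (\<lambda>i. if i < k then r i else E ((s(k' := l)) i))"
      using step.hyps by (auto simp: fun_eq_iff)
    then show ?case using s(1) l by (intro exI[of _ "s(k' := l)"]) auto
  qed
  from this[OF k order_refl] obtain s where s: "\<forall>i. s i \<le> p"
    "independent_rows p (Suc p) (\<lambda>i. if i < k then r i else E (s i))" by blast
  have "det (mat (Suc p) (Suc p) (\<lambda>(i, j). (if i < k then r i else E (s i)) j)) \<noteq> 0"
    by (rule det_nonzero_if_independent_rows[OF s(2)])
  moreover have "(\<lambda>(i, j). (if i < k then r i else E (s i)) j) = (\<lambda>(i, j). if i < k then r i j else E (s i) j)"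
    by (auto simp: fun_eq_iff)
  ultimately show ?thesis using s(1) by auto
qed

text \<open>A linear relation between the polynomials \<open>X\<^sup>i P\<close> is a polynomial \<open>Q\<close> with \<open>Q P = 0\<close>. The restriction on the degree ensures that
the columns \<open>0, \<dots>, p\<close> contain all coefficients of \<open>Q P\<close>.\<close>

lemma shifted_coeffs_independent:
  assumes P: "P \<noteq> 0" "degree P + k \<le> Suc p"
  shows "independent_rows p k (\<lambda>i j. coeff (monom 1 i * P) j)"
  unfolding independent_rows_def
proof (intro allI impI)
  fix c i assume c: "\<forall>j\<le>p. (\<Sum>i<k. c i * coeff (monom 1 i * P) j) = 0" and i: "i < k"
  define Q where "Q = (\<Sum>i<k. monom (c i) i)"
  have QP: "Q * P = (\<Sum>i<k. Polynomial.smult (c i) (monom 1 i * P))"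
    by (simp add: Q_def sum_distrib_right smult_monom flip: mult_smult_left)
  have "coeff (Q * P) j = 0" for j
  proof (cases "j \<le> p")
    case True
    then show ?thesis unfolding QP coeff_sum coeff_smult using c by blast
  next
    case False
    have "degree Q \<le> k - 1" unfolding Q_def
      by (intro degree_sum_le) (auto intro: order.trans[OF degree_monom_le])
    then have "degree (Q * P) \<le> p"
      using degree_mult_le[of Q P] P(2) i by linarith
    then show ?thesis using False by (intro coeff_eq_0) auto
  qed
  then have "Q * P = 0" by (intro poly_eqI) simp
  then have "Q = 0" using P(1) by simp
  moreover have "coeff Q i = c i" using i by (simp add: Q_def coeff_sum)
  ultimately show "c i = 0" by simp
qed

lemma det_norm_bound:
  fixes f :: "nat \<Rightarrow> nat \<Rightarrow> complex"
  assumes "\<And>\<pi>. \<pi> permutes {0..<n} \<Longrightarrow> (\<Prod>i = 0..<n. norm (f i (\<pi> i))) \<le> B"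
  shows "norm (det (mat n n (\<lambda>(i, j). f i j))) \<le> fact n * B"
proof -
  have "det (mat n n (\<lambda>(i, j). f i j)) = (\<Sum>\<pi> | \<pi> permutes {0..<n}. signof \<pi> * (\<Prod>i = 0..<n. f i (\<pi> i)))"
    unfolding det_def'[OF mat_carrier]
    by (intro sum.cong prod.cong refl arg_cong2[of _ _ _ _ "(*)"]) (auto dest: permutes_in_image)
  also have "norm \<dots> \<le> (\<Sum>\<pi> | \<pi> permutes {0..<n}. B)"
    by (rule sum_norm_le) (simp add: norm_mult sign_def assms flip: prod_norm)
  also have "\<dots> = fact n * B" by (simp add: card_permutations)
  finally show ?thesis .
qed

lemma prod_row_bounds:
  fixes x y :: real
  assumes "k \<le> Suc p"
  shows "(\<Prod>i = 0..<Suc p. if i < k then x else y) = x ^ k * y ^ (Suc p - k)"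
proof -
  have "(\<Prod>i = 0..<Suc p. if i < k then x else y) = x ^ card ({0..<Suc p} \<inter> {i. i < k}) * y ^ card ({0..<Suc p} \<inter> - {i. i < k})"
    by (subst prod.If_cases) auto
  also have "{0..<Suc p} \<inter> {i. i < k} = {0..<k}" using assms by auto
  also have "{0..<Suc p} \<inter> - {i. i < k} = {k..<Suc p}" by auto
  finally show ?thesis by simp
qed

section \<open>The scaled approximants and the determinant\<close>

lemma Lcm_pos: "0 < Lcm {1..p::nat}"
proof -
  have "Lcm {1..p} \<noteq> 0" by (subst Lcm_0_iff) auto
  then show ?thesis by (simp only: neq0_conv)
qed

lemma fact_eq_div_mult:
  assumes "k \<le> n"
  shows "(fact n :: 'a::field_char_0) = of_nat (fact n div fact k) * fact k"
proof -
  have "(fact n :: nat) = (fact n div fact k) * fact k"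
    using fact_dvd[OF assms, where 'a = nat] by simp
  then have "(of_nat (fact n) :: 'a) = of_nat ((fact n div fact k) * fact k)" by simp
  then show ?thesis by (simp only: of_nat_mult of_nat_fact)
qed

text \<open>Multiplied by \<open>n! \<alpha>\<^sup>-\<^sup>n\<close>, the monomial \<open>\<alpha>\<^sup>k / k!\<close> becomes \<open>n! / k! \<cdot> (1/\<alpha>)\<^sup>n\<^sup>-\<^sup>k\<close>, an integral multiple of a power of
\<open>1 / \<alpha>\<close>. The result is an integer polynomial in \<open>D0 / \<alpha>\<close>, to which embeddings can be applied. The sum in the second part
bounds the moduli of its conjugates when \<open>t\<close> bounds those of the conjugates of \<open>1 / \<alpha>\<close>.\<close>

lemma scaled_entry:
  fixes f :: "complex poly" and D0 n N :: nat
  assumes int: "\<And>k. of_nat \<Lambda> ^ N * (fact k * coeff f k) \<in> \<int>"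
    and deg: "\<And>k. n < k \<Longrightarrow> coeff f k = 0"
    and norm: "(\<Sum>k\<le>n. fact k * norm (coeff f k)) \<le> 2 ^ N"
    and \<alpha>: "\<alpha> \<noteq> 0" and D0: "1 \<le> D0"
  shows "\<exists>h :: nat \<Rightarrow> int.
    of_nat \<Lambda> ^ N * of_nat D0 ^ n * fact n * inverse \<alpha> ^ n * poly f \<alpha> =
      (\<Sum>k\<le>n. of_int (h k) * (of_nat D0 * inverse \<alpha>) ^ (n - k)) \<and>
    (\<forall>t\<ge>1. (\<Sum>k\<le>n. \<bar>real_of_int (h k)\<bar> * (real D0 * t) ^ (n - k)) \<le>
      fact n * (2 * real \<Lambda>) ^ N * (real D0 * t) ^ n)"
proof -
  have "\<forall>k. \<exists>i. of_nat \<Lambda> ^ N * (fact k * coeff f k) = of_int i"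
    using int by (auto simp: Ints_def)
  then obtain g where g: "\<And>k. of_nat \<Lambda> ^ N * (fact k * coeff f k) = of_int (g k)"
    by metis
  define h where "h k = g k * int (fact n div fact k) * int D0 ^ k" for k
  have "of_nat \<Lambda> ^ N * of_nat D0 ^ n * fact n * inverse \<alpha> ^ n * poly f \<alpha> =
      (\<Sum>k\<le>n. of_nat \<Lambda> ^ N * of_nat D0 ^ n * fact n * inverse \<alpha> ^ n * (coeff f k * \<alpha> ^ k))"
    using deg by (subst poly_eq_sum_atMost[of f n]) (auto intro: degree_le simp: sum_distrib_left)
  also have "\<dots> = (\<Sum>k\<le>n. of_int (h k) * (of_nat D0 * inverse \<alpha>) ^ (n - k))"
  proof (intro sum.cong refl)
    fix k assume "k \<in> {..n}"
    then have k: "k \<le> n" by simp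
    have ak: "inverse \<alpha> ^ n * \<alpha> ^ k = inverse \<alpha> ^ (n - k)"
    proof -
      have "inverse \<alpha> ^ n = inverse \<alpha> ^ (n - k) * inverse \<alpha> ^ k" using k by (simp flip: power_add)
      moreover have "inverse \<alpha> ^ k * \<alpha> ^ k = 1" using \<alpha> by (simp flip: power_mult_distrib)
      ultimately show ?thesis by (simp add: mult.assoc)
    qed
    have Dk: "(of_nat D0 :: complex) ^ n = of_nat D0 ^ k * of_nat D0 ^ (n - k)"
      using k by (simp flip: power_add)
    have "of_nat \<Lambda> ^ N * of_nat D0 ^ n * fact n * inverse \<alpha> ^ n * (coeff f k * \<alpha> ^ k) =
        (of_nat \<Lambda> ^ N * (fact k * coeff f k)) * of_nat (fact n div fact k) * of_nat D0 ^ k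
          * (of_nat D0 ^ (n - k) * (inverse \<alpha> ^ n * \<alpha> ^ k))"
      unfolding Dk fact_eq_div_mult[OF k, where 'a = complex] by (simp only: ac_simps)
    also have "\<dots> = of_int (h k) * (of_nat D0 * inverse \<alpha>) ^ (n - k)"
      unfolding g ak h_def by (simp add: power_mult_distrib)
    finally show "of_nat \<Lambda> ^ N * of_nat D0 ^ n * fact n * inverse \<alpha> ^ n * (coeff f k * \<alpha> ^ k) =
        of_int (h k) * (of_nat D0 * inverse \<alpha>) ^ (n - k)" .
  qed
  finally have eq: "of_nat \<Lambda> ^ N * of_nat D0 ^ n * fact n * inverse \<alpha> ^ n * poly f \<alpha> =
      (\<Sum>k\<le>n. of_int (h k) * (of_nat D0 * inverse \<alpha>) ^ (n - k))" .
  have "(\<Sum>k\<le>n. \<bar>real_of_int (h k)\<bar> * (real D0 * t) ^ (n - k)) \<le>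
      fact n * (2 * real \<Lambda>) ^ N * (real D0 * t) ^ n" if t: "1 \<le> t" for t
  proof -
    have le: "\<bar>real_of_int (h k)\<bar> * (real D0 * t) ^ (n - k) \<le>
        (real \<Lambda> ^ N * (fact k * norm (coeff f k))) * (fact n * (real D0 * t) ^ n)" if k: "k \<le> n" for k
    proof -
      have gk: "\<bar>real_of_int (g k)\<bar> = real \<Lambda> ^ N * (fact k * norm (coeff f k))"
      proof -
        have "\<bar>real_of_int (g k)\<bar> = norm (of_int (g k) :: complex)" by simp
        also have "\<dots> = real \<Lambda> ^ N * (fact k * norm (coeff f k))"
          unfolding g[symmetric] by (simp add: norm_mult norm_power)
        finally show ?thesis .
      qed
      have "real (fact n div fact k) \<le> real (fact n div fact k) * fact k"
        using mult_left_mono[of 1 "fact k" "real (fact n div fact k)"] by simp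
      then have 1: "real (fact n div fact k) \<le> fact n" using fact_eq_div_mult[OF k, where 'a = real] by simp
      have "real D0 ^ k \<le> (real D0 * t) ^ k"
        using mult_left_mono[OF t, of "real D0"] by (intro power_mono) auto
      then have "real D0 ^ k * (real D0 * t) ^ (n - k) \<le> (real D0 * t) ^ k * (real D0 * t) ^ (n - k)"
        using t by (intro mult_right_mono) auto
      then have 2: "real D0 ^ k * (real D0 * t) ^ (n - k) \<le> (real D0 * t) ^ n"
        using k by (simp flip: power_add)
      have "\<bar>real_of_int (h k)\<bar> * (real D0 * t) ^ (n - k) =
          \<bar>real_of_int (g k)\<bar> * (real (fact n div fact k) * (real D0 ^ k * (real D0 * t) ^ (n - k)))"
        by (simp add: h_def abs_mult)
      also have "\<dots> \<le> \<bar>real_of_int (g k)\<bar> * (fact n * (real D0 * t) ^ n)"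
        using 1 2 t by (intro mult_left_mono mult_mono) auto
      finally show ?thesis unfolding gk .
    qed
    have "(\<Sum>k\<le>n. \<bar>real_of_int (h k)\<bar> * (real D0 * t) ^ (n - k)) \<le>
        (\<Sum>k\<le>n. (real \<Lambda> ^ N * (fact k * norm (coeff f k))) * (fact n * (real D0 * t) ^ n))"
      by (intro sum_mono le) simp
    also have "\<dots> = real \<Lambda> ^ N * (\<Sum>k\<le>n. fact k * norm (coeff f k)) * (fact n * (real D0 * t) ^ n)"
      by (simp add: sum_distrib_left sum_distrib_right)
    also have "\<dots> \<le> real \<Lambda> ^ N * 2 ^ N * (fact n * (real D0 * t) ^ n)"
      using norm t by (intro mult_right_mono mult_left_mono) auto
    also have "\<dots> = fact n * (2 * real \<Lambda>) ^ N * (real D0 * t) ^ n"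
      by (simp add: power_mult_distrib mult_ac)
    finally show ?thesis .
  qed
  with eq show ?thesis by blast
qed

lemma det_expand:
  "det (mat n n (\<lambda>(i, j). f i j)) =
    (\<Sum>\<pi> | \<pi> permutes {0..<n}. signof \<pi> * (\<Prod>i = 0..<n. f i (\<pi> i)))"
  unfolding det_def'[OF mat_carrier]
  by (intro sum.cong prod.cong refl arg_cong2[of _ _ _ _ "(*)"]) (auto dest: permutes_in_image)

lemma det_algebraic_int:
  fixes f :: "nat \<Rightarrow> nat \<Rightarrow> complex"
  assumes "\<And>i j. i < n \<Longrightarrow> j < n \<Longrightarrow> algebraic_int (f i j)"
  shows "algebraic_int (det (mat n n (\<lambda>(i, j). f i j)))"
  unfolding det_expand
proof (intro algebraic_int_sum algebraic_int_plus_times(2) algebraic_int_prod)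
  fix \<pi> :: "nat \<Rightarrow> nat"
  have "signof \<pi> = (of_int (signof \<pi>) :: complex)" by (simp add: sign_def)
  then show "algebraic_int (signof \<pi> :: complex)" by (metis algebraic_int_of_int)
  fix i assume "\<pi> \<in> {\<pi>. \<pi> permutes {0..<n}}" "i \<in> {0..<n}"
  then show "algebraic_int (f i (\<pi> i))"
    using permutes_in_image[of \<pi> "{0..<n}" i] by (intro assms) auto
qed

lemma det_in_subfield:
  assumes F: "complex_subfield F" and f: "\<And>i j. i < n \<Longrightarrow> j < n \<Longrightarrow> f i j \<in> F"
  shows "det (mat n n (\<lambda>(i, j). f i j)) \<in> F"
    and "field_embedding F \<sigma> \<Longrightarrow>
      \<sigma> (det (mat n n (\<lambda>(i, j). f i j))) = det (mat n n (\<lambda>(i, j). \<sigma> (f i j)))"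
proof -
  have sgn: "signof \<pi> = (of_int (signof \<pi>) :: complex)" for \<pi> :: "nat \<Rightarrow> nat" by (simp add: sign_def)
  have sF: "signof \<pi> \<in> F" for \<pi> :: "nat \<Rightarrow> nat"
    by (subst sgn) (rule complex_subfield_of_int[OF F])
  have fF: "f i (\<pi> i) \<in> F" if "\<pi> permutes {0..<n}" "i \<in> {0..<n}" for \<pi> i
    using permutes_in_image[OF that(1), of i] that(2) by (intro f) auto
  have PF: "(\<Prod>i = 0..<n. f i (\<pi> i)) \<in> F" if "\<pi> permutes {0..<n}" for \<pi>
    by (intro complex_subfield_prod[OF F] fF that)
  show "det (mat n n (\<lambda>(i, j). f i j)) \<in> F"
    unfolding det_expand by (intro complex_subfield_sum[OF F] complex_subfieldD(4)[OF F] sF PF) auto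
  assume \<sigma>: "field_embedding F \<sigma>"
  have \<sigma>s: "\<sigma> (signof \<pi>) = signof \<pi>" for \<pi> :: "nat \<Rightarrow> nat"
    by (subst (1 2) sgn) (rule embedding_of_int[OF F \<sigma>])
  show "\<sigma> (det (mat n n (\<lambda>(i, j). f i j))) = det (mat n n (\<lambda>(i, j). \<sigma> (f i j)))"
    unfolding det_expand
  proof (subst embedding_sum[OF F \<sigma>])
    fix \<pi> assume "\<pi> \<in> {\<pi>. \<pi> permutes {0..<n}}"
    then show "signof \<pi> * (\<Prod>i = 0..<n. f i (\<pi> i)) \<in> F"
      by (intro complex_subfieldD(4)[OF F] sF PF) simp
  next
    show "(\<Sum>\<pi> | \<pi> permutes {0..<n}. \<sigma> (signof \<pi> * (\<Prod>i = 0..<n. f i (\<pi> i)))) =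
        (\<Sum>\<pi> | \<pi> permutes {0..<n}. signof \<pi> * (\<Prod>i = 0..<n. \<sigma> (f i (\<pi> i))))"
    proof (rule sum.cong[OF refl])
      fix \<pi> assume "\<pi> \<in> {\<pi>. \<pi> permutes {0..<n}}"
      then have \<pi>: "\<pi> permutes {0..<n}" by simp
      show "\<sigma> (signof \<pi> * (\<Prod>i = 0..<n. f i (\<pi> i))) = signof \<pi> * (\<Prod>i = 0..<n. \<sigma> (f i (\<pi> i)))"
        using embedding_mult[OF F \<sigma> sF PF[OF \<pi>], of \<pi>]
          embedding_prod[OF F \<sigma>, of "{0..<n}" "\<lambda>i. f i (\<pi> i)"] fF[OF \<pi>] \<sigma>s[of \<pi>]
        by (simp del: prod.op_ivl_Suc)
    qed
  qed
qed

lemma scaled_approximants: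
  fixes p n :: nat
  assumes L: "number_field L" "\<alpha> \<in> L" "\<alpha> \<noteq> 0"
  defines "D0 \<equiv> alg_denominator (1 / \<alpha>)" and "\<Lambda> \<equiv> Lcm {1..p}" and "N \<equiv> Suc p * n"
    and "t \<equiv> max 1 (house (1 / \<alpha>))"
  obtains E where
    "\<forall>l\<le>p. \<forall>j\<le>p. E l j \<in> L \<and> algebraic_int (E l j)"
    "\<forall>l\<le>p. \<forall>j\<le>p. \<forall>\<sigma>. field_embedding L \<sigma> \<longrightarrow>
      cmod (\<sigma> (E l j)) \<le> fact n * (2 * real \<Lambda>) ^ N * (real D0 * t) ^ n"
    "\<forall>l\<le>p. cmod (\<Sum>j\<le>p. E l j * exp \<alpha> ^ j) \<le>
      real \<Lambda> ^ N * real D0 ^ n * fact n * inverse (cmod \<alpha>) ^ n * (cmod \<alpha> ^ N / fact N * exp (real p * cmod \<alpha>))"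
    "det (mat (Suc p) (Suc p) (\<lambda>(l, j). E l j)) \<noteq> 0"
proof -
  note Ls = number_field_subfield[OF L(1)]
  have z: "1 / \<alpha> \<in> L" using complex_subfieldD(6)[OF Ls L(2)] by (simp add: inverse_eq_divide)
  have alg: "algebraic (1 / \<alpha>)" by (rule number_field_algebraic[OF L(1) z])
  have D0: "1 \<le> D0" "algebraic_int (of_nat D0 * (1 / \<alpha>))"
    unfolding D0_def by (rule alg_denominator[OF alg])+
  define y where "y = of_nat D0 * inverse \<alpha>"
  have y: "y \<in> L" "algebraic_int y"
    using D0(2) z complex_subfieldD(4)[OF Ls _ z, of "of_nat D0"] complex_subfield_of_int[OF Ls, of "int D0"]
    by (simp_all add: y_def inverse_eq_divide)
  have \<sigma>y: "cmod (\<sigma> y) \<le> real D0 * t" if \<sigma>: "field_embedding L \<sigma>" for \<sigma>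
  proof -
    have "cmod (\<sigma> (1 / \<alpha>)) \<le> house (1 / \<alpha>)"
      by (rule cmod_le_house[OF alg embedding_in_galois_conjugates[OF Ls \<sigma> z alg]])
    then have "cmod (\<sigma> (1 / \<alpha>)) \<le> t" by (simp add: t_def)
    moreover have "\<sigma> y = of_nat D0 * \<sigma> (1 / \<alpha>)"
      using embedding_mult[OF Ls \<sigma> _ z, of "of_nat D0"] embedding_of_int[OF Ls \<sigma>, of "int D0"]
        complex_subfield_of_int[OF Ls, of "int D0"]
      by (simp add: y_def inverse_eq_divide)
    ultimately show ?thesis by (simp add: norm_mult mult_left_mono)
  qed
  have "\<forall>l. \<exists>A. approximants p (node_mset p n l) A \<or> p < l"
  proof
    fix l
    show "\<exists>A. approximants p (node_mset p n l) A \<or> p < l"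
    proof (cases "l \<le> p")
      case True
      then have "node_mset p n l \<noteq> {#}" using size_node_mset[OF True, of n] by auto
      then show ?thesis using approximants_exist[OF _ node_mset_le] by blast
    qed auto
  qed
  from choice[OF this] obtain A where A: "\<And>l. l \<le> p \<Longrightarrow> approximants p (node_mset p n l) (A l)"
    by (auto simp: not_less[symmetric])
  define c where "c = (of_nat \<Lambda> ^ N * of_nat D0 ^ n * fact n * inverse \<alpha> ^ n :: complex)"
  define E where "E l j = c * poly (A l j) \<alpha>" for l j
  have \<Lambda>: "0 < \<Lambda>" unfolding \<Lambda>_def by (rule Lcm_pos)
  have c0: "c \<noteq> 0" using \<Lambda> D0(1) L(3) by (simp add: c_def)
  have Eh: "\<exists>h :: nat \<Rightarrow> int. E l j = (\<Sum>k\<le>n. of_int (h k) * y ^ (n - k)) \<and>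
      (\<forall>t\<ge>1. (\<Sum>k\<le>n. \<bar>real_of_int (h k)\<bar> * (real D0 * t) ^ (n - k)) \<le>
        fact n * (2 * real \<Lambda>) ^ N * (real D0 * t) ^ n)" if lj: "l \<le> p" "j \<le> p" for l j
    unfolding E_def c_def y_def
  proof (rule scaled_entry[OF _ _ _ L(3) D0(1)])
    note a = approximantsD[OF A[OF lj(1)]]
    note sz = size_node_mset[OF lj(1), of n]
    show "of_nat \<Lambda> ^ N * (fact k * coeff (A l j) k) \<in> \<int>" for k
      using a(3)[where j = j and k = k] by (simp add: sz \<Lambda>_def N_def)
    show "coeff (A l j) k = 0" if "n < k" for k
      by (rule a(1)) (use that lj in \<open>simp add: count_node_mset\<close>)
    have "(\<Sum>k\<le>n. fact k * norm (coeff (A l j) k)) = (\<Sum>(i, k)\<in>{j} \<times> {..n}. fact k * norm (coeff (A l i) k))"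
      by (simp add: sum.cartesian_product[symmetric])
    also have "\<dots> \<le> (\<Sum>(i, k)\<in>{..p} \<times> {..<size (node_mset p n l)}. fact k * norm (coeff (A l i) k))"
      using lj by (intro sum_mono2) (auto simp: sz)
    also have "\<dots> \<le> 2 ^ N" using a(4) by (simp add: sz N_def)
    finally show "(\<Sum>k\<le>n. fact k * norm (coeff (A l j) k)) \<le> 2 ^ N" .
  qed
  show ?thesis
  proof (rule that[of E]; (intro allI impI)?)
    fix l j assume lj: "l \<le> p" "j \<le> p"
    obtain h where h: "E l j = (\<Sum>k\<le>n. of_int (h k) * y ^ (n - k))"
      "\<forall>t\<ge>1. (\<Sum>k\<le>n. \<bar>real_of_int (h k)\<bar> * (real D0 * t) ^ (n - k)) \<le>
        fact n * (2 * real \<Lambda>) ^ N * (real D0 * t) ^ n"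
      using Eh[OF lj] by blast
    show "E l j \<in> L \<and> algebraic_int (E l j)"
    proof
      show "E l j \<in> L"
        unfolding h(1) by (intro complex_subfield_sum[OF Ls] complex_subfieldD(4)[OF Ls]
            complex_subfield_of_int[OF Ls] complex_subfield_power[OF Ls] y)
      show "algebraic_int (E l j)"
        unfolding h(1) by (intro algebraic_int_sum algebraic_int_plus_times(2) algebraic_int_power
            algebraic_int_of_int y)
    qed
  next
    fix l j \<sigma> assume lj: "l \<le> p" "j \<le> p"
    obtain h where h: "E l j = (\<Sum>k\<le>n. of_int (h k) * y ^ (n - k))"
      "\<forall>t\<ge>1. (\<Sum>k\<le>n. \<bar>real_of_int (h k)\<bar> * (real D0 * t) ^ (n - k)) \<le>
        fact n * (2 * real \<Lambda>) ^ N * (real D0 * t) ^ n"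
      using Eh[OF lj] by blast
    assume \<sigma>: "field_embedding L \<sigma>"
    have "\<sigma> (E l j) = (\<Sum>k\<le>n. \<sigma> (of_int (h k) * y ^ (n - k)))"
      unfolding h(1) by (intro embedding_sum[OF Ls \<sigma>] complex_subfieldD(4)[OF Ls]
          complex_subfield_of_int[OF Ls] complex_subfield_power[OF Ls] y)
    also have "\<dots> = (\<Sum>k\<le>n. of_int (h k) * \<sigma> y ^ (n - k))"
      by (intro sum.cong refl) (simp add: embedding_mult[OF Ls \<sigma>] embedding_of_int[OF Ls \<sigma>]
          embedding_power[OF Ls \<sigma>] complex_subfield_of_int[OF Ls] complex_subfield_power[OF Ls] y)
    also have "cmod \<dots> \<le> (\<Sum>k\<le>n. \<bar>real_of_int (h k)\<bar> * (real D0 * t) ^ (n - k))"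
      using \<sigma>y[OF \<sigma>] by (intro sum_norm_le) (auto simp: norm_mult norm_power intro!: mult_left_mono power_mono)
    also have "\<dots> \<le> fact n * (2 * real \<Lambda>) ^ N * (real D0 * t) ^ n"
      using h(2) by (simp add: t_def)
    finally show "cmod (\<sigma> (E l j)) \<le> fact n * (2 * real \<Lambda>) ^ N * (real D0 * t) ^ n" .
  next
    fix l assume l: "l \<le> p"
    have "(\<Sum>j\<le>p. E l j * exp \<alpha> ^ j) = c * (\<Sum>j\<le>p. poly (A l j) \<alpha> * exp (of_nat j * \<alpha>))"
      by (simp add: E_def sum_distrib_left mult.assoc exp_of_nat_mult)
    then have "cmod (\<Sum>j\<le>p. E l j * exp \<alpha> ^ j) =
        cmod c * cmod (\<Sum>j\<le>p. poly (A l j) \<alpha> * exp (of_nat j * \<alpha>))" by (simp only: norm_mult)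
    also have "\<dots> \<le> cmod c * (cmod \<alpha> ^ N / fact N * exp (real p * cmod \<alpha>))"
      using approximants_value_bound[OF A[OF l] node_mset_le, of N \<alpha>] size_node_mset[OF l, of n]
      by (intro mult_left_mono) (simp_all add: N_def)
    also have "cmod c = real \<Lambda> ^ N * real D0 ^ n * fact n * inverse (cmod \<alpha>) ^ n"
      by (simp add: c_def norm_mult norm_power norm_inverse)
    finally show "cmod (\<Sum>j\<le>p. E l j * exp \<alpha> ^ j) \<le>
      real \<Lambda> ^ N * real D0 ^ n * fact n * inverse (cmod \<alpha>) ^ n * (cmod \<alpha> ^ N / fact N * exp (real p * cmod \<alpha>))" .
  next
    have "mat (Suc p) (Suc p) (\<lambda>(l, j). E l j) = c \<cdot>\<^sub>m mat (Suc p) (Suc p) (\<lambda>(l, j). poly (A l j) \<alpha>)"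
      by (auto simp: E_def)
    then show "det (mat (Suc p) (Suc p) (\<lambda>(l, j). E l j)) \<noteq> 0"
      using approximants_det_nonzero[OF A L(3)] c0 by simp
  qed
qed

text \<open>The matrix consists of \<open>k = p + 1 - \<delta>\<close> rows of shifted coefficients of \<open>P\<close>, bounded by \<open>H\<close> in every
embedding, and of \<open>\<delta>\<close> rows of scaled approximants, bounded by \<open>C\<close>. After the first column
is replaced by the values at \<open>e\<^sup>\<alpha>\<close>, each term of the determinant contains one entry of this column, which is
at most the bound of its row times \<open>X0 / H\<close> or \<open>S / C\<close>.\<close>

lemma determinant_inequality:
  fixes K :: "complex set" and p n d \<delta> :: nat
  assumes K: "number_field K" and \<alpha>: "algebraic \<alpha>" "\<alpha> \<noteq> 0"
    and d: "d = rat_complex.dim (field_adjoin K \<alpha>)"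
    and H: "1 \<le> H" and \<delta>: "1 \<le> \<delta>" "\<delta> \<le> p"
    and P: "\<And>j. coeff P j \<in> ring_of_integers K" "P \<noteq> 0" "degree P \<le> \<delta>" "poly_height P \<le> H"
  defines "D0 \<equiv> alg_denominator (1 / \<alpha>)" and "\<Lambda> \<equiv> Lcm {1..p}" and "N \<equiv> Suc p * n"
    and "t \<equiv> max 1 (house (1 / \<alpha>))"
  defines "C \<equiv> fact n * (2 * real \<Lambda>) ^ N * (real D0 * t) ^ n"
    and "S \<equiv> real \<Lambda> ^ N * real D0 ^ n * fact n * inverse (cmod \<alpha>) ^ n *
        (cmod \<alpha> ^ N / fact N * exp (real p * cmod \<alpha>))"
    and "X0 \<equiv> exp (real p * cmod \<alpha>) * cmod (poly P (exp \<alpha>))"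
  shows "1 \<le> (fact (Suc p) * (H ^ (Suc p - \<delta>) * C ^ \<delta>)) ^ d * (X0 / H + S / C)"
proof -
  define L where "L = field_adjoin K \<alpha>"
  have L: "number_field L" and KL: "K \<subseteq> L" and \<alpha>L: "\<alpha> \<in> L"
    unfolding L_def by (rule number_field_adjoin[OF K \<alpha>(1)])+
  note Ls = number_field_subfield[OF L]
  define k where "k = Suc p - \<delta>"
  have k: "k \<le> Suc p" "k \<le> p" "0 < k" "Suc p - k = \<delta>" using \<delta> by (auto simp: k_def)
  obtain E where E': "\<forall>l\<le>p. \<forall>j\<le>p. E l j \<in> L \<and> algebraic_int (E l j)"
    "\<forall>l\<le>p. \<forall>j\<le>p. \<forall>\<sigma>. field_embedding L \<sigma> \<longrightarrow> cmod (\<sigma> (E l j)) \<le> C"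
    "\<forall>l\<le>p. cmod (\<Sum>j\<le>p. E l j * exp \<alpha> ^ j) \<le> S"
    "det (mat (Suc p) (Suc p) (\<lambda>(l, j). E l j)) \<noteq> 0"
    unfolding C_def S_def D0_def \<Lambda>_def N_def t_def
    by (rule scaled_approximants[OF L \<alpha>L \<alpha>(2)])
  have E: "E l j \<in> L \<and> algebraic_int (E l j)" "field_embedding L \<sigma> \<Longrightarrow> cmod (\<sigma> (E l j)) \<le> C"
    if "l \<le> p" "j \<le> p" for l j \<sigma>
    using E'(1,2) that by auto
  have E_small: "cmod (\<Sum>j\<le>p. E l j * exp \<alpha> ^ j) \<le> S" if "l \<le> p" for l
    using E'(3) that by auto
  have D0: "1 \<le> D0"
    unfolding D0_def by (rule alg_denominator(1)) (use number_field_algebraic[OF L] \<alpha>L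
      complex_subfieldD(6)[OF Ls \<alpha>L] in \<open>simp add: inverse_eq_divide\<close>)
  have \<Lambda>: "1 \<le> \<Lambda>" using Lcm_pos[of p] by (simp add: \<Lambda>_def)
  have t: "1 \<le> t" by (simp add: t_def)
  have C: "1 \<le> C"
  proof -
    have "1 * 1 \<le> real D0 * t" using D0 t by (intro mult_mono) auto
    then have "1 \<le> (real D0 * t) ^ n" by (intro one_le_power) simp
    moreover have "1 \<le> (2 * real \<Lambda>) ^ N" using \<Lambda> by (intro one_le_power) simp
    moreover have "(1::real) \<le> fact n" by simp
    ultimately have "1 * 1 * 1 \<le> fact n * (2 * real \<Lambda>) ^ N * (real D0 * t) ^ n"
      by (intro mult_mono) auto
    then show ?thesis by (simp add: C_def)
  qed
  have S: "0 \<le> S" by (simp add: S_def)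
  have coeffL: "coeff P j \<in> L" "algebraic_int (coeff P j)" for j
    using P(1)[of j] KL by (auto simp: ring_of_integers_def)
  have coeffH: "cmod (\<sigma> (coeff P j)) \<le> H" if \<sigma>: "field_embedding L \<sigma>" for \<sigma> j
  proof (cases "j \<le> degree P")
    case True
    have alg: "algebraic (coeff P j)" by (rule algebraic_int_imp_algebraic[OF coeffL(2)])
    have "cmod (\<sigma> (coeff P j)) \<le> house (coeff P j)"
      by (rule cmod_le_house[OF alg embedding_in_galois_conjugates[OF Ls \<sigma> coeffL(1) alg]])
    also have "\<dots> \<le> poly_height P"
      unfolding poly_height_def using True by (intro Max_ge) auto
    finally show ?thesis using P(4) by simp
  next
    case False
    then show ?thesis using embedding_0[OF Ls \<sigma>] H by (simp add: coeff_eq_0)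
  qed
  \<comment> \<open>The first k rows come from P, the others are chosen among the approximants.\<close>
  have "independent_rows p k (\<lambda>i j. coeff (monom 1 i * P) j)"
    by (rule shifted_coeffs_independent[OF P(2)]) (use P(3) \<delta> in \<open>simp add: k_def\<close>)
  from independent_rows_complete[OF this k(1) E'(4)] obtain s where s: "\<And>i. s i \<le> p"
    "det (mat (Suc p) (Suc p) (\<lambda>(i, j). if i < k then coeff (monom 1 i * P) j else E (s i) j)) \<noteq> 0"
    by blast
  define M where "M i j = (if i < k then coeff (monom 1 i * P) j else E (s i) j)" for i j
  define \<Delta> where "\<Delta> = det (mat (Suc p) (Suc p) (\<lambda>(i, j). M i j))"
  have \<Delta>0: "\<Delta> \<noteq> 0" using s(2) by (simp add: \<Delta>_def M_def)
  define r where "r i = (if i < k then H else C)" for i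
  have r1: "1 \<le> r i" for i using H C by (simp add: r_def)
  have prod_r: "(\<Prod>i = 0..<Suc p. r i) = H ^ k * C ^ \<delta>"
    unfolding r_def using prod_row_bounds[OF k(1)] k(4) by simp
  have shift: "coeff (monom 1 i * P) j = (if j < i then 0 else coeff P (j - i))" for i j
    by (simp add: coeff_monom_mult)
  have M_in: "M i j \<in> L \<and> algebraic_int (M i j)" if "j \<le> p" for i j
    using E(1)[OF s(1) that] coeffL complex_subfieldD(1)[OF Ls] by (auto simp: M_def shift)
  have M\<sigma>: "cmod (\<sigma> (M i j)) \<le> r i" if "field_embedding L \<sigma>" "j \<le> p" for \<sigma> i j
    using E(2)[OF s(1) that(2,1)] coeffH[OF that(1)] embedding_0[OF Ls that(1)] H
    by (auto simp: M_def r_def shift)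
  define B where "B = fact (Suc p) * (H ^ k * C ^ \<delta>)"
  have HC: "1 \<le> H ^ k * C ^ \<delta>"
    using mult_mono[OF one_le_power[OF H] one_le_power[OF C], of k \<delta>] H by simp
  have B: "1 \<le> B"
  proof -
    have "1 * 1 \<le> fact (Suc p) * (H ^ k * C ^ \<delta>)"
      using HC by (intro mult_mono) (auto simp del: fact_Suc)
    then show ?thesis by (simp add: B_def)
  qed
  have \<Delta>L: "\<Delta> \<in> L"
    unfolding \<Delta>_def by (rule det_in_subfield(1)[OF Ls]) (use M_in in auto)
  have \<Delta>int: "algebraic_int \<Delta>"
    unfolding \<Delta>_def by (rule det_algebraic_int) (use M_in in auto)
  have \<Delta>\<sigma>: "cmod (\<sigma> \<Delta>) \<le> B" if \<sigma>: "field_embedding L \<sigma>" for \<sigma>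
  proof -
    have "\<sigma> \<Delta> = det (mat (Suc p) (Suc p) (\<lambda>(i, j). \<sigma> (M i j)))"
      unfolding \<Delta>_def by (rule det_in_subfield(2)[OF Ls _ \<sigma>]) (use M_in in auto)
    also have "cmod \<dots> \<le> fact (Suc p) * (H ^ k * C ^ \<delta>)"
    proof (rule det_norm_bound)
      fix \<pi> assume \<pi>: "\<pi> permutes {0..<Suc p}"
      have "(\<Prod>i = 0..<Suc p. cmod (\<sigma> (M i (\<pi> i)))) \<le> (\<Prod>i = 0..<Suc p. r i)"
      proof (rule prod_mono)
        fix i assume "i \<in> {0..<Suc p}"
        then have "\<pi> i \<le> p" using permutes_in_image[OF \<pi>, of i] by auto
        then show "0 \<le> cmod (\<sigma> (M i (\<pi> i))) \<and> cmod (\<sigma> (M i (\<pi> i))) \<le> r i"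
          using M\<sigma>[OF \<sigma>] by auto
      qed
      then show "(\<Prod>i = 0..<Suc p. cmod (\<sigma> (M i (\<pi> i)))) \<le> H ^ k * C ^ \<delta>"
        using prod_r by simp
    qed
    finally show ?thesis by (simp only: B_def)
  qed
  have norm_ge: "1 \<le> cmod \<Delta> * B ^ (d - 1)"
    unfolding d L_def[symmetric]
    by (rule product_of_conjugates_ge_1[OF L \<Delta>L \<Delta>0 \<Delta>int B]) (rule \<Delta>\<sigma>)
  have id: "field_embedding L (\<lambda>x. x)" by (simp add: field_embedding_def)
  define V where "V i = (\<Sum>j\<le>p. M i j * exp \<alpha> ^ j)" for i
  define q where "q = X0 / H + S / C"
  have X0: "0 \<le> X0" by (simp add: X0_def)
  have q: "0 \<le> q" using X0 S H C by (simp add: q_def)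
  have V: "cmod (V i) \<le> q * r i" if "i \<le> p" for i
  proof (cases "i < k")
    case True
    have "degree (monom 1 i * P) \<le> p"
      using degree_mult_le[of "monom 1 i" P] degree_monom_le[of "1::complex" i] P(3) True \<delta>
      by (simp add: k_def)
    then have "V i = poly (monom 1 i * P) (exp \<alpha>)"
      using True poly_eq_sum_atMost[of "monom 1 i * P" p "exp \<alpha>"]
      unfolding V_def M_def by (simp only: if_True)
    then have "cmod (V i) = cmod (exp \<alpha>) ^ i * cmod (poly P (exp \<alpha>))"
      by (simp add: poly_monom norm_mult norm_power)
    also have "cmod (exp \<alpha>) ^ i = exp (real i * Re \<alpha>)"
      by (simp add: exp_of_nat_mult)
    also have "\<dots> \<le> exp (real p * cmod \<alpha>)"
    proof -
      have "real i * Re \<alpha> \<le> real i * cmod \<alpha>" by (intro mult_left_mono complex_Re_le_cmod) auto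
      also have "\<dots> \<le> real p * cmod \<alpha>" using that by (intro mult_right_mono) auto
      finally show ?thesis by simp
    qed
    finally have "cmod (V i) \<le> X0" by (simp add: X0_def mult_right_mono)
    also have "X0 = X0 / H * H" using H by simp
    also have "\<dots> \<le> q * H" using S C H by (intro mult_right_mono) (auto simp: q_def)
    finally show ?thesis using True by (simp add: r_def)
  next
    case False
    then have "cmod (V i) \<le> S" using E_small[OF s(1), of i] by (simp add: V_def M_def)
    also have "S = S / C * C" using C by simp
    also have "\<dots> \<le> q * C" using X0 C H by (intro mult_right_mono) (auto simp: q_def)
    finally show ?thesis using False by (simp add: r_def)
  qed
  have "\<Delta> = det (mat (Suc p) (Suc p) (\<lambda>(i, j). if j = 0 then V i else M i j))"
    unfolding \<Delta>_def V_def by (rule det_replace_col_0) simp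
  also have "cmod \<dots> \<le> fact (Suc p) * (q * (H ^ k * C ^ \<delta>))"
  proof (rule det_norm_bound)
    fix \<pi> assume \<pi>: "\<pi> permutes {0..<Suc p}"
    obtain i0 where "\<pi> i0 = 0" using permutes_surj[OF \<pi>] by (metis surjD)
    then have i0: "\<pi> i = 0 \<longleftrightarrow> i = i0" for i
      using permutes_inj[OF \<pi>] by (metis injD)
    have i0p: "i0 \<in> {0..<Suc p}" using i0[of i0] permutes_in_image[OF \<pi>, of i0] by simp
    have "(\<Prod>i = 0..<Suc p. cmod (if \<pi> i = 0 then V i else M i (\<pi> i)))
        \<le> (\<Prod>i = 0..<Suc p. (if i = i0 then q else 1) * r i)"
    proof (rule prod_mono)
      fix i assume i: "i \<in> {0..<Suc p}"
      then have "\<pi> i \<le> p" using permutes_in_image[OF \<pi>, of i] by auto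
      then show "0 \<le> cmod (if \<pi> i = 0 then V i else M i (\<pi> i)) \<and>
          cmod (if \<pi> i = 0 then V i else M i (\<pi> i)) \<le> (if i = i0 then q else 1) * r i"
        using V[of i] M\<sigma>[OF id] i i0[of i] by auto
    qed
    also have "\<dots> = q * (H ^ k * C ^ \<delta>)"
      unfolding prod.distrib prod_r using i0p by (subst prod.delta) auto
    finally show "(\<Prod>i = 0..<Suc p. cmod (if \<pi> i = 0 then V i else M i (\<pi> i))) \<le> q * (H ^ k * C ^ \<delta>)" .
  qed
  finally have "cmod \<Delta> \<le> q * B" by (simp only: B_def ac_simps)
  then have "cmod \<Delta> * B ^ (d - 1) \<le> q * B * B ^ (d - 1)" using B by (intro mult_right_mono) auto
  also have "\<dots> = B ^ d * q"
  proof -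
    have "d = Suc (d - 1)" using number_field_dim_pos[OF L] by (simp add: d L_def)
    then have "B ^ d = B * B ^ (d - 1)" by (metis power_Suc)
    then show ?thesis by (simp only: ac_simps)
  qed
  finally show ?thesis using norm_ge by (simp only: B_def q_def k_def)
qed

text \<open>The product of \<open>1 / \<alpha>\<close> with its denominator is a nonzero algebraic integer and cannot be too small, by the bound for its conjugates. This is
needed because the remainders of the approximation contain powers of \<open>\<alpha>\<close>, while the statement only
involves \<open>1 / \<alpha>\<close>.\<close>

lemma cmod_le_denominator_house:
  assumes K: "number_field K" and \<alpha>: "algebraic \<alpha>" "\<alpha> \<noteq> 0"
  shows "cmod \<alpha> \<le> (real (alg_denominator (1 / \<alpha>)) * max 1 (house (1 / \<alpha>))) ^ rat_complex.dim (field_adjoin K \<alpha>)"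
proof -
  define L where "L = field_adjoin K \<alpha>"
  have L: "number_field L" and \<alpha>L: "\<alpha> \<in> L"
    unfolding L_def by (rule number_field_adjoin[OF K \<alpha>(1)])+
  note Ls = number_field_subfield[OF L]
  have z: "1 / \<alpha> \<in> L" using complex_subfieldD(6)[OF Ls \<alpha>L] by (simp add: inverse_eq_divide)
  have alg: "algebraic (1 / \<alpha>)" by (rule number_field_algebraic[OF L z])
  define D0 where "D0 = alg_denominator (1 / \<alpha>)"
  define t where "t = max 1 (house (1 / \<alpha>))"
  have D0: "1 \<le> D0" "algebraic_int (of_nat D0 * (1 / \<alpha>))"
    unfolding D0_def by (rule alg_denominator[OF alg])+
  have D0L: "of_nat D0 \<in> L" using complex_subfield_of_int[OF Ls, of "int D0"] by simp
  have t: "1 \<le> t" by (simp add: t_def)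
  have B: "1 \<le> real D0 * t" using mult_mono[of 1 "real D0" 1 t] D0(1) t by simp
  have y: "of_nat D0 * (1 / \<alpha>) \<in> L" by (rule complex_subfieldD(4)[OF Ls D0L z])
  have "1 \<le> cmod (of_nat D0 * (1 / \<alpha>)) * (real D0 * t) ^ (rat_complex.dim L - 1)"
  proof (rule product_of_conjugates_ge_1[OF L y _ D0(2) B])
    show "of_nat D0 * (1 / \<alpha>) \<noteq> 0" using D0(1) \<alpha>(2) by simp
    fix \<sigma> assume \<sigma>: "field_embedding L \<sigma>"
    have "cmod (\<sigma> (1 / \<alpha>)) \<le> house (1 / \<alpha>)"
      by (rule cmod_le_house[OF alg embedding_in_galois_conjugates[OF Ls \<sigma> z alg]])
    then have "cmod (\<sigma> (1 / \<alpha>)) \<le> t" by (simp add: t_def)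
    moreover have "\<sigma> (of_nat D0) = of_nat D0" using embedding_of_int[OF Ls \<sigma>, of "int D0"] by simp
    then have "\<sigma> (of_nat D0 * (1 / \<alpha>)) = of_nat D0 * \<sigma> (1 / \<alpha>)"
      using embedding_mult[OF Ls \<sigma> D0L z] by simp
    ultimately show "cmod (\<sigma> (of_nat D0 * (1 / \<alpha>))) \<le> real D0 * t"
      by (simp add: norm_mult mult_left_mono)
  qed
  then have "cmod \<alpha> \<le> real D0 * (real D0 * t) ^ (rat_complex.dim L - 1)"
    using \<alpha>(2) by (simp add: norm_mult norm_divide field_simps)
  also have "\<dots> \<le> (real D0 * t) * (real D0 * t) ^ (rat_complex.dim L - 1)"
    using t mult_left_mono[OF t, of "real D0"] by (intro mult_right_mono) auto
  also have "\<dots> = (real D0 * t) ^ rat_complex.dim L"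
    using number_field_dim_pos[OF L] by (simp flip: power_Suc)
  finally show ?thesis by (simp add: D0_def t_def L_def)
qed

section \<open>The choice of the parameter\<close>

lemma power_self_le_fact_mult_exp: "real m ^ m \<le> fact m * exp 1 ^ m"
proof -
  have "(\<Sum>k\<in>{m}. real m ^ k / fact k) \<le> (\<Sum>k. real m ^ k / fact k)"
    by (rule sum_le_suminf) (use summable_exp[of "real m"] in \<open>auto simp: field_simps\<close>)
  also have "\<dots> = exp (real m)"
    using exp_converges[of "real m"] by (simp add: sums_iff field_simps)
  finally have "real m ^ m \<le> fact m * exp (real m)"
    by (simp add: field_simps)
  also have "exp (real m) = exp 1 ^ m" by (simp flip: exp_of_nat_mult)
  finally show ?thesis .
qed

lemma ex_fact_ge_geometric: "\<exists>n. u * \<beta> ^ n \<le> (fact n :: real)"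
proof -
  have "(\<lambda>n. u * (inverse (fact n) * \<beta> ^ n)) \<longlonglongrightarrow> u * 0"
    by (intro tendsto_mult tendsto_const summable_LIMSEQ_zero[OF summable_exp])
  then have "(\<lambda>n. u * (inverse (fact n) * \<beta> ^ n)) \<longlonglongrightarrow> 0" by simp
  then have "\<forall>\<^sub>F n in sequentially. u * (inverse (fact n) * \<beta> ^ n) < 1"
    by (rule order_tendstoD) simp
  then obtain n where "u * (inverse (fact n) * \<beta> ^ n) < 1"
    by (meson eventually_sequentially order_refl)
  then have "u * \<beta> ^ n < fact n" by (simp add: field_simps)
  then show ?thesis by (meson less_imp_le)
qed

text \<open>Let \<open>n = m + 1\<close> be the least admissible parameter and \<open>v = \<beta> e\<close>. By minimality \<open>m! < u \<beta>\<^sup>m\<close>, so that \<open>n! < (m + 1) u \<beta>\<^sup>m\<close>, and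
\<open>m! \<ge> (m / e)\<^sup>m\<close> gives \<open>(m / v)\<^sup>m < u\<close>. If \<open>m > v\<^sup>2\<close> this implies \<open>m ln m < 2 ln u\<close>, which forces
\<open>m \<le> 3 ln u / ln ln (u + 2)\<close>; the gap between \<open>3\<close> and the constant \<open>4\<close> in \<open>T\<close>, together with
\<open>1 + v\<^sup>2\<close>, absorbs the factor \<open>m + 1\<close>. If \<open>m \<le> v\<^sup>2\<close>, the factor \<open>m + 1\<close> is at most \<open>\<beta>\<^sup>5\<close>, and
\<open>5 \<le> 1 + 4 ln u / ln ln (u + 2)\<close>.\<close>

lemma parameter_choice:
  fixes u \<beta> :: real
  assumes u: "2 \<le> u" and \<beta>: "2 \<le> \<beta>"
  defines "T \<equiv> 1 + (\<beta> * exp 1) ^ 2 + 4 * ln u / ln (ln (u + 2))"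
  obtains n where "u * \<beta> ^ n \<le> fact n" "fact n \<le> u * \<beta> powr T" "real n \<le> T"
proof -
  define v where "v = \<beta> * exp 1"
  define w where "w = ln (ln (u + 2))"
  define y where "y = ln u"
  define n where "n = (LEAST n. u * \<beta> ^ n \<le> fact n)"
  have n: "u * \<beta> ^ n \<le> fact n"
    unfolding n_def by (rule LeastI_ex[OF ex_fact_ge_geometric])
  have "n \<noteq> 0" using n u by (cases n) auto
  then obtain m where m: "n = Suc m" by (cases n) auto
  have less: "fact m < u * \<beta> ^ m"
    using not_less_Least[of m "\<lambda>n. u * \<beta> ^ n \<le> fact n"] m by (simp add: n_def)
  have e: "2 \<le> exp (1::real)" "exp (1::real) < 272 / 100"
    using exp_ge_add_one_self[of "1::real"] e_less_272 by simp_all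
  have v: "4 \<le> v" using mult_mono[OF \<beta> e(1)] \<beta> by (simp add: v_def)
  have ln4: "1 < ln (u + 2)"
  proof -
    have "exp 1 < u + 2" using e u by simp
    then show ?thesis using ln_ge_iff[of "u + 2" 1] u by (metis add_pos_nonneg exp_gt_zero exp_less_cancel_iff exp_ln less_trans)
  qed
  then have w: "0 < w" by (simp add: w_def)
  have y: "0 < y" using u by (simp add: y_def)
  have "w \<le> y"
  proof -
    have "(1 + u / 2) ^ 2 \<le> exp (u / 2) ^ 2"
      using exp_ge_add_one_self[of "u / 2"] u by (intro power_mono) auto
    also have "\<dots> = exp u" by (simp add: exp_double[symmetric] power2_eq_square flip: exp_add)
    finally have "(1 + u / 2) ^ 2 \<le> exp u" .
    moreover have "u + 2 \<le> (1 + u / 2) ^ 2"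
      using mult_mono[OF u u] u by (simp add: power2_eq_square field_simps)
    ultimately have "ln (u + 2) \<le> u" using u by (metis add_pos_pos exp_gt_zero ln_exp ln_mono order_trans zero_less_numeral less_le_trans)
    then show ?thesis using ln4 u by (simp add: w_def y_def)
  qed
  then have yw: "1 \<le> y / w" using w by simp
  have T: "T = 1 + v ^ 2 + 4 * (y / w)" by (simp add: T_def v_def w_def y_def)
  have \<beta>1: "1 \<le> \<beta>" using \<beta> by simp
  have main: "real (Suc m) * \<beta> ^ m \<le> \<beta> powr T \<and> real (Suc m) \<le> T"
  proof (cases "real m \<le> v ^ 2")
    case True
    have "exp 1 ^ 2 \<le> (272 / 100 :: real) ^ 2" using e by (intro power_mono) auto
    then have "v ^ 2 \<le> 74 / 10 * \<beta> ^ 2"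
      unfolding v_def power_mult_distrib using \<beta> by (simp add: mult.commute power2_eq_square)
    moreover have "4 \<le> \<beta> ^ 2" using power_mono[OF \<beta>, of 2] by simp
    ultimately have "real (Suc m) \<le> 8 * \<beta> ^ 2" using True by simp
    also have "\<dots> \<le> \<beta> ^ 3 * \<beta> ^ 2"
      using power_mono[OF \<beta>, of 3] by (intro mult_right_mono) auto
    also have "\<dots> = \<beta> powr 5" using \<beta> by (simp add: powr_realpow flip: power_add)
    finally have m1: "real (Suc m) \<le> \<beta> powr 5" .
    have "real (Suc m) * \<beta> ^ m \<le> \<beta> powr 5 * \<beta> powr real m"
      using m1 \<beta> by (intro mult_mono) (auto simp: powr_realpow)
    also have "\<dots> = \<beta> powr (5 + real m)" by (simp add: powr_add)
    also have "\<dots> \<le> \<beta> powr T" using True yw \<beta>1 by (intro powr_mono) (auto simp: T)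
    finally show ?thesis using True yw by (simp add: T)
  next
    case False
    then have mv: "v ^ 2 < real m" by simp
    moreover have "4 ^ 2 \<le> v ^ 2" using v by (intro power_mono) auto
    ultimately have m16: "16 < real m" by simp
    have "real m ^ m \<le> fact m * exp 1 ^ m" by (rule power_self_le_fact_mult_exp)
    also have "\<dots> < (u * \<beta> ^ m) * exp 1 ^ m" using less by (intro mult_strict_right_mono) auto
    also have "\<dots> = u * v ^ m" by (simp add: v_def power_mult_distrib)
    finally have "ln (real m ^ m) < ln (u * v ^ m)"
      using m16 v u by (subst ln_less_cancel_iff) auto
    then have "real m * ln (real m) < y + real m * ln v"
      using m16 v u by (simp add: ln_mult ln_realpow y_def)
    moreover have "ln (v ^ 2) < ln (real m)"
      using mv v m16 by (subst ln_less_cancel_iff) auto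
    then have "2 * ln v < ln (real m)" using v by (simp add: ln_realpow)
    then have "real m * (2 * ln v) < real m * ln (real m)" using m16 by (intro mult_strict_left_mono) auto
    ultimately have mlm: "real m * ln (real m) < 2 * y" by simp
    \<comment> \<open>If \<open>ln m\<close> is small compared to \<open>w\<close>, then \<open>m\<close> is at most a power of \<open>ln (u + 2)\<close> with exponent \<open>2/3\<close>.\<close>
    have wm: "w * real m \<le> 3 * y"
    proof (cases "w \<le> 3 / 2 * ln (real m)")
      case True
      then have "w * real m \<le> 3 / 2 * ln (real m) * real m" by (intro mult_right_mono) auto
      then show ?thesis using mlm by (simp add: mult.commute)
    next
      case False
      then have "ln (real m) < 2 / 3 * w" by simp
      then have "exp (ln (real m)) < exp (2 / 3 * w)" by (simp only: exp_less_cancel_iff)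
      then have "real m < exp (2 / 3 * w)" using m16 by simp
      then have "w * real m \<le> w * exp (2 / 3 * w)" using w by (intro mult_left_mono) auto
      also have "w \<le> 3 / 2 * exp (w / 3)"
      proof -
        have "w / 3 \<le> exp (w / 3 - 1)" using exp_ge_add_one_self[of "w / 3 - 1"] by simp
        also have "\<dots> = exp (w / 3) / exp 1" by (simp add: exp_diff)
        also have "\<dots> \<le> exp (w / 3) / 2" using e(1) by (intro divide_left_mono) auto
        finally show ?thesis by simp
      qed
      then have "w * exp (2 / 3 * w) \<le> 3 / 2 * exp (w / 3) * exp (2 / 3 * w)" by (intro mult_right_mono) auto
      also have "\<dots> = 3 / 2 * exp w" by (simp add: mult.assoc flip: exp_add)
      also have "exp w = ln (u + 2)" using ln4 by (simp add: w_def)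
      also have "3 / 2 * ln (u + 2) \<le> 3 / 2 * ln (u ^ 2)"
      proof -
        have "2 * u \<le> u * u" using u by (intro mult_right_mono) auto
        then have "u + 2 \<le> u ^ 2" unfolding power2_eq_square using u by linarith
        then show ?thesis using u by (subst mult_le_cancel_left_pos) (auto intro: ln_mono)
      qed
      also have "\<dots> = 3 * y" using u by (simp add: y_def ln_realpow)
      finally show ?thesis .
    qed
    then have yw3: "real m \<le> 3 * (y / w)" using w by (simp add: field_simps)
    have "ln (exp 1) \<le> ln ((2::real) ^ 2)" using e(2) by (intro ln_mono) auto
    moreover have "ln ((2::real) ^ 2) = 2 * ln 2" by (subst ln_realpow) auto
    ultimately have ln2: "1 / 2 \<le> ln (2::real)" by simp
    have "1 + real m / 8 \<le> 1 + real m / 4 * ln \<beta>"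
    proof -
      have "ln 2 \<le> ln \<beta>" using \<beta> by simp
      then have "1 / 2 \<le> ln \<beta>" using ln2 by simp
      then have "real m / 4 * (1 / 2) \<le> real m / 4 * ln \<beta>" by (intro mult_left_mono) auto
      then show ?thesis by simp
    qed
    also have "\<dots> \<le> exp (real m / 4 * ln \<beta>)" using exp_ge_add_one_self[of "real m / 4 * ln \<beta>"] by simp
    also have "\<dots> = \<beta> powr (real m / 4)" using \<beta> by (simp add: powr_def)
    finally have m8: "1 + real m / 8 \<le> \<beta> powr (real m / 4)" .
    have "real (Suc m) \<le> 8 * (1 + real m / 8)" by simp
    also have "\<dots> \<le> \<beta> ^ 3 * \<beta> powr (real m / 4)"
      using m8 power_mono[OF \<beta>, of 3] \<beta> by (intro mult_mono) auto
    also have "\<dots> = \<beta> powr (3 + real m / 4)" using \<beta> by (simp add: powr_add powr_realpow)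
    finally have m1: "real (Suc m) \<le> \<beta> powr (3 + real m / 4)" .
    have "real (Suc m) * \<beta> ^ m \<le> \<beta> powr (3 + real m / 4) * \<beta> powr real m"
      using m1 \<beta> by (intro mult_mono) (auto simp: powr_realpow)
    also have "\<dots> = \<beta> powr (3 + real m / 4 + real m)" by (simp only: powr_add)
    also have "\<dots> \<le> \<beta> powr T"
      using yw3 \<beta>1 \<open>4 ^ 2 \<le> v ^ 2\<close> by (intro powr_mono) (auto simp: T)
    finally have "real (Suc m) * \<beta> ^ m \<le> \<beta> powr T" .
    moreover have "real (Suc m) \<le> T"
      unfolding T using yw3 yw zero_le_power2[of v] by linarith
    ultimately show ?thesis ..
  qed
  have "fact n = real (Suc m) * fact m" by (simp add: m)
  also have "\<dots> \<le> real (Suc m) * (u * \<beta> ^ m)" using less by (intro mult_left_mono) auto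
  also have "\<dots> = u * (real (Suc m) * \<beta> ^ m)" by (simp only: ac_simps)
  also have "\<dots> \<le> u * \<beta> powr T" using main u by (intro mult_left_mono) auto
  finally show ?thesis using that[of n] n main by (simp add: m)
qed


text \<open>Both sides have the same logarithm. The
exchange of the roles of \<open>u\<close> and \<open>b\<close> in the exponents comes from
\<open>b\<close> to the power \<open>ln u\<close> being the same as \<open>u\<close> to the power \<open>ln b\<close>.\<close>

lemma target_denominator_eq:
  fixes A H b u \<beta> c d \<delta> D v W :: real
  assumes pos: "0 < A" "1 \<le> H" "0 < b" "0 < D" "0 < d"
    and u: "u = (A * H powr (c * d)) powr (1 / D)"
    and \<beta>: "\<beta> = b powr (d / D)"
  shows "A powr (1 + \<delta> * d / D) * (b powr (d + \<delta> * d ^ 2 / D)) powr (1 + v ^ 2)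
      * u powr ((d + \<delta> * d ^ 2 / D) * (4 * ln b / W))
      * H powr (\<delta> * d ^ 2 * c / D + d * c - 1)
    = u powr (D + \<delta> * d) * (\<beta> powr (1 + v ^ 2 + 4 * ln u / W)) powr (D + \<delta> * d) / H"
proof -
  have H: "0 < H" using pos by simp
  have up: "0 < u" unfolding u using pos H by simp
  have lu: "ln u = (ln A + c * d * ln H) / D"
    unfolding u using pos H by (simp add: ln_powr ln_mult)
  have l\<beta>: "ln \<beta> = d / D * ln b" unfolding \<beta> using pos by (simp add: ln_powr)
  have \<beta>p: "0 < \<beta>" unfolding \<beta> using pos by simp
  let ?L = "A powr (1 + \<delta> * d / D) * (b powr (d + \<delta> * d ^ 2 / D)) powr (1 + v ^ 2)
      * u powr ((d + \<delta> * d ^ 2 / D) * (4 * ln b / W))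
      * H powr (\<delta> * d ^ 2 * c / D + d * c - 1)"
  let ?R = "u powr (D + \<delta> * d) * (\<beta> powr (1 + v ^ 2 + 4 * ln u / W)) powr (D + \<delta> * d) / H"
  have "ln ?L = (1 + \<delta> * d / D) * ln A + (1 + v ^ 2) * ((d + \<delta> * d ^ 2 / D) * ln b)
      + (d + \<delta> * d ^ 2 / D) * (4 * ln b / W) * ln u + (\<delta> * d ^ 2 * c / D + d * c - 1) * ln H"
    using pos H up by (simp add: ln_mult ln_powr)
  moreover have "ln ?R = (D + \<delta> * d) * ln u + (D + \<delta> * d) * ((1 + v ^ 2 + 4 * ln u / W) * ln \<beta>) - ln H"
    using pos H up \<beta>p by (simp add: ln_mult ln_powr ln_div)
  moreover have "(D + \<delta> * d) * ln u = (1 + \<delta> * d / D) * ln A + (\<delta> * d ^ 2 * c / D + d * c) * ln H"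
    unfolding lu using pos by (simp add: field_simps power2_eq_square)
  moreover have "(D + \<delta> * d) * ((1 + v ^ 2 + 4 * ln u / W) * ln \<beta>)
      = (1 + v ^ 2) * ((d + \<delta> * d ^ 2 / D) * ln b) + (d + \<delta> * d ^ 2 / D) * (4 * ln b / W) * ln u"
  proof -
    have *: "(D + \<delta> * d) * (d / D) = d + \<delta> * d ^ 2 / D" using pos by (simp add: field_simps power2_eq_square)
    have "(D + \<delta> * d) * ((1 + v ^ 2 + 4 * ln u / W) * ln \<beta>)
        = ((D + \<delta> * d) * (d / D)) * ((1 + v ^ 2 + 4 * ln u / W) * ln b)"
      unfolding l\<beta> by (simp only: ac_simps)
    moreover have "k * ((1 + v ^ 2 + 4 * ln u / W) * ln b)
        = (1 + v ^ 2) * (k * ln b) + k * (4 * ln b / W) * ln u" for k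
      by (simp add: algebra_simps)
    ultimately show ?thesis unfolding * by simp
  qed
  ultimately have "ln ?L = ln ?R" by (simp add: left_diff_distrib)
  moreover have "0 < ?L" "0 < ?R" using pos H up \<beta>p by simp_all
  ultimately show ?thesis using ln_inj_iff by blast
qed

section \<open>The lower bound\<close>

lemma fact_power_le_fact: "(fact n :: real) ^ r \<le> fact (r * n)"
proof (induction r)
  case (Suc r)
  have "(fact n * fact (r * n) :: nat) \<le> fact (n + r * n)"
    using fact_fact_dvd_fact[of n "r * n", where 'a = nat] by (rule dvd_imp_le) simp
  then have "real (fact n * fact (r * n)) \<le> real (fact (n + r * n))" by (simp only: of_nat_le_iff)
  then have "(fact n * fact (r * n) :: real) \<le> fact (n + r * n)" by simp
  moreover have "(fact n :: real) * fact n ^ r \<le> fact n * fact (r * n)"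
    using Suc by (intro mult_left_mono) auto
  ultimately show ?case by (simp only: power_Suc mult_Suc)
qed simp

theorem proposition1:
  fixes K :: "complex set" and \<alpha> :: complex and P :: "complex poly"
    and d \<delta> p q :: nat and H t a b u v \<psi> :: real
  assumes "number_field K"
    and "algebraic \<alpha>" and "\<alpha> \<noteq> 0"
    and "d = rat_complex.dim (field_adjoin K \<alpha>)"
    and "1 \<le> H" and "1 \<le> \<delta>" and "d * \<delta> \<le> p"
    and "\<forall>j. coeff P j \<in> ring_of_integers K" and "P \<noteq> 0"
    and "degree P \<le> \<delta>" and "poly_height P \<le> H"
    and "q = Lcm {1..p} * alg_denominator (1 / \<alpha>)"
    and "t = max 1 (house (1 / \<alpha>))"
    and "a = fact (p + 1) * exp (cmod \<alpha> * real p * (real p + 1) / 2) * (2 * real q * t) ^ (p * \<delta>)"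
    and "b = (2 * real q * t) ^ ((p + 1) * \<delta>)"
    and "u = (2 * a ^ d * H powr ((real p - real \<delta> + 1) * real d))
               powr (1 / (real p - real d * real \<delta> + 1))"
    and "v = b powr (real d / (real p - real d * real \<delta> + 1)) * exp 1"
    and "\<psi> = real \<delta> * real d ^ 2 * (real p - real \<delta> + 1) / (real p - real \<delta> * real d + 1)
               + real d * (real p - real \<delta> + 1) - 1"
  shows "cmod (poly P (exp \<alpha>)) \<ge>
    1 / ((2 * a ^ d) powr (1 + real \<delta> * real d / (real p - real d * real \<delta> + 1))
         * (b powr (real d + real \<delta> * real d ^ 2 / (real p - real d * real \<delta> + 1))) powr (1 + v ^ 2)
         * u powr ((real d + real \<delta> * real d ^ 2 / (real p - real d * real \<delta> + 1))
                     * (4 * ln b / ln (ln (u + 2))))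
         * H powr \<psi>)"
proof -
  define \<Lambda> where "\<Lambda> = Lcm {1..p}"
  define D0 where "D0 = alg_denominator (1 / \<alpha>)"
  define L where "L = field_adjoin K \<alpha>"
  define D where "D = p + 1 - d * \<delta>"
  define k where "k = Suc p - \<delta>"
  define Z where "Z = 2 * real q * t"
  define G where "G = real D0 * t"
  have L: "number_field L" and \<alpha>L: "\<alpha> \<in> L"
    unfolding L_def by (rule number_field_adjoin[OF assms(1,2)])+
  have d1: "1 \<le> d" using number_field_dim_pos[OF L] assms(4) by (simp add: L_def)
  have "1 * \<delta> \<le> d * \<delta>" using d1 by (rule mult_le_mono1)
  then have \<delta>p: "\<delta> \<le> p" using assms(7) by linarith
  have p1: "1 \<le> p" using \<delta>p assms(6) by simp
  have Dr: "real p - real d * real \<delta> + 1 = real D" "real p - real \<delta> * real d + 1 = real D"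
    using assms(7) by (simp_all add: D_def of_nat_diff mult.commute)
  have kr: "real p - real \<delta> + 1 = real k" using \<delta>p by (simp add: k_def of_nat_diff)
  have D1: "1 \<le> D" "D \<le> Suc p" "p + 1 = d * \<delta> + D" using assms(7) by (simp_all add: D_def)
  have "algebraic (1 / \<alpha>)"
    using assms(2) algebraic_inverse[of \<alpha>] by (simp add: inverse_eq_divide)
  then have D0: "1 \<le> D0" unfolding D0_def by (rule alg_denominator(1))
  have \<Lambda>: "1 \<le> \<Lambda>" using Lcm_pos[of p] by (simp add: \<Lambda>_def)
  have t1: "1 \<le> t" using assms(13) by simp
  have qr: "real q = real \<Lambda> * real D0" by (simp add: assms(12) \<Lambda>_def D0_def)
  have G1: "1 \<le> G" using mult_mono[of 1 "real D0" 1 t] D0 t1 by (simp add: G_def)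
  have ZG: "Z = 2 * real \<Lambda> * G" by (simp add: Z_def qr G_def)
  have Z2: "2 \<le> Z" using mult_mono[of 1 "real \<Lambda>" 1 G] \<Lambda> G1 by (simp add: ZG)
  define e2 where "e2 = exp (cmod \<alpha> * real p * (real p + 1) / 2)"
  have aeq: "a = fact (Suc p) * e2 * Z ^ (p * \<delta>)"
    by (simp only: assms(14) e2_def Z_def Suc_eq_plus1)
  have beq: "b = Z ^ (Suc p * \<delta>)" by (simp add: assms(15) Z_def)
  have e2: "1 \<le> e2" "exp (real p * cmod \<alpha>) \<le> e2"
  proof -
    have "0 \<le> cmod \<alpha> * real p * (real p + 1) / 2" by simp
    then show "1 \<le> e2" by (simp add: e2_def)
    have "real p * cmod \<alpha> * 2 \<le> real p * cmod \<alpha> * (real p + 1)"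
      using p1 by (intro mult_left_mono) auto
    then show "exp (real p * cmod \<alpha>) \<le> e2" by (simp add: e2_def mult_ac)
  qed
  have Z1: "1 \<le> Z ^ m" for m using Z2 by (intro one_le_power) simp
  have a_big: "2 ^ (p * \<delta>) \<le> a"
  proof -
    have "1 * 1 * 2 ^ (p * \<delta>) \<le> fact (Suc p) * e2 * Z ^ (p * \<delta>)"
      using e2(1) Z2 by (intro mult_mono power_mono) (auto simp del: fact_Suc)
    then show ?thesis by (simp add: aeq)
  qed
  then have a1: "1 \<le> a" by (rule order.trans[rotated]) simp
  have b1: "1 \<le> b" unfolding beq by (rule Z1)
  define \<beta> where "\<beta> = b powr (real d / real D)"
  have \<beta>D: "\<beta> powr real D = b ^ d"
    using D1(1) b1 by (simp add: \<beta>_def powr_powr powr_realpow)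
  have \<beta>pos: "0 < \<beta>" using b1 by (simp add: \<beta>_def)
  have le_powrI: "2 \<le> x" if "2 ^ D \<le> x powr real D" "0 < x" for x :: real
  proof (rule ccontr)
    assume "\<not> 2 \<le> x"
    then have "x ^ D < 2 ^ D" using that(2) D1(1) by (intro power_strict_mono) auto
    then show False using that by (simp add: powr_realpow)
  qed
  have ueq: "u = (2 * a ^ d * H powr (real k * real d)) powr (1 / real D)"
    by (simp only: assms(16) kr Dr)
  have H0: "0 < H" using assms(5) by simp
  have HH: "H powr (real k * real d) = (H ^ k) ^ d"
    using H0 by (simp add: powr_realpow flip: power_mult of_nat_mult)
  have upos: "0 < u" using a1 H0 by (simp add: ueq)
  have uD: "u powr real D = 2 * a ^ d * (H ^ k) ^ d"
    unfolding ueq HH using D1(1) a1 H0 by (simp add: powr_powr)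
  have \<beta>2: "2 \<le> \<beta>"
  proof (rule le_powrI[OF _ \<beta>pos])
    have "(2::real) ^ D \<le> 2 ^ (Suc p * \<delta> * d)"
    proof (rule power_increasing)
      have "Suc p * 1 * 1 \<le> Suc p * \<delta> * d" using assms(6) d1 by (intro mult_le_mono) auto
      then show "D \<le> Suc p * \<delta> * d" using D1(2) by simp
    qed simp
    also have "\<dots> \<le> Z ^ (Suc p * \<delta> * d)" using Z2 by (intro power_mono) auto
    also have "\<dots> = b ^ d" by (simp only: beq power_mult)
    finally show "2 ^ D \<le> \<beta> powr real D" by (simp only: \<beta>D)
  qed
  have u2: "2 \<le> u"
  proof (rule le_powrI[OF _ upos])
    have "(2::real) ^ D \<le> 2 ^ (Suc (p * \<delta> * d))"
    proof (rule power_increasing)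
      have "p * 1 * 1 \<le> p * \<delta> * d" using assms(6) d1 by (intro mult_le_mono) auto
      then show "D \<le> Suc (p * \<delta> * d)" using D1(2) by linarith
    qed simp
    also have "\<dots> = 2 * (2 ^ (p * \<delta>)) ^ d * 1" by (simp only: power_Suc power_mult mult_1_right)
    also have "\<dots> \<le> 2 * a ^ d * (H ^ k) ^ d"
      using a_big a1 assms(5) by (intro mult_mono power_mono) (auto simp: one_le_power)
    finally show "2 ^ D \<le> u powr real D" by (simp only: uD)
  qed
  define W where "W = ln (ln (u + 2))"
  have veq: "v = \<beta> * exp 1" by (simp only: assms(17) \<beta>_def Dr)
  define T where "T = 1 + v ^ 2 + 4 * ln u / W"
  obtain n where n: "u * \<beta> ^ n \<le> fact n" "fact n \<le> u * \<beta> powr T" "real n \<le> T"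
    using parameter_choice[OF u2 \<beta>2] unfolding T_def W_def veq by blast
  define N where "N = Suc p * n"
  define C where "C = fact n * (2 * real \<Lambda>) ^ N * G ^ n"
  define S where "S = real \<Lambda> ^ N * real D0 ^ n * fact n * inverse (cmod \<alpha>) ^ n *
        (cmod \<alpha> ^ N / fact (N) * exp (real p * cmod \<alpha>))"
  define Bc where "Bc = fact (Suc p) * (H ^ k * C ^ \<delta>)"
  define Y where "Y = exp (real p * cmod \<alpha>) * cmod (poly P (exp \<alpha>))"
  define Q where "Q = a ^ d * ((H ^ k) ^ d * (fact n ^ \<delta> * b ^ n) ^ d)"
  have main: "1 \<le> Bc ^ d * (Y / H + S / C)"
    unfolding Bc_def k_def C_def S_def Y_def N_def \<Lambda>_def G_def D0_def assms(13)
    by (rule determinant_inequality[OF assms(1,2,3,4,5,6) \<delta>p _ assms(9,10,11)]) (use assms(8) in blast)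
  have Gpos: "0 < G" using G1 by simp
  have Cpos: "0 < C" using \<Lambda> Gpos by (simp add: C_def)
  have \<alpha>0: "0 < cmod \<alpha>" using assms(3) by simp
  have \<alpha>G: "cmod \<alpha> \<le> G ^ d"
    using cmod_le_denominator_house[OF assms(1,2,3)] by (simp add: G_def D0_def assms(4,13))
  have bn: "((2 * real \<Lambda>) ^ N * G ^ N) ^ \<delta> = b ^ n"
  proof -
    have "(2 * real \<Lambda>) ^ N * G ^ N = Z ^ N" by (simp only: ZG power_mult_distrib)
    moreover have "(Z ^ N) ^ \<delta> = b ^ n"
      by (simp only: beq N_def power_mult[symmetric] ac_simps)
    ultimately show ?thesis by (simp only:)
  qed
  have C_le: "C ^ \<delta> \<le> fact n ^ \<delta> * b ^ n"
  proof -
    have "G ^ n \<le> G ^ N" using G1 by (intro power_increasing) (auto simp: N_def)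
    then have "C \<le> fact n * (2 * real \<Lambda>) ^ N * G ^ N"
      unfolding C_def by (intro mult_left_mono) auto
    then have "C ^ \<delta> \<le> (fact n * ((2 * real \<Lambda>) ^ N * G ^ N)) ^ \<delta>"
      using Cpos by (intro power_mono) (auto simp: mult.assoc)
    then show ?thesis by (simp only: power_mult_distrib[of "fact n"] bn)
  qed
  \<comment> \<open>The exponent of \<open>G\<close> in \<open>C\<close> is only \<open>n\<close>, whereas \<open>b\<close> provides \<open>N = n + p n\<close>. The difference
    pays for the factor \<open>\<bar>\<alpha>\<bar>\<^sup>p\<^sup>n\<close> of the remainders.\<close>
  have C\<alpha>_le: "(C ^ \<delta>) ^ d * cmod \<alpha> ^ (p * n) \<le> (fact n ^ \<delta> * b ^ n) ^ d"
  proof -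
    have "cmod \<alpha> ^ (p * n) \<le> (G ^ d) ^ (p * n)" using \<alpha>G by (intro power_mono) auto
    also have "\<dots> = G ^ (p * n * d)" by (simp add: mult_ac flip: power_mult)
    also have "\<dots> \<le> G ^ (p * n * \<delta> * d)"
      using G1 assms(6) by (intro power_increasing) auto
    finally have "(C ^ \<delta>) ^ d * cmod \<alpha> ^ (p * n) \<le> (C ^ \<delta>) ^ d * G ^ (p * n * \<delta> * d)"
      using Cpos by (intro mult_left_mono) auto
    also have "\<dots> = ((C * G ^ (p * n)) ^ \<delta>) ^ d"
      by (simp only: power_mult_distrib power_mult)
    also have "C * G ^ (p * n) = fact n * ((2 * real \<Lambda>) ^ N * G ^ N)"
      by (simp add: C_def N_def power_add mult_ac)
    finally show ?thesis by (simp only: power_mult_distrib[of "fact n"] bn)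
  qed
  have fact_a: "fact (Suc p) ^ d * exp (real p * cmod \<alpha>) \<le> a ^ d"
  proof -
    have "e2 \<le> e2 ^ d" using power_increasing[of 1 d e2] e2(1) d1 by simp
    then have "exp (real p * cmod \<alpha>) \<le> e2 ^ d" using e2(2) by simp
    then have "fact (Suc p) ^ d * exp (real p * cmod \<alpha>) * 1 \<le> fact (Suc p) ^ d * e2 ^ d * (Z ^ (p * \<delta>)) ^ d"
      using one_le_power[OF Z1[of "p * \<delta>"], of d] e2(1) by (intro mult_mono) (auto simp del: fact_Suc)
    then show ?thesis by (simp add: aeq power_mult_distrib del: fact_Suc)
  qed
  have "Bc ^ d * exp (real p * cmod \<alpha>) =
      (fact (Suc p) ^ d * exp (real p * cmod \<alpha>)) * ((H ^ k) ^ d * (C ^ \<delta>) ^ d)"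
    by (simp only: Bc_def power_mult_distrib ac_simps)
  also have "\<dots> \<le> Q"
    unfolding Q_def using fact_a C_le Cpos H0 a1 by (intro mult_mono power_mono) auto
  finally have Q: "Bc ^ d * exp (real p * cmod \<alpha>) \<le> Q" .
  have Q2: "2 * Q = (u powr real D) * (fact n ^ (\<delta> * d) * (\<beta> powr real D) ^ n)"
    unfolding uD \<beta>D Q_def by (simp add: power_mult_distrib mult_ac flip: power_mult)
  \<comment> \<open>The condition \<open>n! \<ge> u \<beta>\<^sup>n\<close> makes the contribution of the approximants at most one half.\<close>
  have small: "Bc ^ d * (S / C) \<le> 1 / 2"
  proof -
    have SC: "S / C \<le> cmod \<alpha> ^ (p * n) * exp (real p * cmod \<alpha>) / fact n ^ Suc p"
    proof -
      have \<alpha>N: "inverse (cmod \<alpha>) ^ n * cmod \<alpha> ^ N = cmod \<alpha> ^ (p * n)"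
        using \<alpha>0 by (simp add: N_def power_add field_simps)
      have "S / C = (real \<Lambda> ^ N * real D0 ^ n * fact n) * (inverse (cmod \<alpha>) ^ n * cmod \<alpha> ^ N
          * exp (real p * cmod \<alpha>)) / ((real \<Lambda> ^ N * real D0 ^ n * fact n) * (2 ^ N * t ^ n * fact (N)))"
        by (simp add: S_def C_def G_def power_mult_distrib mult_ac)
      also have "\<dots> = cmod \<alpha> ^ (p * n) * exp (real p * cmod \<alpha>) / (2 ^ N * t ^ n * fact (N))"
        unfolding \<alpha>N using \<Lambda> D0 by simp
      also have "\<dots> \<le> cmod \<alpha> ^ (p * n) * exp (real p * cmod \<alpha>) / fact n ^ Suc p"
      proof (rule divide_left_mono)
        have "1 * 1 * fact n ^ Suc p \<le> 2 ^ N * t ^ n * fact (N)"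
          using fact_power_le_fact[of n "Suc p"] t1
          by (intro mult_mono one_le_power) (auto simp: N_def simp del: power_Suc)
        then show "fact n ^ Suc p \<le> 2 ^ N * t ^ n * fact (N)" by simp
      qed (use t1 in auto)
      finally show ?thesis .
    qed
    have "Bc ^ d * (S / C) \<le> Bc ^ d * (cmod \<alpha> ^ (p * n) * exp (real p * cmod \<alpha>) / fact n ^ Suc p)"
      using SC Cpos H0 by (intro mult_left_mono) (auto simp: Bc_def)
    also have "\<dots> = (fact (Suc p) ^ d * exp (real p * cmod \<alpha>)) *
        ((H ^ k) ^ d * ((C ^ \<delta>) ^ d * cmod \<alpha> ^ (p * n))) / fact n ^ Suc p"
      by (simp only: Bc_def power_mult_distrib times_divide_eq_right ac_simps)
    also have "\<dots> \<le> Q / fact n ^ Suc p"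
      unfolding Q_def using fact_a C\<alpha>_le Cpos H0 a1
      by (intro divide_right_mono mult_mono) auto
    also have "\<dots> \<le> 1 / 2"
    proof -
      have "u powr real D * (\<beta> powr real D) ^ n = (u * \<beta> ^ n) ^ D"
        using upos \<beta>pos by (simp add: powr_realpow power_mult_distrib mult.commute flip: power_mult)
      also have "\<dots> \<le> fact n ^ D" using n(1) upos \<beta>pos by (intro power_mono) auto
      finally have "u powr real D * (\<beta> powr real D) ^ n * fact n ^ (\<delta> * d) \<le> fact n ^ D * fact n ^ (\<delta> * d)"
        by (intro mult_right_mono) auto
      then have "2 * Q \<le> fact n ^ (D + \<delta> * d)" unfolding Q2 power_add by (simp only: ac_simps)
      also have "D + \<delta> * d = Suc p" using D1(3) by (simp add: mult.commute)
      finally show ?thesis by (simp add: field_simps del: power_Suc)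
    qed
    finally show ?thesis .
  qed
  define E where "E = real D + real \<delta> * real d"
  define R where "R = u powr E * (\<beta> powr T) powr E"
  \<comment> \<open>Replacing \<open>n!\<close> by \<open>u \<beta>\<^sup>T\<close> and \<open>n\<close> by \<open>T\<close> leaves a quantity that depends on the data only.\<close>
  have Q_le: "2 * Q \<le> R"
  proof -
    have "(fact n :: real) ^ (\<delta> * d) \<le> (u * \<beta> powr T) ^ (\<delta> * d)" using n(2) by (intro power_mono) auto
    also have "\<dots> = u powr (real \<delta> * real d) * (\<beta> powr T) powr (real \<delta> * real d)"
      using upos \<beta>pos by (simp add: power_mult_distrib powr_realpow flip: of_nat_mult)
    finally have 1: "(fact n :: real) ^ (\<delta> * d) \<le> u powr (real \<delta> * real d) * (\<beta> powr T) powr (real \<delta> * real d)" .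
    have "(\<beta> powr real D) ^ n = (\<beta> powr real n) powr real D"
      using \<beta>pos by (simp add: powr_powr mult.commute flip: powr_realpow)
    also have "\<dots> \<le> (\<beta> powr T) powr real D"
      using n(3) \<beta>2 by (intro powr_mono2 powr_mono) auto
    finally have 2: "(\<beta> powr real D) ^ n \<le> (\<beta> powr T) powr real D" .
    have "2 * Q \<le> u powr real D * ((u powr (real \<delta> * real d) * (\<beta> powr T) powr (real \<delta> * real d))
        * (\<beta> powr T) powr real D)"
      unfolding Q2 using 1 2 by (intro mult_left_mono mult_mono) auto
    also have "\<dots> = R" by (simp only: R_def E_def powr_add ac_simps)
    finally show ?thesis .
  qed
  have Qpos: "0 < Q" using a1 b1 H0 by (simp add: Q_def)
  have "1 / 2 \<le> Bc ^ d * (Y / H)"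
    using main small unfolding distrib_left by linarith
  also have "\<dots> = (Bc ^ d * exp (real p * cmod \<alpha>)) * cmod (poly P (exp \<alpha>)) / H"
    by (simp add: Y_def)
  also have "\<dots> \<le> Q * cmod (poly P (exp \<alpha>)) / H"
    using Q H0 by (intro divide_right_mono mult_right_mono) auto
  finally have "H \<le> 2 * Q * cmod (poly P (exp \<alpha>))" using H0 by (simp add: field_simps)
  also have "\<dots> \<le> R * cmod (poly P (exp \<alpha>))" using Q_le by (intro mult_right_mono) auto
  finally have "1 / (R / H) \<le> cmod (poly P (exp \<alpha>))"
    using H0 upos \<beta>pos by (simp add: R_def field_simps)
  moreover have "(2 * a ^ d) powr (1 + real \<delta> * real d / real D)
      * (b powr (real d + real \<delta> * real d ^ 2 / real D)) powr (1 + v ^ 2)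
      * u powr ((real d + real \<delta> * real d ^ 2 / real D) * (4 * ln b / W))
      * H powr (real \<delta> * real d ^ 2 * real k / real D + real d * real k - 1) = R / H"
    unfolding R_def E_def T_def
    by (rule target_denominator_eq[OF _ assms(5) _ _ _ ueq \<beta>_def]) (use a1 b1 D1(1) d1 in auto)
  ultimately show ?thesis
    unfolding assms(18) Dr kr W_def by simp
qed

end
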